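(* Let either $\beta \in [0,\infty)$ and $m = 1$, or $\beta = -1$ and $m \in \mathbb{N}$ with $m > 1$. Let $(T_n)_{n\ge 1}$ be the random tree sequence with parameters $(\beta, m)$, let $P_n$ be the path length of $T_n$, and let $S_0 := 0$ and $S_n := \frac{P_n - \mathbf{E}[P_n]}{n - \beta/(\beta+m)}$ for $n \ge 1$. Then $(S_n)_{n \ge 0}$ is an $L_2$-bounded martingale with respect to the filtration $(\mathcal{F}_n)_{n\ge 0}$. Moreover, denoting by $S$ the almost sure limit of $S_n$, as $n \to \infty$, $$\sqrt{\frac{\beta + m}{m}}\, \sqrt{\frac{n}{\log n}}\, (S_n - S) \to \mathcal{N} \quad \text{in distribution},$$ where $\mathcal{N}$ is a standard normal random variable, and, almost surely, $$\limsup_{n \to \infty} \sqrt{\frac{\beta + m}{2m}}\, \sqrt{\frac{n}{\log n \, \log\log n}}\, (S_n - S) = 1, \qquad \liminf_{n \to \infty} \sqrt{\frac{\beta + m}{2m}}\, \sqrt{\frac{n}{\log n\, \log\log n}}\, (S_n - S) = -1.$$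
   Context: Random tree model with parameters $(\beta,m)$: $(T_n)_{n \ge 1}$ is a sequence of random rooted trees, where $T_n$ has $n$ nodes. $T_1$ consists of a single node, the root. For $n \ge 2$, given $T_1,\dots,T_{n-1}$, a node $v \in T_{n-1}$ is chosen with probability proportional to $\beta d_v + m$, where $d_v$ denotes the number of children (outdegree) of $v$ in $T_{n-1}$, and $T_n$ is obtained from $T_{n-1}$ by attaching a new node (the $n$-th inserted node) as a child of $v$. Nodes are identified by their order of insertion. The depth of a node is its graph distance to the root. The path length $P_n$ of $T_n$ is the sum of the depths of all nodes of $T_n$. Filtration: $\mathcal{F}_0 := \{\emptyset, \Omega\}$ and $\mathcal{F}_n := \sigma(T_1,\dots,T_n)$ for $n \ge 1$. A sequence of random variables $(Y_n)$ is $L_p$-bounded if $\sup_n \mathbf{E}[|Y_n|^p] < \infty$. *)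

theory Defs
  imports "HOL-Probability.Probability"
begin

section \<open>Rooted trees with nodes identified by order of insertion\<close>

text \<open>
  A tree on the nodes \<open>1, \<dots>, n\<close> is recorded by the way it grows: \<open>Attach t v\<close> is \<open>t\<close> with one
  new node, the next unused number, attached as a child of \<open>v\<close>. Two such terms whose attachment
  points are all present nodes are equal iff they are equal as labelled rooted trees.
\<close>

datatype rec_tree = Root | Attach rec_tree nat

primrec num_nodes :: "rec_tree \<Rightarrow> nat" where
  "num_nodes Root = 1"
| "num_nodes (Attach t v) = Suc (num_nodes t)"

definition nodes :: "rec_tree \<Rightarrow> nat set" where
  "nodes t = {1..num_nodes t}"

text \<open>Edges are directed from parent to child.\<close>

primrec edges :: "rec_tree \<Rightarrow> (nat \<times> nat) set" where
  "edges Root = {}"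
| "edges (Attach t v) = insert (v, Suc (num_nodes t)) (edges t)"

definition outdeg :: "rec_tree \<Rightarrow> nat \<Rightarrow> nat" where
  "outdeg t v = card {w. (v, w) \<in> edges t}"

definition graph_dist :: "rec_tree \<Rightarrow> nat \<Rightarrow> nat \<Rightarrow> nat" where
  "graph_dist t u v = (LEAST k. (u, v) \<in> (edges t \<union> (edges t)\<inverse>) ^^ k)"

definition depth :: "rec_tree \<Rightarrow> nat \<Rightarrow> nat" where
  "depth t v = graph_dist t v 1"

definition path_length :: "rec_tree \<Rightarrow> nat" where
  "path_length t = (\<Sum>v\<in>nodes t. depth t v)"

section \<open>The random tree model\<close>

definition attach_weight :: "real \<Rightarrow> nat \<Rightarrow> rec_tree \<Rightarrow> nat \<Rightarrow> real" where
  "attach_weight \<beta> m t v = \<beta> * real (outdeg t v) + real m"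

text \<open>
  The random trees are \<open>T 1, T 2, \<dots>\<close>; \<open>T 0\<close> plays no role. As the history \<open>T 1, \<dots>, T n\<close> is
  discrete, its conditional laws are given by conditioning on the histories of positive probability.
\<close>

locale random_tree_sequence = prob_space M for M :: "'a measure" +
  fixes \<beta> :: real and m :: nat and T :: "nat \<Rightarrow> 'a \<Rightarrow> rec_tree"
  assumes random_tree: "\<And>n. n \<ge> 1 \<Longrightarrow> T n \<in> measurable M (count_space UNIV)"
    and initial: "AE \<omega> in M. T 1 \<omega> = Root"
    and growth: "\<And>n t v. n \<ge> 1 \<Longrightarrow> \<P>(\<omega> in M. \<forall>i\<in>{1..n}. T i \<omega> = t i) > 0 \<Longrightarrow> v \<in> nodes (t n) \<Longrightarrow>
      \<P>(\<omega> in M. T (Suc n) \<omega> = Attach (t n) v \<bar> \<forall>i\<in>{1..n}. T i \<omega> = t i)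
        = attach_weight \<beta> m (t n) v / (\<Sum>u\<in>nodes (t n). attach_weight \<beta> m (t n) u)"

text \<open>For \<open>n = 0\<close> the generating family is empty and the result is the trivial \<open>\<sigma>\<close>-algebra.\<close>

definition tree_filtration :: "'a measure \<Rightarrow> (nat \<Rightarrow> 'a \<Rightarrow> rec_tree) \<Rightarrow> nat \<Rightarrow> 'a measure" where
  "tree_filtration M T n = sigma (space M) {T i -` A \<inter> space M | i A. 1 \<le> i \<and> i \<le> n}"

definition normalized_path_length ::
    "'a measure \<Rightarrow> real \<Rightarrow> nat \<Rightarrow> (nat \<Rightarrow> 'a \<Rightarrow> rec_tree) \<Rightarrow> nat \<Rightarrow> 'a \<Rightarrow> real" where
  "normalized_path_length M \<beta> m T n \<omega> =
    (if n = 0 then 0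
     else (real (path_length (T n \<omega>)) - (\<integral>\<omega>'. real (path_length (T n \<omega>')) \<partial>M))
            / (real n - \<beta> / (\<beta> + real m)))"

section \<open>Martingales in discrete time\<close>

definition martingale :: "'a measure \<Rightarrow> (nat \<Rightarrow> 'a measure) \<Rightarrow> (nat \<Rightarrow> 'a \<Rightarrow> real) \<Rightarrow> bool" where
  "martingale M F Y \<longleftrightarrow>
     filtration (space M) F \<and> (\<forall>n. subalgebra M (F n)) \<and>
     (\<forall>n. Y n \<in> borel_measurable (F n)) \<and> (\<forall>n. integrable M (Y n)) \<and>
     (\<forall>i j. i \<le> j \<longrightarrow> (AE \<omega> in M. real_cond_exp M (F i) (Y j) \<omega> = Y i \<omega>))"

definition Lp_bounded :: "'a measure \<Rightarrow> real \<Rightarrow> (nat \<Rightarrow> 'a \<Rightarrow> real) \<Rightarrow> bool" where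
  "Lp_bounded M p Y \<longleftrightarrow> (SUP n. \<integral>\<^sup>+\<omega>. ennreal (\<bar>Y n \<omega>\<bar> powr p) \<partial>M) < \<infinity>"

end

(*
  The centred path length is a sum of martingale increments (d - mu) / (n + 1 - c), where d is the
  depth of the attachment point and mu its conditional mean. The conditional variance V of d
  satisfies a linear recursion up to a martingale, which gives V ~ lam log n almost surely with
  lam = m / (beta + m), and an exponential moment bounds the height by a multiple of log n. On the
  resulting good event the increments are small and their conditional variances are nearly
  deterministic. The central limit theorem follows by telescoping conditional characteristic
  functions. The upper half of the iterated logarithm law is Ville's inequality for exponential
  supermartingales along geometric blocks; for the lower half, Kolmogorov's lower exponential bound
  holds conditionally on each block, so that the probability of never seeing a large block increment
  is bounded by an infinite product that vanishes. As histories take finitely many values, all conditional expectations are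
  finite sums over trees.
*)
theory Submission
  imports Defs "HOL-Real_Asymp.Real_Asymp"
begin

section \<open>Trees grown by attachment\<close>

text \<open>Counting each child at its parent turns the weighted sum of depths into a multiple of
  the path length, so that P_n = (n - c) mu + c (n - 1); this is where the normaliser n - c comes
  from, and S_n is mu centred. The conditional variance of the k-th increment is about lam log k /
  k^2, and summing over k >= n gives the tail variance lam log n / n. The obstacle is that
  logarithmic height and V ~ lam log n hold only from a random time on, while exponential and
  characteristic function estimates need sure bounds. Every estimate is therefore made for a
  modified process: increments at trees that are not \<open>good\<close> are dropped (upper bound),
  paths with a bad ancestor are discarded (central limit theorem), or bad steps are replaced by
  signs of the predicted variance (lower bound, where dropping them would lose variance). Started
  late enough, a good path sees no modification. The term for a tree contains its whole growth
  history. Stopping rules and partial sums are thus functions of the current tree, and a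
  supermartingale is an inequality for the average \<open>avg\<close> over one attachment.\<close>

primrec dep :: "rec_tree \<Rightarrow> nat \<Rightarrow> nat" where
  "dep Root w = 0"
| "dep (Attach t v) w = (if w = Suc (num_nodes t) then Suc (dep t v) else dep t w)"

text \<open>Only the trees strictly before the present one are tested, so whether the next tree
  satisfies \<open>past Q\<close> is already decided by \<open>t\<close>. Stopping times are encoded
  through this predicate.\<close>

primrec past :: "(rec_tree \<Rightarrow> bool) \<Rightarrow> rec_tree \<Rightarrow> bool" where
  "past Q Root = True"
| "past Q (Attach t v) = (past Q t \<and> Q t)"

text \<open>A martingale transform as a function of the tree: an increment counts only from size
  \<open>n\<close> on and only if \<open>G\<close> holds before the attachment. The gate is
  predictable, so centred increments stay centred.\<close>

primrec tsum :: "nat \<Rightarrow> (rec_tree \<Rightarrow> bool) \<Rightarrow> (rec_tree \<Rightarrow> nat \<Rightarrow> real) \<Rightarrow> rec_tree \<Rightarrow> real" where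
  "tsum n G y Root = 0"
| "tsum n G y (Attach t v) = tsum n G y t + (if n \<le> num_nodes t \<and> G t then y t v else 0)"

lemma num_nodes_pos [simp]: "0 < num_nodes t"
  by (induction t) auto

lemma num_nodes_ge1 [simp]: "1 \<le> num_nodes t" "Suc 0 \<le> num_nodes t"
  using num_nodes_pos[of t] by linarith+

lemma num_nodes_neq0 [simp]: "num_nodes t \<noteq> 0"
  using num_nodes_pos[of t] by linarith

lemma finite_nodes [simp]: "finite (nodes t)"
  by (simp add: nodes_def)

lemma nodes_Attach: "nodes (Attach t v) = insert (Suc (num_nodes t)) (nodes t)"
  by (auto simp: nodes_def)

lemma new_notin_nodes [simp]: "Suc (num_nodes t) \<notin> nodes t"
  by (simp add: nodes_def)

lemma tsum_le: "num_nodes t \<le> n \<Longrightarrow> tsum n G y t = 0"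
  by (induction t) auto

section \<open>Outdegrees, graph distances and path length of grown trees\<close>

primrec proper :: "rec_tree \<Rightarrow> bool" where
  "proper Root = True"
| "proper (Attach t v) = (proper t \<and> v \<in> nodes t)"

lemma edges_nodes: "proper t \<Longrightarrow> edges t \<subseteq> nodes t \<times> nodes t"
proof (induction t)
  case (Attach t v)
  then have "edges t \<subseteq> nodes t \<times> nodes t" "v \<in> nodes t" by simp_all
  moreover have "nodes t \<subseteq> nodes (Attach t v)" "Suc (num_nodes t) \<in> nodes (Attach t v)"
    by (auto simp: nodes_Attach)
  ultimately show ?case unfolding edges.simps by blast
qed simp

lemma finite_edges [simp]: "finite (edges t)"
  by (induction t) auto

lemma outdeg_Root [simp]: "outdeg Root v = 0"
  by (simp add: outdeg_def)

lemma outdeg_Attach: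
  assumes "proper t"
  shows "outdeg (Attach t v) u = (if u = v then Suc (outdeg t u) else outdeg t u)"
proof (cases "u = v")
  case True
  have eq: "{w. (u, w) \<in> edges (Attach t v)} = insert (Suc (num_nodes t)) {w. (u, w) \<in> edges t}"
    using True by auto
  have "Suc (num_nodes t) \<notin> {w. (u, w) \<in> edges t}"
    using edges_nodes[OF assms] by (auto simp: nodes_def)
  moreover have "finite {w. (u, w) \<in> edges t}"
    by (rule finite_subset[of _ "snd ` edges t"]) force+
  ultimately have "card {w. (u, w) \<in> edges (Attach t v)} = Suc (card {w. (u, w) \<in> edges t})"
    unfolding eq by simp
  then show ?thesis using True unfolding outdeg_def by (simp only: if_True simp_thms)
next
  case False
  then have "{w. (u, w) \<in> edges (Attach t v)} = {w. (u, w) \<in> edges t}" by auto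
  then show ?thesis using False by (simp add: outdeg_def)
qed

lemma outdeg_new:
  assumes "proper t"
  shows "outdeg t (Suc (num_nodes t)) = 0"
proof -
  have "{w. (Suc (num_nodes t), w) \<in> edges t} = {}"
    using edges_nodes[OF assms] by (auto simp: nodes_def)
  then show ?thesis by (simp add: outdeg_def)
qed

lemma dep_one: "dep t 1 = 0"
  by (induction t) simp_all

lemma dep_edge: "proper t \<Longrightarrow> (u, w) \<in> edges t \<Longrightarrow> dep t w = Suc (dep t u)"
proof (induction t)
  case (Attach t v)
  have "u \<in> nodes t" "w \<in> nodes t" if "(u, w) \<in> edges t" using edges_nodes Attach.prems that by auto
  then show ?case using Attach by (auto simp: nodes_def)
qed simp

text \<open>Along an edge, in either direction, \<open>dep\<close> changes by exactly one, so a walk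
  of length \<open>k\<close> cannot lower it by more than \<open>k\<close>. With
  \<open>w = 1\<close> this bounds the distance to the root from below.\<close>

lemma walk_lower:
  assumes "proper t"
  shows "(u, w) \<in> (edges t \<union> (edges t)\<inverse>) ^^ k \<Longrightarrow> dep t u \<le> dep t w + k"
proof (induction k arbitrary: w)
  case (Suc k)
  then obtain x where x: "(u, x) \<in> (edges t \<union> (edges t)\<inverse>) ^^ k" "(x, w) \<in> edges t \<union> (edges t)\<inverse>"
    by auto
  then have "dep t x \<le> dep t w + 1" using dep_edge[OF assms] by fastforce
  then show ?case using Suc.IH[OF x(1)] by linarith
qed simp

text \<open>Following parents upwards gives the walk; its edges survive every later
  attachment.\<close>

lemma walk_upper:
  "proper t \<Longrightarrow> v \<in> nodes t \<Longrightarrow> (v, 1) \<in> (edges t \<union> (edges t)\<inverse>) ^^ dep t v"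
proof (induction t arbitrary: v)
  case Root
  then show ?case by (simp add: nodes_def)
next
  case (Attach t v w)
  let ?R = "edges t \<union> (edges t)\<inverse>" and ?R' = "edges (Attach t v) \<union> (edges (Attach t v))\<inverse>"
  have sub: "?R ^^ k \<subseteq> ?R' ^^ k" for k
  proof (induction k)
    case (Suc k)
    have "?R \<subseteq> ?R'" by auto
    then show ?case using Suc by (simp only: relpow.simps) (rule relcomp_mono)
  qed simp
  show ?case
  proof (cases "w = Suc (num_nodes t)")
    case True
    have "(v, 1) \<in> ?R' ^^ dep t v" using sub Attach by auto
    moreover have "(w, v) \<in> ?R'" using True by simp
    ultimately have "(w, 1) \<in> ?R' ^^ Suc (dep t v)" by (rule relpow_Suc_I2[rotated])
    then show ?thesis using True by simp
  next
    case False
    then have "w \<in> nodes t" using Attach.prems by (auto simp: nodes_Attach)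
    then have "(w, 1) \<in> ?R' ^^ dep t w" using sub Attach by auto
    then show ?thesis using False by simp
  qed
qed

lemma depth_eq_dep:
  assumes "proper t" "v \<in> nodes t"
  shows "depth t v = dep t v"
  unfolding depth_def graph_dist_def
proof (rule Least_equality)
  show "(v, 1) \<in> (edges t \<union> (edges t)\<inverse>) ^^ dep t v" using walk_upper assms by auto
  show "\<And>k. (v, 1) \<in> (edges t \<union> (edges t)\<inverse>) ^^ k \<Longrightarrow> dep t v \<le> k"
    using walk_lower[OF assms(1)] dep_one by fastforce
qed

lemma path_length_Root: "path_length Root = 0"
  using depth_eq_dep[of Root 1] by (simp add: path_length_def nodes_def)

lemma path_length_Attach:
  assumes "proper t" "v \<in> nodes t"
  shows "path_length (Attach t v) = path_length t + dep t v + 1"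
proof -
  have "path_length (Attach t v) = (\<Sum>w\<in>nodes (Attach t v). dep (Attach t v) w)"
    unfolding path_length_def using assms by (intro sum.cong) (auto simp: depth_eq_dep)
  also have "\<dots> = Suc (dep t v) + (\<Sum>w\<in>nodes t. dep t w)"
    by (subst nodes_Attach, subst sum.insert) (auto intro!: sum.cong simp: nodes_def)
  also have "(\<Sum>w\<in>nodes t. dep t w) = path_length t"
    unfolding path_length_def using assms by (intro sum.cong) (auto simp: depth_eq_dep)
  finally show ?thesis by simp
qed

section \<open>The attachment law\<close>

locale tree_params =
  fixes \<beta> :: real and m :: nat
  assumes params: "(0 \<le> \<beta> \<and> m = 1) \<or> (\<beta> = -1 \<and> m > 1)"
begin

text \<open>A tree with \<open>n\<close> nodes has total weight
  \<open>(\<beta> + m) * (n - cc)\<close>. Hence \<open>rho n\<close> is the share of the new total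
  weight that one attachment contributes, and \<open>lam\<close> is the part of this share carried
  by the new node.\<close>

definition cc :: real where "cc = \<beta> / (\<beta> + real m)"
definition lam :: real where "lam = real m / (\<beta> + real m)"
definition rho :: "nat \<Rightarrow> real" where "rho n = 1 / (real n + 1 - cc)"

lemma bm_pos: "\<beta> + real m > 0"
  using params by auto

lemma cc_lam: "cc + lam = 1"
  using bm_pos by (simp add: cc_def lam_def add_divide_distrib[symmetric])

lemma cc_less1: "cc < 1" 
  using bm_pos params by (auto simp: cc_def)

lemma lam_pos: "lam > 0"
  using cc_less1 cc_lam by linarith

lemma rho_pos: "rho n > 0"
  using cc_less1 by (simp add: rho_def)

lemma rho_le: "n \<ge> 1 \<Longrightarrow> rho n \<le> 1 / real n"
  using cc_less1 unfolding rho_def by (intro divide_left_mono) auto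

lemma rho_le1: "n \<ge> 1 \<Longrightarrow> rho n \<le> 1"
  by (rule order_trans[OF rho_le]) auto

text \<open>The trees that the model can produce: for \<open>\<beta> = -1\<close> a node with
  \<open>m\<close> children has weight zero and admits no further child.\<close>

primrec reach :: "rec_tree \<Rightarrow> bool" where
  "reach Root = True"
| "reach (Attach t v) = (reach t \<and> v \<in> nodes t \<and> attach_weight \<beta> m t v > 0)"

lemma reach_proper: "reach t \<Longrightarrow> proper t"
  by (induction t) auto

definition tw :: "rec_tree \<Rightarrow> real" where "tw t = (\<beta> + m) * real (num_nodes t) - \<beta>"

lemma tw_pos: "tw t > 0"
proof -
  have "tw t = (\<beta> + m) * (real (num_nodes t) - 1) + m" by (simp add: tw_def algebra_simps)
  moreover have "(\<beta> + m) * (real (num_nodes t) - 1) \<ge> 0" using bm_pos num_nodes_ge1[of t]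
    by (intro mult_nonneg_nonneg) auto
  moreover have "real m > 0" using params by auto
  ultimately show ?thesis by linarith
qed

lemma attach_weight_nonneg: "reach t \<Longrightarrow> attach_weight \<beta> m t v \<ge> 0"
proof (cases "\<beta> = -1")
  case True
  \<comment> \<open>A node that receives a child had positive weight, that is, fewer than
    \<open>m\<close> children beforehand.\<close>
  have "reach t \<Longrightarrow> outdeg t v \<le> m"
  proof (induction t)
    case (Attach t w)
    then have "attach_weight \<beta> m t w > 0" "reach t" by auto
    then have "real (outdeg t w) < real m" unfolding attach_weight_def True by simp
    then have "outdeg t w < m" by simp
    then show ?case using Attach.IH[OF \<open>reach t\<close>] reach_proper[OF \<open>reach t\<close>] by (auto simp: outdeg_Attach)
  qed simp
  then show "reach t \<Longrightarrow> attach_weight \<beta> m t v \<ge> 0" using True by (simp add: attach_weight_def)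
next
  case False
  then show ?thesis using params by (auto simp: attach_weight_def)
qed

lemma attach_weight_Attach:
  assumes "proper t"
  shows "attach_weight \<beta> m (Attach t v) u = attach_weight \<beta> m t u + (if u = v then \<beta> else 0)"
  using assms by (auto simp: attach_weight_def outdeg_Attach algebra_simps)

lemma attach_weight_new:
  assumes "proper t" "v \<in> nodes t"
  shows "attach_weight \<beta> m (Attach t v) (Suc (num_nodes t)) = m"
  using assms by (auto simp: attach_weight_def outdeg_Attach outdeg_new nodes_def)

definition q :: "rec_tree \<Rightarrow> nat \<Rightarrow> real" where
  "q t v = attach_weight \<beta> m t v / tw t"

text \<open>Conditional expectation over the attachment point given the present tree. Values in a
  real vector space admit the complex exponentials of the central limit theorem.\<close>

definition avg :: "rec_tree \<Rightarrow> (nat \<Rightarrow> 'b::real_vector) \<Rightarrow> 'b" where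
  "avg t g = (\<Sum>v\<in>nodes t. q t v *\<^sub>R g v)"

text \<open>An attachment adds weight \<open>\<beta>\<close> at \<open>v\<close> and a node of
  weight \<open>m\<close> one level deeper; all other weights and depths persist. Every recursion
  for the depth profile is this one with a suitable \<open>f\<close>.\<close>

lemma weighted_sum_Attach:
  fixes f :: "nat \<Rightarrow> real"
  assumes "proper t" "v \<in> nodes t"
  shows "(\<Sum>u\<in>nodes (Attach t v). attach_weight \<beta> m (Attach t v) u * f (dep (Attach t v) u))
    = (\<Sum>u\<in>nodes t. attach_weight \<beta> m t u * f (dep t u)) + \<beta> * f (dep t v) + m * f (Suc (dep t v))"
proof -
  have "(\<Sum>u\<in>nodes (Attach t v). attach_weight \<beta> m (Attach t v) u * f (dep (Attach t v) u))
    = m * f (Suc (dep t v)) + (\<Sum>u\<in>nodes t. attach_weight \<beta> m (Attach t v) u * f (dep (Attach t v) u))"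
    by (subst nodes_Attach, subst sum.insert) (auto simp: attach_weight_new assms)
  also have "(\<Sum>u\<in>nodes t. attach_weight \<beta> m (Attach t v) u * f (dep (Attach t v) u))
    = (\<Sum>u\<in>nodes t. attach_weight \<beta> m t u * f (dep t u) + (if u = v then \<beta> * f (dep t u) else 0))"
    by (intro sum.cong) (auto simp: attach_weight_Attach assms nodes_def algebra_simps)
  also have "\<dots> = (\<Sum>u\<in>nodes t. attach_weight \<beta> m t u * f (dep t u)) + \<beta> * f (dep t v)"
    using assms by (simp add: sum.distrib)
  finally show ?thesis by simp
qed

lemma total_weight:
  "proper t \<Longrightarrow> (\<Sum>u\<in>nodes t. attach_weight \<beta> m t u) = tw t"
proof (induction t)
  case Root
  then show ?case by (simp add: nodes_def attach_weight_def tw_def)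
next
  case (Attach t v)
  then show ?case using weighted_sum_Attach[of t v "\<lambda>_. 1"] by (simp add: tw_def algebra_simps)
qed

lemma q_nonneg: "reach t \<Longrightarrow> q t v \<ge> 0"
  using attach_weight_nonneg[of t v] tw_pos[of t] by (simp add: q_def)

lemma sum_q: "proper t \<Longrightarrow> (\<Sum>v\<in>nodes t. q t v) = 1"
  using total_weight[of t] tw_pos[of t] by (simp add: q_def sum_divide_distrib[symmetric])

lemma avg_const: "reach t \<Longrightarrow> avg t (\<lambda>_. k) = k"
  by (simp add: avg_def scaleR_left.sum[symmetric] sum_q reach_proper)

lemma avg_mono:
  fixes f g :: "nat \<Rightarrow> real"
  assumes "reach t" "\<And>v. v \<in> nodes t \<Longrightarrow> q t v > 0 \<Longrightarrow> f v \<le> g v"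
  shows "avg t f \<le> avg t g"
  unfolding avg_def
proof (rule sum_mono)
  fix v assume v: "v \<in> nodes t"
  show "q t v *\<^sub>R f v \<le> q t v *\<^sub>R g v"
    using assms(2)[OF v] q_nonneg[OF assms(1), of v] by (cases "q t v = 0") (auto intro: mult_left_mono)
qed

lemma avg_cong:
  assumes "\<And>v. v \<in> nodes t \<Longrightarrow> q t v \<noteq> 0 \<Longrightarrow> f v = g v"
  shows "avg t f = avg t g"
  unfolding avg_def by (intro sum.cong) (use assms in force)+

lemma avg_add: "avg t (\<lambda>v. f v + g v) = avg t f + avg t g"
  by (simp add: avg_def scaleR_right_distrib sum.distrib)

lemma avg_diff: "avg t (\<lambda>v. f v - g v) = avg t f - avg t g"
  by (simp add: avg_def scaleR_right_diff_distrib sum_subtractf)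

lemma avg_cmult:
  fixes f :: "nat \<Rightarrow> 'b::real_algebra"
  shows "avg t (\<lambda>v. k * f v) = k * avg t f"
  by (simp add: avg_def sum_distrib_left)

lemma avg_cmult_right:
  fixes f :: "nat \<Rightarrow> 'b::real_algebra"
  shows "avg t (\<lambda>v. f v * k) = avg t f * k"
  by (simp add: avg_def sum_distrib_right)

text \<open>The old law of the attachment depth keeps mass \<open>1 - rho\<close>; the rest is split
  between the chosen depth and the next one with coefficients \<open>cc\<close> and
  \<open>lam\<close>. For \<open>\<beta> = -1\<close> the coefficient \<open>cc\<close> is negative,
  so this split is affine rather than convex.\<close>

lemma avg_Attach:
  fixes f :: "nat \<Rightarrow> real"
  assumes "proper t" "v \<in> nodes t"
  shows "avg (Attach t v) (\<lambda>u. f (dep (Attach t v) u)) =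
    (1 - rho (num_nodes t)) * avg t (\<lambda>u. f (dep t u))
      + rho (num_nodes t) * (cc * f (dep t v) + lam * f (Suc (dep t v)))"
proof -
  let ?b = "\<beta> + real m"
  have tw: "tw (Attach t v) = tw t + ?b" by (simp add: tw_def algebra_simps)
  have twp: "tw t + ?b > 0" using tw_pos[of t] bm_pos by linarith
  have b: "?b > 0" by (rule bm_pos)
  have r: "rho (num_nodes t) = ?b / (tw t + ?b)"
  proof -
    have "(real (num_nodes t) + 1 - cc) = (tw t + ?b) / ?b"
      using b by (simp add: tw_def cc_def field_simps)
    then show ?thesis by (simp add: rho_def)
  qed
  have r1: "1 - rho (num_nodes t) = tw t / (tw t + ?b)" using twp by (simp add: r field_simps)
  have E: "avg s (\<lambda>u. f (dep s u)) = (\<Sum>u\<in>nodes s. attach_weight \<beta> m s u * f (dep s u)) / tw s" for s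
    by (simp add: avg_def q_def sum_divide_distrib)
  have s1: "rho (num_nodes t) * cc = \<beta> / (tw t + ?b)" "rho (num_nodes t) * lam = m / (tw t + ?b)"
    using b twp by (auto simp: r cc_def lam_def)
  have "avg (Attach t v) (\<lambda>u. f (dep (Attach t v) u)) =
     ((\<Sum>u\<in>nodes t. attach_weight \<beta> m t u * f (dep t u)) + \<beta> * f (dep t v) + m * f (Suc (dep t v))) / (tw t + ?b)"
    unfolding E weighted_sum_Attach[OF assms, of f] tw ..
  also have "\<dots> = tw t / (tw t + ?b) * avg t (\<lambda>u. f (dep t u))
     + (\<beta> / (tw t + ?b) * f (dep t v) + m / (tw t + ?b) * f (Suc (dep t v)))"
    using tw_pos[of t] by (simp add: E add_divide_distrib)
  finally show ?thesis unfolding r1 s1[symmetric] by (simp add: algebra_simps)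
qed

section \<open>Conditional mean and variance of the attachment depth\<close>

definition mu :: "rec_tree \<Rightarrow> real" where "mu t = avg t (\<lambda>v. real (dep t v))"
definition vv :: "rec_tree \<Rightarrow> real" where "vv t = avg t (\<lambda>v. (real (dep t v))\<^sup>2) - (mu t)\<^sup>2"

text \<open>
  \<open>mu\<close> and \<open>vv\<close> are the conditional mean and variance of the depth of the attachment point;
  \<open>spl\<close>, with increments \<open>yy\<close>, will turn out to be the paper's \<open>S\<^sub>n\<close> as a function of the tree, and
  \<open>yv\<close> is the centred part of the increment of \<open>vv\<close>.
\<close>

definition yy :: "rec_tree \<Rightarrow> nat \<Rightarrow> real" where
  "yy t v = rho (num_nodes t) * (real (dep t v) - mu t)"

definition spl :: "rec_tree \<Rightarrow> real" where "spl = tsum 1 (\<lambda>_. True) yy"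

lemma spl_Root [simp]: "spl Root = 0" by (simp add: spl_def)
lemma spl_Attach [simp]: "spl (Attach t v) = spl t + yy t v" by (simp add: spl_def)

lemma mu_Root [simp]: "mu Root = 0" by (simp add: mu_def avg_def)
lemma vv_Root [simp]: "vv Root = 0" by (simp add: vv_def avg_def)

text \<open>Since \<open>cc + lam = 1\<close>, the mean moves towards the chosen depth by the
  fraction \<open>rho\<close> and drifts by \<open>rho * lam\<close>. The drift is deterministic, so
  centring \<open>mu\<close> leaves the martingale \<open>spl\<close>.\<close>

lemma mu_Attach:
  assumes "proper t" "v \<in> nodes t"
  shows "mu (Attach t v) = mu t + yy t v + rho (num_nodes t) * lam"
proof -
  have "mu (Attach t v) = (1 - rho (num_nodes t)) * mu t + rho (num_nodes t) * ((cc + lam) * real (dep t v) + lam)"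
    unfolding mu_def by (subst avg_Attach[OF assms, of real]) (simp add: algebra_simps)
  then show ?thesis by (simp add: cc_lam yy_def algebra_simps)
qed

definition yv :: "rec_tree \<Rightarrow> nat \<Rightarrow> real" where
  "yv t v = rho (num_nodes t) * (1 - rho (num_nodes t)) *
     ((real (dep t v) - mu t)\<^sup>2 + 2 * lam * (real (dep t v) - mu t) - vv t)"

text \<open>The increment is split into the centred part \<open>yv\<close>, a drift of order
  \<open>lam / n\<close> that produces the logarithm, and corrections of order \<open>rho\<close>
  squared that become summable once the height is logarithmic.\<close>

lemma vv_Attach:
  assumes "proper t" "v \<in> nodes t"
  defines "r \<equiv> rho (num_nodes t)"
  shows "vv (Attach t v) = vv t + yv t v + (r * lam - r\<^sup>2 * lam\<^sup>2) - r\<^sup>2 * vv t"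
proof -
  let ?d = "real (dep t v)"
  have 1: "avg (Attach t v) (\<lambda>u. (real (dep (Attach t v) u))\<^sup>2) = (1 - r) * (vv t + (mu t)\<^sup>2) + r * (cc * ?d\<^sup>2 + lam * (?d + 1)\<^sup>2)"
    unfolding r_def by (subst avg_Attach[OF assms(1,2), of "\<lambda>k. (real k)\<^sup>2"]) (simp add: vv_def algebra_simps)
  have c: "cc = 1 - lam" using cc_lam by linarith
  show ?thesis
    unfolding vv_def[of "Attach t v"] 1 mu_Attach[OF assms(1,2)] yv_def yy_def r_def[symmetric] c
    by (simp add: algebra_simps power2_eq_square)
qed

lemma avg_dev: "reach t \<Longrightarrow> avg t (\<lambda>v. real (dep t v) - mu t) = 0"
  by (simp add: avg_diff avg_const mu_def)

lemma avg_dev2: "reach t \<Longrightarrow> avg t (\<lambda>v. (real (dep t v) - mu t)\<^sup>2) = vv t"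
proof -
  assume r: "reach t"
  have "(\<lambda>v. (real (dep t v) - mu t)\<^sup>2) = (\<lambda>v. (real (dep t v))\<^sup>2 - (2 * mu t) * real (dep t v) + (mu t)\<^sup>2)"
    by (auto simp: power2_eq_square algebra_simps)
  then have "avg t (\<lambda>v. (real (dep t v) - mu t)\<^sup>2) = avg t (\<lambda>v. (real (dep t v))\<^sup>2) - 2 * mu t * mu t + (mu t)\<^sup>2"
    by (simp only: avg_add avg_diff avg_cmult avg_const[OF r] mu_def)
  then show ?thesis by (simp add: vv_def power2_eq_square)
qed

lemma vv_nonneg: "reach t \<Longrightarrow> vv t \<ge> 0"
  using avg_mono[of t "\<lambda>_. 0" "\<lambda>v. (real (dep t v) - mu t)\<^sup>2"] avg_dev2[of t] avg_const[of t "0::real"] by simp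

lemma avg_yy: "reach t \<Longrightarrow> avg t (yy t) = 0"
  using avg_dev[of t] by (simp add: yy_def[abs_def] avg_cmult)

lemma avg_yy2: "reach t \<Longrightarrow> avg t (\<lambda>v. (yy t v)\<^sup>2) = (rho (num_nodes t))\<^sup>2 * vv t"
  using avg_dev2[of t] by (simp add: yy_def power_mult_distrib avg_cmult)

lemma avg_yv: "reach t \<Longrightarrow> avg t (yv t) = 0"
proof -
  assume r: "reach t"
  show ?thesis unfolding yv_def[abs_def] avg_cmult avg_diff avg_add avg_const[OF r]
    using avg_dev[OF r] avg_dev2[OF r] by (simp add: avg_diff avg_const[OF r])
qed

definition det_mean :: "nat \<Rightarrow> real" where "det_mean n = lam * (\<Sum>k=1..<n. rho k)"

lemma mu_eq_spl: "proper t \<Longrightarrow> mu t = spl t + det_mean (num_nodes t)"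
  proof (induction t)
  case (Attach t v)
  have "{1..<Suc (num_nodes t)} = insert (num_nodes t) {1..<num_nodes t}" using num_nodes_ge1[of t] by auto
  then show ?case using Attach by (simp add: mu_Attach det_mean_def algebra_simps)
qed (simp add: det_mean_def)

text \<open>In the sum of \<open>attach_weight\<close> times depth, counting children at their
  parents turns the sum of outdegree times depth into the path length minus
  \<open>num_nodes t - 1\<close>. Division by \<open>\<beta> + m\<close> gives the formula; here it
  is verified by induction on the growth.\<close>

lemma path_length_mu:
  "proper t \<Longrightarrow> real (path_length t) = (real (num_nodes t) - cc) * mu t + cc * (real (num_nodes t) - 1)"
proof (induction t)
  case Root
  then show ?case by (simp add: path_length_Root)
next
  case (Attach t v)
  then have p: "proper t" "v \<in> nodes t" by auto
  have "real (num_nodes t) + 1 - cc > 0" using cc_less1 by (simp add: add_pos_nonneg)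
  then have r: "(real (num_nodes t) + 1 - cc) * rho (num_nodes t) = 1" by (simp add: rho_def)
  have "(real (num_nodes t) + 1 - cc) * mu (Attach t v) =
     (real (num_nodes t) + 1 - cc) * mu t + ((real (num_nodes t) + 1 - cc) * rho (num_nodes t)) * (real (dep t v) - mu t + lam)"
    unfolding mu_Attach[OF p] yy_def by (simp add: algebra_simps)
  also have "\<dots> = (real (num_nodes t) - cc) * mu t + real (dep t v) + lam"
    unfolding r by (simp add: algebra_simps)
  finally show ?case using Attach.IH[OF p(1)] cc_lam
    by (simp add: path_length_Attach[OF p] algebra_simps)
qed

end

section \<open>The tree-valued Markov chain\<close>

instance rec_tree :: countable by countable_datatype

text \<open>The history of a growing tree is recovered from its last term: \<open>anc t i\<close> is
  its stage with \<open>i\<close> nodes.\<close>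

primrec anc :: "rec_tree \<Rightarrow> nat \<Rightarrow> rec_tree" where
  "anc Root i = Root"
| "anc (Attach t v) i = (if i \<le> num_nodes t then anc t i else Attach t v)"

lemma anc_self: "anc t (num_nodes t) = t"
  by (induction t) auto

context tree_params
begin

definition step :: "rec_tree \<Rightarrow> rec_tree \<Rightarrow> bool" where
  "step t t' \<longleftrightarrow> (\<exists>v\<in>nodes t. t' = Attach t v \<and> attach_weight \<beta> m t v > 0)"

text \<open>Almost every realisation is a \<open>path\<close>, so pathwise arguments become
  statements about a fixed sequence of trees. Index 0 is left free, as in the model.\<close>

definition path :: "(nat \<Rightarrow> rec_tree) \<Rightarrow> bool" where
  "path s \<longleftrightarrow> s 1 = Root \<and> (\<forall>n\<ge>1. step (s n) (s (Suc n)))"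

definition trees :: "nat \<Rightarrow> rec_tree set" where
  "trees n = {t. reach t \<and> num_nodes t = n}"

lemma trees_1: "trees (Suc 0) = {Root}"
proof -
  have "num_nodes t = Suc 0 \<Longrightarrow> t = Root" for t
    by (cases t) auto
  then show ?thesis by (auto simp: trees_def)
qed

lemma trees_Suc:
  assumes "n \<ge> 1"
  shows "trees (Suc n) = (\<lambda>(t, v). Attach t v) ` (SIGMA t:trees n. {v \<in> nodes t. attach_weight \<beta> m t v > 0})"
proof -
  have "t \<in> trees (Suc n) \<Longrightarrow> \<exists>s v. t = Attach s v" for t
    using assms by (cases t) (auto simp: trees_def)
  then show ?thesis by (fastforce simp: trees_def)
qed

lemma finite_trees: "n \<ge> 1 \<Longrightarrow> finite (trees n)"
proof (induction n rule: nat_induct_at_least)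
  case base
  then show ?case by (simp add: trees_1)
next
  case (Suc n)
  then show ?case unfolding trees_Suc[OF Suc.hyps(1)] by (intro finite_imageI finite_SigmaI) auto
qed

lemma step_trees: "t \<in> trees n \<Longrightarrow> step t t' \<Longrightarrow> t' \<in> trees (Suc n)"
  by (auto simp: trees_def step_def)

lemma path_trees:
  assumes "path s" "n \<ge> 1"
  shows "s n \<in> trees n"
  using assms(2)
proof (induction n rule: nat_induct_at_least)
  case base
  then show ?case using assms by (simp add: path_def trees_1)
next
  case (Suc n)
  then show ?case using assms step_trees by (auto simp: path_def)
qed

lemma path_step:
  assumes "path s" "n \<ge> 1"
  obtains v where "v \<in> nodes (s n)" "s (Suc n) = Attach (s n) v" "q (s n) v > 0"
proof -
  obtain v where "v \<in> nodes (s n)" "s (Suc n) = Attach (s n) v" "attach_weight \<beta> m (s n) v > 0"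
    using assms by (auto simp: path_def step_def)
  then show ?thesis using that tw_pos[of "s n"] by (auto simp: q_def)
qed

lemma path_anc:
  assumes "path s" "1 \<le> i" "i \<le> n"
  shows "s i = anc (s n) i"
  using assms(3)
proof (induction n rule: dec_induct)
  case base
  then show ?case using path_trees[OF assms(1,2)] anc_self[of "s i"] by (simp add: trees_def)
next
  case (step n)
  have n: "n \<ge> 1" using step assms by simp
  obtain v where "s (Suc n) = Attach (s n) v" using path_step[OF assms(1) n] .
  moreover have "num_nodes (s n) = n" using path_trees[OF assms(1) n] by (simp add: trees_def)
  ultimately show ?case using step by simp
qed

lemma path_past:
  assumes "path s" "n \<ge> 1"
  shows "past Q (s n) \<longleftrightarrow> (\<forall>k\<in>{1..<n}. Q (s k))"
  using assms(2)
proof (induction n rule: nat_induct_at_least)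
  case base
  then show ?case using assms(1) by (simp add: path_def)
next
  case (Suc n)
  obtain v where "s (Suc n) = Attach (s n) v" using path_step[OF assms(1) Suc.hyps(1)] .
  moreover have "{1..<Suc n} = insert n {1..<n}" using Suc.hyps by auto
  ultimately show ?case using Suc.IH by auto
qed

text \<open>While the gate stays open the gated sum telescopes. This transfers results about a
  modified process to \<open>spl\<close> on good paths.\<close>

lemma path_tsum:
  assumes "path s" "n \<ge> 1" "n \<le> N" "\<And>k. n \<le> k \<Longrightarrow> k < N \<Longrightarrow> G (s k)"
    and F: "\<And>t v. F (Attach t v) = F t + y t v"
  shows "tsum n G y (s N) = F (s N) - F (s n)"
  using assms(3,4)
proof (induction N rule: dec_induct)
  case base
  then show ?case using path_trees[OF assms(1,2)] by (simp add: tsum_le trees_def)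
next
  case (step N)
  have n: "N \<ge> 1" using step assms by simp
  obtain v where "s (Suc N) = Attach (s N) v" using path_step[OF assms(1) n] .
  moreover have "num_nodes (s N) = N" using path_trees[OF assms(1) n] by (simp add: trees_def)
  ultimately show ?case using step by (simp add: F)
qed

end

locale tree_run = random_tree_sequence M \<beta> m T + tree_params \<beta> m
  for M :: "'a measure" and \<beta> :: real and m :: nat and T :: "nat \<Rightarrow> 'a \<Rightarrow> rec_tree"
begin

lemma T_comp:
  assumes "n \<ge> 1" and "\<And>t. f t \<in> space N"
  shows "(\<lambda>\<omega>. f (T n \<omega>)) \<in> measurable M N"
  by (rule measurable_compose[OF random_tree[OF assms(1)]]) (simp add: assms)

lemma T_pred [measurable]: "n \<ge> 1 \<Longrightarrow> Measurable.pred M (\<lambda>\<omega>. P (T n \<omega>))"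
  by (rule T_comp) auto

lemma T_borel: "n \<ge> 1 \<Longrightarrow> (\<lambda>\<omega>. f (T n \<omega>)) \<in> borel_measurable M"
  by (rule T_comp) auto

lemma T_event: "n \<ge> 1 \<Longrightarrow> {\<omega>\<in>space M. P (T n \<omega>)} \<in> events"
  using T_pred[of n P] by simp

lemma T_event_ex:
  assumes "n \<ge> 1"
  shows "{\<omega>\<in>space M. \<exists>k\<ge>n. P k (T k \<omega>)} \<in> events"
proof (intro sets.sets_Collect_countable_Ex)
  show "{\<omega>\<in>space M. n \<le> k \<and> P k (T k \<omega>)} \<in> events" for k
    using T_event[of k "P k"] assms by (cases "n \<le> k") auto
qed

text \<open>The growth rule conditions on the whole history; \<open>hist t\<close> is the event that
  this history is the one encoded in \<open>t\<close>.\<close>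

definition hist :: "rec_tree \<Rightarrow> 'a \<Rightarrow> bool" where
  "hist t \<omega> \<longleftrightarrow> (\<forall>i\<in>{1..num_nodes t}. T i \<omega> = anc t i)"

lemma hist_meas [measurable]: "Measurable.pred M (hist t)"
  unfolding hist_def by (intro pred_intros_finite T_pred) auto

lemma hist_growth:
  assumes "v \<in> nodes t" and that: "reach t"
  shows "prob {\<omega>\<in>space M. T (Suc (num_nodes t)) \<omega> = Attach t v \<and> hist t \<omega>} = q t v * prob {\<omega>\<in>space M. hist t \<omega>}"
\<comment> \<open>The growth rule speaks only of histories of positive probability; for a null
  history both sides vanish.\<close>
proof (cases "prob {\<omega>\<in>space M. hist t \<omega>} = 0")
  case True
  have [measurable]: "Measurable.pred M (\<lambda>\<omega>. T (Suc (num_nodes t)) \<omega> = Attach t v)" by (rule T_pred) simp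
  have "prob {\<omega>\<in>space M. T (Suc (num_nodes t)) \<omega> = Attach t v \<and> hist t \<omega>} \<le> prob {\<omega>\<in>space M. hist t \<omega>}"
    by (intro finite_measure_mono) auto
  then show ?thesis using True by (simp add: measure_le_0_iff)
next
  case False
  let ?n = "num_nodes t"
  have pos: "prob {\<omega>\<in>space M. \<forall>i\<in>{1..?n}. T i \<omega> = anc t i} > 0"
    using False unfolding hist_def zero_less_measure_iff .
  have "cond_prob M (\<lambda>\<omega>. T (Suc ?n) \<omega> = Attach (anc t ?n) v) (\<lambda>\<omega>. \<forall>i\<in>{1..?n}. T i \<omega> = anc t i)
        = attach_weight \<beta> m (anc t ?n) v / (\<Sum>u\<in>nodes (anc t ?n). attach_weight \<beta> m (anc t ?n) u)"
    using pos assms by (intro growth) (auto simp: anc_self)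
  also have "\<dots> = q t v" using total_weight[of t] reach_proper[OF that] by (simp add: anc_self q_def)
  finally show ?thesis using False by (simp add: cond_prob_def anc_self hist_def field_simps)
qed

text \<open>The probabilities of the admissible attachments already sum to the probability of the
  history, so nothing is left for any other next tree.\<close>

lemma AE_hist_step:
  assumes "reach t"
  shows "AE \<omega> in M. hist t \<omega> \<longrightarrow> step t (T (Suc (num_nodes t)) \<omega>)"
proof -
  let ?n = "Suc (num_nodes t)"
  let ?V = "{v\<in>nodes t. attach_weight \<beta> m t v > 0}"
  let ?A = "\<lambda>v. {\<omega>\<in>space M. T ?n \<omega> = Attach t v \<and> hist t \<omega>}"
  have [measurable]: "Measurable.pred M (\<lambda>\<omega>. P (T ?n \<omega>))" for P by (rule T_pred) simp
  have eq: "{\<omega>\<in>space M. hist t \<omega> \<and> step t (T ?n \<omega>)} = (\<Union>v\<in>?V. ?A v)"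
    by (auto simp: step_def)
  have "prob (\<Union>v\<in>?V. ?A v) = (\<Sum>v\<in>?V. prob (?A v))"
    by (rule finite_measure_finite_Union) (auto simp: disjoint_family_on_def)
  also have "\<dots> = (\<Sum>v\<in>?V. q t v * prob {\<omega>\<in>space M. hist t \<omega>})"
    by (intro sum.cong) (auto simp: hist_growth assms)
  also have "\<dots> = (\<Sum>v\<in>nodes t. q t v * prob {\<omega>\<in>space M. hist t \<omega>})"
  proof (intro sum.mono_neutral_left ballI)
    fix v assume "v \<in> nodes t - ?V"
    then have "attach_weight \<beta> m t v = 0" using attach_weight_nonneg[OF assms, of v] by fastforce
    then show "q t v * prob {\<omega>\<in>space M. hist t \<omega>} = 0" by (simp add: q_def)
  qed auto
  also have "\<dots> = prob {\<omega>\<in>space M. hist t \<omega>}"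
    using sum_q[OF reach_proper[OF assms]] by (simp add: sum_distrib_right[symmetric])
  finally have pe: "prob {\<omega>\<in>space M. hist t \<omega> \<and> step t (T ?n \<omega>)} = prob {\<omega>\<in>space M. hist t \<omega>}"
    by (simp add: eq)
  have "prob ({\<omega>\<in>space M. hist t \<omega>} - {\<omega>\<in>space M. hist t \<omega> \<and> step t (T ?n \<omega>)}) =
     prob {\<omega>\<in>space M. hist t \<omega>} - prob {\<omega>\<in>space M. hist t \<omega> \<and> step t (T ?n \<omega>)}"
    by (rule finite_measure_Diff) auto
  then have "prob {\<omega>\<in>space M. hist t \<omega> \<and> \<not> step t (T ?n \<omega>)} = 0"
    using pe by (simp add: set_diff_eq) (smt (verit) Collect_cong)
  then have "AE \<omega> in M. \<not> (hist t \<omega> \<and> \<not> step t (T ?n \<omega>))"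
    by (subst (asm) prob_eq_0) auto
  then show ?thesis by eventually_elim auto
qed

text \<open>The exceptional null sets of the single steps may be united because there are countably
  many trees.\<close>

lemma AE_path: "AE \<omega> in M. path (\<lambda>n. T n \<omega>)"
proof -
  have "AE \<omega> in M. \<forall>t. reach t \<longrightarrow> hist t \<omega> \<longrightarrow> step t (T (Suc (num_nodes t)) \<omega>)"
    unfolding AE_all_countable using AE_hist_step by auto
  with initial show ?thesis
  proof eventually_elim
    case (elim \<omega>)
    have "T n \<omega> \<in> trees n \<and> hist (T n \<omega>) \<omega>" if "n \<ge> 1" for n
      using that
    proof (induction n rule: nat_induct_at_least)
      case base
      then show ?case using elim by (simp add: trees_1 hist_def)
    next
      case (Suc n)
      then have n: "num_nodes (T n \<omega>) = n" "reach (T n \<omega>)" by (auto simp: trees_def)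
      have st: "step (T n \<omega>) (T (Suc n) \<omega>)" using elim(2) Suc.IH n by metis
      then obtain v where v: "T (Suc n) \<omega> = Attach (T n \<omega>) v" by (auto simp: step_def)
      have "hist (T (Suc n) \<omega>) \<omega>" unfolding hist_def
      proof
        fix i assume "i \<in> {1..num_nodes (T (Suc n) \<omega>)}"
        then have "i \<in> {1..n} \<or> i = Suc n" using v n by auto
        then show "T i \<omega> = anc (T (Suc n) \<omega>) i"
        proof
          assume i: "i \<in> {1..n}"
          then have "anc (T (Suc n) \<omega>) i = anc (T n \<omega>) i" unfolding v using n by simp
          moreover have "T i \<omega> = anc (T n \<omega>) i" 
          proof -
            have h: "\<forall>i\<in>{1..num_nodes (T n \<omega>)}. T i \<omega> = anc (T n \<omega>) i"
              using conjunct2[OF Suc.IH] unfolding hist_def .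
            show ?thesis by (rule bspec[OF h]) (use i in \<open>simp only: n\<close>)
          qed
          ultimately show ?thesis by (rule trans[OF _ sym, rotated])
        next
          assume i: "i = Suc n"
          show ?thesis unfolding i v using n by simp
        qed
      qed
      then show ?case using step_trees[OF _ st] Suc.IH by blast
    qed
    then have "step (T n \<omega>) (T (Suc n) \<omega>)" if "n \<ge> 1" for n
      using elim(2) that by (metis (mono_tags, lifting) mem_Collect_eq trees_def)
    then show ?case using elim by (simp add: path_def)
  qed
qed

lemma AE_trees: "n \<ge> 1 \<Longrightarrow> AE \<omega> in M. T n \<omega> \<in> trees n"
  using AE_path by eventually_elim (rule path_trees)

lemma AE_hist: "n \<ge> 1 \<Longrightarrow> AE \<omega> in M. T n \<omega> = t \<longrightarrow> hist t \<omega>"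
  using AE_path
proof eventually_elim
  case (elim \<omega>)
  then have "num_nodes (T n \<omega>) = n" using path_trees by (auto simp: trees_def)
  then show ?case using path_anc[OF elim(2)] by (auto simp: hist_def)
qed

text \<open>Markov property: up to a null set the event that the present tree is \<open>t\<close>
  coincides with \<open>hist t\<close>, since a tree determines its history.\<close>

lemma prob_Attach:
  assumes "t \<in> trees n" "v \<in> nodes t"
  shows "prob {\<omega>\<in>space M. T (Suc n) \<omega> = Attach t v} = q t v * prob {\<omega>\<in>space M. T n \<omega> = t}"
proof -
  have n: "n = num_nodes t" "reach t" using assms by (auto simp: trees_def)
  then have n1: "n \<ge> 1" by simp
  have [measurable]: "Measurable.pred M (\<lambda>\<omega>. P (T n \<omega>))" "Measurable.pred M (\<lambda>\<omega>. P (T (Suc n) \<omega>))" for P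
    using n1 by auto
  have "prob {\<omega>\<in>space M. T (Suc n) \<omega> = Attach t v} = prob {\<omega>\<in>space M. T (Suc n) \<omega> = Attach t v \<and> hist t \<omega>}"
  proof (rule prob_eq_AE)
    show "AE \<omega> in M. T (Suc n) \<omega> = Attach t v \<longleftrightarrow> T (Suc n) \<omega> = Attach t v \<and> hist t \<omega>"
      using AE_path AE_hist[OF n1, of t]
    proof eventually_elim
      case (elim \<omega>)
      obtain w where "T (Suc n) \<omega> = Attach (T n \<omega>) w" using path_step[OF elim(1) n1] .
      then show ?case using elim by auto
    qed
  qed auto
  moreover have "prob {\<omega>\<in>space M. T n \<omega> = t} = prob {\<omega>\<in>space M. hist t \<omega>}"
  proof (rule prob_eq_AE)
    show "AE \<omega> in M. T n \<omega> = t \<longleftrightarrow> hist t \<omega>"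
      using AE_hist[OF n1, of t]
    proof eventually_elim
      case (elim \<omega>)
      then show ?case using n anc_self[of t] by (auto simp: hist_def)
    qed
  qed auto
  ultimately show ?thesis using hist_growth[OF assms(2) n(2)] n(1) by simp
qed

lemma has_integral_T:
  fixes f :: "rec_tree \<Rightarrow> 'b::{banach, second_countable_topology}"
  assumes n: "n \<ge> 1"
  shows "has_bochner_integral M (\<lambda>\<omega>. f (T n \<omega>)) (\<Sum>t\<in>trees n. prob {\<omega>\<in>space M. T n \<omega> = t} *\<^sub>R f t)"
proof -
  have [measurable]: "Measurable.pred M (\<lambda>\<omega>. P (T n \<omega>))" for P using T_pred[OF n] .
  let ?g = "\<lambda>\<omega>. \<Sum>t\<in>trees n. indicator {\<omega>\<in>space M. T n \<omega> = t} \<omega> *\<^sub>R f t"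
  have "has_bochner_integral M ?g (\<Sum>t\<in>trees n. prob {\<omega>\<in>space M. T n \<omega> = t} *\<^sub>R f t)"
    by (intro has_bochner_integral_sum has_bochner_integral_scaleR_left has_bochner_integral_real_indicator)
       (auto simp: emeasure_eq_measure)
  moreover have "AE \<omega> in M. ?g \<omega> = f (T n \<omega>)"
    using AE_trees[OF n] AE_space
  proof eventually_elim
    case (elim \<omega>)
    have "?g \<omega> = (\<Sum>t\<in>trees n. if t = T n \<omega> then f t else 0)"
      using elim by (intro sum.cong) (auto simp: indicator_def)
    then show ?case using elim finite_trees[OF n] by simp
  qed
  ultimately show ?thesis
    using T_borel[OF n, of f] by (subst has_bochner_integral_cong_AE[of _ _ ?g]) auto
qed

section \<open>Expectations along the chain as iterated averages\<close>

definition expT :: "nat \<Rightarrow> (rec_tree \<Rightarrow> 'b::{banach, second_countable_topology}) \<Rightarrow> 'b" where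
  "expT n f = (\<integral>\<omega>. f (T n \<omega>) \<partial>M)"

lemma integrable_T: 
  fixes f :: "rec_tree \<Rightarrow> 'b::{banach, second_countable_topology}"
  shows "n \<ge> 1 \<Longrightarrow> integrable M (\<lambda>\<omega>. f (T n \<omega>))"
  using has_integral_T[of n f] by (rule integrable.intros)

lemma expT_eq: "n \<ge> 1 \<Longrightarrow> expT n f = (\<Sum>t\<in>trees n. prob {\<omega>\<in>space M. T n \<omega> = t} *\<^sub>R f t)"
  unfolding expT_def using has_integral_T[of n f] by (rule has_bochner_integral_integral_eq)

lemma expT_1: "expT (Suc 0) f = f Root"
proof -
  have "prob {\<omega>\<in>space M. T 1 \<omega> = Root} = 1"
    using initial by (intro prob_Collect_eq_1[THEN iffD2] T_event) auto
  then show ?thesis using expT_eq[of 1 f] by (simp add: trees_1)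
qed

text \<open>Tower property in finite form: the trees of size \<open>Suc n\<close> correspond
  bijectively to pairs of a tree and an attachment point of positive weight.\<close>

lemma expT_Suc:
  assumes n: "n \<ge> 1"
  shows "expT (Suc n) f = expT n (\<lambda>t. avg t (\<lambda>v. f (Attach t v)))"
proof -
  let ?V = "\<lambda>t. {v\<in>nodes t. attach_weight \<beta> m t v > 0}"
  have "expT (Suc n) f = (\<Sum>(t, v)\<in>(SIGMA t:trees n. ?V t). prob {\<omega>\<in>space M. T (Suc n) \<omega> = Attach t v} *\<^sub>R f (Attach t v))"
    unfolding expT_eq[OF le_SucI[OF n]] trees_Suc[OF n]
    by (subst sum.reindex) (auto simp: inj_on_def case_prod_unfold)
  also have "\<dots> = (\<Sum>t\<in>trees n. \<Sum>v\<in>?V t. prob {\<omega>\<in>space M. T (Suc n) \<omega> = Attach t v} *\<^sub>R f (Attach t v))"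
    using finite_trees[OF n] by (subst sum.Sigma) auto
  also have "\<dots> = (\<Sum>t\<in>trees n. prob {\<omega>\<in>space M. T n \<omega> = t} *\<^sub>R avg t (\<lambda>v. f (Attach t v)))"
  proof (intro sum.cong refl)
    fix t assume t: "t \<in> trees n"
    then have r: "reach t" by (simp add: trees_def)
    have "(\<Sum>v\<in>?V t. prob {\<omega>\<in>space M. T (Suc n) \<omega> = Attach t v} *\<^sub>R f (Attach t v))
      = (\<Sum>v\<in>?V t. prob {\<omega>\<in>space M. T n \<omega> = t} *\<^sub>R (q t v *\<^sub>R f (Attach t v)))"
      using t by (intro sum.cong) (auto simp: prob_Attach)
    also have "\<dots> = (\<Sum>v\<in>nodes t. prob {\<omega>\<in>space M. T n \<omega> = t} *\<^sub>R (q t v *\<^sub>R f (Attach t v)))"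
    proof (intro sum.mono_neutral_left ballI)
      fix v assume "v \<in> nodes t - ?V t"
      then have "attach_weight \<beta> m t v = 0" using attach_weight_nonneg[OF r, of v] by fastforce
      then show "prob {\<omega>\<in>space M. T n \<omega> = t} *\<^sub>R (q t v *\<^sub>R f (Attach t v)) = 0" by (simp add: q_def)
    qed auto
    finally show "(\<Sum>v\<in>?V t. prob {\<omega>\<in>space M. T (Suc n) \<omega> = Attach t v} *\<^sub>R f (Attach t v))
      = prob {\<omega>\<in>space M. T n \<omega> = t} *\<^sub>R avg t (\<lambda>v. f (Attach t v))"
      by (simp add: avg_def scaleR_sum_right)
  qed
  finally show ?thesis by (simp add: expT_eq[OF n])
qed

lemma expT_cong:
  assumes "n \<ge> 1" "\<And>t. t \<in> trees n \<Longrightarrow> f t = g t"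
  shows "expT n f = expT n g"
  unfolding expT_eq[OF assms(1)] using assms by (intro sum.cong) auto

lemma expT_mono:
  fixes f g :: "rec_tree \<Rightarrow> real"
  assumes "n \<ge> 1" "\<And>t. t \<in> trees n \<Longrightarrow> f t \<le> g t"
  shows "expT n f \<le> expT n g"
  unfolding expT_eq[OF assms(1)] using assms by (intro sum_mono) (auto intro: mult_left_mono)

lemma expT_norm:
  fixes f :: "rec_tree \<Rightarrow> complex"
  assumes "n \<ge> 1" "\<And>t. t \<in> trees n \<Longrightarrow> norm (f t) \<le> g t"
  shows "norm (expT n f) \<le> expT n g"
  unfolding expT_eq[OF assms(1)] using assms
  by (intro sum_norm_le) (auto intro: mult_left_mono)

lemma expT_add: "n \<ge> 1 \<Longrightarrow> expT n (\<lambda>t. f t + g t) = expT n f + expT n g"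
  by (simp add: expT_eq scaleR_right_distrib sum.distrib)

lemma expT_diff: "n \<ge> 1 \<Longrightarrow> expT n (\<lambda>t. f t - g t) = expT n f - expT n g"
  by (simp add: expT_eq scaleR_right_diff_distrib sum_subtractf)

lemma expT_cmult:
  fixes f :: "rec_tree \<Rightarrow> real"
  shows "n \<ge> 1 \<Longrightarrow> expT n (\<lambda>t. k * f t) = k * expT n f"
  by (simp add: expT_eq sum_distrib_left mult_ac)

lemma expT_const: "n \<ge> 1 \<Longrightarrow> expT n (\<lambda>_. k) = k"
  by (simp add: expT_def prob_space)

lemma expT_indicator: "n \<ge> 1 \<Longrightarrow> expT n (\<lambda>t. if P t then 1 else 0 :: real) = prob {\<omega>\<in>space M. P (T n \<omega>)}"
proof -
  assume n: "n \<ge> 1"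
  have "expT n (\<lambda>t. if P t then 1 else 0 :: real) = (\<integral>\<omega>. indicator {\<omega>\<in>space M. P (T n \<omega>)} \<omega> \<partial>M)"
    unfolding expT_def by (intro Bochner_Integration.integral_cong) (auto simp: indicator_def)
  then show ?thesis using T_event[OF n, of P] by simp
qed

lemma expT_supermart:
  fixes f :: "rec_tree \<Rightarrow> real"
  assumes n: "n \<ge> 1" "n \<le> N"
    and f: "\<And>t. reach t \<Longrightarrow> n \<le> num_nodes t \<Longrightarrow> num_nodes t < N \<Longrightarrow> avg t (\<lambda>v. f (Attach t v)) \<le> f t"
  shows "expT N f \<le> expT n f"
  using n(2) f
proof (induction N rule: dec_induct)
  case (step N)
  have N: "N \<ge> 1" using step n by simp
  have "expT (Suc N) f \<le> expT N f" unfolding expT_Suc[OF N]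
    by (intro expT_mono N) (use step in \<open>auto simp: trees_def\<close>)
  then show ?case using step by fastforce
qed simp

text \<open>The supermartingale is frozen at the level \<open>x\<close> once an ancestor has passed it.\<close>

lemma ville_finite:
  fixes g :: "rec_tree \<Rightarrow> real"
  assumes n: "n \<ge> 1" "n \<le> N" and x: "x > 0"
    and nn: "\<And>t. reach t \<Longrightarrow> n \<le> num_nodes t \<Longrightarrow> 0 \<le> g t"
    and g: "\<And>t. reach t \<Longrightarrow> n \<le> num_nodes t \<Longrightarrow> avg t (\<lambda>v. g (Attach t v)) \<le> g t"
  shows "prob {\<omega>\<in>space M. \<exists>k\<in>{n..N}. x \<le> g (T k \<omega>)} \<le> expT n g / x"
proof -
  define Q where "Q t \<longleftrightarrow> n \<le> num_nodes t \<longrightarrow> g t < x" for t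
  define f where "f t = (if past Q t then g t else x)" for t
  have fsup: "avg t (\<lambda>v. f (Attach t v)) \<le> f t" if t: "reach t" "n \<le> num_nodes t" for t
  proof (cases "past Q t \<and> Q t")
    case True
    then show ?thesis using g[OF t] by (simp add: f_def)
  next
    case False
    then have "f (Attach t v) = x" for v by (auto simp: f_def)
    then have "avg t (\<lambda>v. f (Attach t v)) = x" using avg_const[OF t(1), of x] by simp
    then show ?thesis using False t by (auto simp: f_def Q_def)
  qed
  have past_small: "past Q t" if "num_nodes t \<le> n" for t
    using that by (induction t) (auto simp: Q_def)
  have [measurable]: "Measurable.pred M (\<lambda>\<omega>. P (T k \<omega>))" if "k \<in> {n..N}" for k P
    using T_pred[of k P] that n by auto
  \<comment> \<open>\<open>past\<close> does not test the tree itself, so the sizes up to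
    \<open>N\<close> are seen by the tree with \<open>Suc N\<close> nodes.\<close>
  have "x * prob {\<omega>\<in>space M. \<exists>k\<in>{n..N}. x \<le> g (T k \<omega>)} =
      x * prob {\<omega>\<in>space M. \<not> past Q (T (Suc N) \<omega>)}"
  proof (intro arg_cong2[of _ _ _ _ "(*)"] refl prob_eq_AE)
    show "AE \<omega> in M. (\<exists>k\<in>{n..N}. x \<le> g (T k \<omega>)) \<longleftrightarrow> \<not> past Q (T (Suc N) \<omega>)"
      using AE_path
    proof eventually_elim
      case (elim \<omega>)
      have p: "past Q (T (Suc N) \<omega>) \<longleftrightarrow> (\<forall>k\<in>{1..<Suc N}. Q (T k \<omega>))"
        by (rule path_past[OF elim]) simp
      have "num_nodes (T k \<omega>) = k" if "k \<in> {1..<Suc N}" for k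
        using path_trees[OF elim, of k] that by (simp add: trees_def)
      then have "past Q (T (Suc N) \<omega>) \<longleftrightarrow> (\<forall>k\<in>{1..<Suc N}. n \<le> k \<longrightarrow> g (T k \<omega>) < x)"
        unfolding p Q_def by simp
      also have "\<dots> \<longleftrightarrow> (\<forall>k\<in>{n..N}. \<not> x \<le> g (T k \<omega>))" using n by (auto simp: not_le Ball_def)
      finally show ?case by blast
    qed
    show "{\<omega>\<in>space M. \<exists>k\<in>{n..N}. x \<le> g (T k \<omega>)} \<in> events" by measurable
    show "{\<omega>\<in>space M. \<not> past Q (T (Suc N) \<omega>)} \<in> events" by (rule T_event) simp
  qed
  also have "\<dots> = expT (Suc N) (\<lambda>t. x * (if \<not> past Q t then 1 else 0))"
    by (simp only: expT_cmult expT_indicator le_add1 plus_1_eq_Suc[symmetric])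
  also have "\<dots> \<le> expT (Suc N) f"
    using n x by (intro expT_mono) (auto simp: f_def trees_def intro!: nn)
  also have "\<dots> \<le> expT n f"
    using n fsup by (intro expT_supermart) auto
  also have "\<dots> = expT n g"
    using n past_small by (intro expT_cong) (auto simp: f_def trees_def)
  finally show ?thesis using x by (simp add: field_simps)
qed

text \<open>The finite-horizon events increase in \<open>N\<close>, and their bound does not depend
  on \<open>N\<close>.\<close>

lemma ville:
  fixes g :: "rec_tree \<Rightarrow> real"
  assumes n: "n \<ge> 1" and x: "x > 0"
    and nn: "\<And>t. reach t \<Longrightarrow> n \<le> num_nodes t \<Longrightarrow> 0 \<le> g t"
    and g: "\<And>t. reach t \<Longrightarrow> n \<le> num_nodes t \<Longrightarrow> avg t (\<lambda>v. g (Attach t v)) \<le> g t"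
  shows "prob {\<omega>\<in>space M. \<exists>k\<ge>n. x \<le> g (T k \<omega>)} \<le> expT n g / x"
proof -
  let ?A = "\<lambda>N. {\<omega>\<in>space M. \<exists>k\<in>{n..N}. x \<le> g (T k \<omega>)}"
  have [measurable]: "Measurable.pred M (\<lambda>\<omega>. P (T k \<omega>))" if "k \<in> {n..N}" for k N P
    using T_pred[of k P] that n by auto
  have "(\<lambda>N. prob (?A N)) \<longlonglongrightarrow> prob (\<Union>N. ?A N)"
  proof (rule finite_Lim_measure_incseq)
    have "?A N \<in> events" for N by measurable
    then show "range ?A \<subseteq> events" by auto
    show "incseq ?A" by (auto simp: incseq_def)
  qed
  moreover have "(\<Union>N. ?A N) = {\<omega>\<in>space M. \<exists>k\<ge>n. x \<le> g (T k \<omega>)}"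
    by fastforce
  moreover have "\<forall>\<^sub>F N in sequentially. prob (?A N) \<le> expT n g / x"
    using eventually_ge_at_top[of n] by eventually_elim (rule ville_finite[OF n _ x nn g])
  ultimately show ?thesis using tendsto_upperbound by fastforce
qed

end

section \<open>Height and variance of the depth profile\<close>

lemma ln_step_upper: "0 < x \<Longrightarrow> ln (x + 1) - ln x \<le> 1 / (x::real)"
proof -
  assume x: "0 < x"
  have "ln (x + 1) - ln x = ln ((x + 1) / x)" using x by (subst ln_div) auto
  also have "(x + 1) / x = 1 + 1 / x" using x by (simp add: field_simps)
  also have "ln (1 + 1 / x) \<le> 1 / x" using x by (intro ln_add_one_self_le_self) simp
  finally show ?thesis .
qed

lemma ln_step_lower: "0 < x \<Longrightarrow> 1 / (x + 1) \<le> ln (x + 1) - ln (x::real)"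
  using ln_le_minus_one[of "x / (x + 1)"] by (simp add: ln_div field_simps)

lemma summable_bigo_powr:
  assumes "f \<in> O(\<lambda>n. real n powr (-3/2))"
  shows "summable (f :: nat \<Rightarrow> real)"
  by (rule summable_comparison_test_bigo[OF _ assms]) (simp add: summable_real_powr_iff)

lemma (in prob_space) borel_cantelli_AE:
  assumes "\<And>n. {\<omega>\<in>space M. P n \<omega>} \<in> events" "summable (\<lambda>n. prob {\<omega>\<in>space M. P n \<omega>})"
  shows "AE \<omega> in M. eventually (\<lambda>n. \<not> P n \<omega>) sequentially"
proof -
  have "AE \<omega> in M. eventually (\<lambda>n. \<omega> \<in> space M - {\<omega>\<in>space M. P n \<omega>}) sequentially"
    using assms by (intro borel_cantelli_AE1) (auto simp: emeasure_eq_measure)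
  then show ?thesis by eventually_elim (auto elim: eventually_mono)
qed

context tree_params
begin

section \<open>Logarithmic growth of the sums of \<open>rho\<close>, and the height\<close>

lemma sum_rho_upper:
  assumes "n \<ge> 1"
  shows "(\<Sum>k=1..<n. rho k) \<le> 1 + ln (real n)"
proof -
  have *: "(\<Sum>k=1..<Suc n. rho k) \<le> 1 + ln (real n)" if "n \<ge> 1" for n
    using that
  proof (induction n rule: nat_induct_at_least)
    case base
    then show ?case using rho_le[of 1] by simp
  next
    case (Suc n)
    have "rho (Suc n) \<le> 1 / (real n + 1)" using rho_le[of "Suc n"] by (simp add: add.commute)
    also have "\<dots> \<le> ln (real n + 1) - ln (real n)" using Suc.hyps by (intro ln_step_lower) simp
    finally show ?case using Suc.IH by (simp add: add.commute)
  qed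
  show ?thesis
  proof (cases "n = 1")
    case False
    then obtain k where k: "n = Suc k" "k \<ge> 1" using assms by (cases n) auto
    have "ln (real k) \<le> ln (real n)" using k by simp
    moreover have "(\<Sum>k=1..<n. rho k) \<le> 1 + ln (real k)" using *[OF k(2)] unfolding k(1) .
    ultimately show ?thesis by linarith
  qed simp
qed

lemma sum_rho_bounds:
  assumes "N \<ge> 1" "N \<le> n"
  shows "ln (real n + 1 - cc) - ln (real N + 1 - cc) \<le> (\<Sum>k=N..<n. rho k)"
    and "(\<Sum>k=N..<n. rho k) \<le> ln (real n - cc) - ln (real N - cc)"
proof -
  have p: "real k - cc > 0" if "k \<ge> N" for k using cc_less1 assms(1) that by linarith
  have r: "rho k = 1 / ((real k - cc) + 1)" "rho k = 1 / (real k + 1 - cc)" for k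
    by (simp_all add: rho_def algebra_simps)
  show "ln (real n + 1 - cc) - ln (real N + 1 - cc) \<le> (\<Sum>k=N..<n. rho k)"
    using assms(2)
  proof (induction n rule: dec_induct)
    case (step k)
    have "ln ((real k + 1 - cc) + 1) - ln (real k + 1 - cc) \<le> rho k"
      unfolding r(2) using p[of k] step by (intro ln_step_upper) linarith
    then show ?case using step by (simp add: algebra_simps)
  qed simp
  show "(\<Sum>k=N..<n. rho k) \<le> ln (real n - cc) - ln (real N - cc)"
    using assms(2)
  proof (induction n rule: dec_induct)
    case (step k)
    have "rho k \<le> ln ((real k - cc) + 1) - ln (real k - cc)"
      unfolding r(1) using p[of k] step by (intro ln_step_lower) linarith
    then show ?case using step by (simp add: algebra_simps)
  qed simp
qed

lemma sum_rho_asymp: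
  assumes "N \<ge> 1"
  shows "(\<lambda>n. (\<Sum>k=N..<n. rho k) / ln (real n)) \<longlonglongrightarrow> 1"
proof (rule tendsto_sandwich)
  show "\<forall>\<^sub>F n in sequentially. (ln (real n + 1 - cc) - ln (real N + 1 - cc)) / ln (real n) \<le> (\<Sum>k=N..<n. rho k) / ln (real n)"
    using eventually_ge_at_top[of N] eventually_gt_at_top[of 1]
    by eventually_elim (use sum_rho_bounds[OF assms] in \<open>auto intro!: divide_right_mono\<close>)
  show "\<forall>\<^sub>F n in sequentially. (\<Sum>k=N..<n. rho k) / ln (real n) \<le> (ln (real n - cc) - ln (real N - cc)) / ln (real n)"
    using eventually_ge_at_top[of N] eventually_gt_at_top[of 1]
    by eventually_elim (use sum_rho_bounds[OF assms] in \<open>auto intro!: divide_right_mono\<close>)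
  show "(\<lambda>n. (ln (real n + 1 - cc) - ln (real N + 1 - cc)) / ln (real n)) \<longlonglongrightarrow> 1"
    by real_asymp
  show "(\<lambda>n. (ln (real n - cc) - ln (real N - cc)) / ln (real n)) \<longlonglongrightarrow> 1"
    by real_asymp
qed

text \<open>The mean exponential of the attachment depth grows at most like a constant times
  \<open>n powr ea\<close>. The additional 2 in \<open>ch\<close> makes the probability that the
  newest node lies deeper than \<open>ch * ln n\<close> of order \<open>1 / n^2\<close>, hence
  summable.\<close>

definition ea :: real where "ea = lam * (exp 1 - 1)"
definition ch :: real where "ch = ea + 2"

lemma ea_pos: "ea > 0"
  using lam_pos by (simp add: ea_def)

lemma ch_pos: "ch > 0"
  using ea_pos by (simp add: ch_def)

definition ephi :: "rec_tree \<Rightarrow> real" where "ephi t = avg t (\<lambda>v. exp (real (dep t v)))"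

text \<open>One level more multiplies the exponential by \<open>exp 1\<close>, so the recursion of
  \<open>avg_Attach\<close> closes for this function.\<close>

lemma avg_ephi:
  assumes "reach t"
  shows "avg t (\<lambda>v. ephi (Attach t v)) = (1 + rho (num_nodes t) * ea) * ephi t"
proof -
  let ?r = "rho (num_nodes t)"
  have "avg t (\<lambda>v. ephi (Attach t v)) =
      avg t (\<lambda>v. (1 - ?r) * ephi t + (?r * (cc + lam * exp 1)) * exp (real (dep t v)))"
  proof (rule avg_cong)
    fix v assume "v \<in> nodes t"
    then show "ephi (Attach t v) = (1 - ?r) * ephi t + (?r * (cc + lam * exp 1)) * exp (real (dep t v))"
      using avg_Attach[OF reach_proper[OF assms], of v "\<lambda>k. exp (real k)"]
      by (simp add: ephi_def exp_add algebra_simps)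
  qed
  also have "\<dots> = (1 - ?r) * ephi t + (?r * (cc + lam * exp 1)) * ephi t"
    by (simp only: avg_add avg_cmult avg_const[OF assms] ephi_def)
  also have "cc + lam * exp 1 = 1 + ea" using cc_lam by (simp add: ea_def algebra_simps)
  finally show ?thesis by (simp add: algebra_simps)
qed

definition ht :: "rec_tree \<Rightarrow> bool" where
  "ht t \<longleftrightarrow> (\<forall>v\<in>nodes t. real (dep t v) \<le> ch * ln (real (num_nodes t)))"

lemma path_dep:
  assumes "path s" "v \<ge> 1" "v \<le> n"
  shows "dep (s n) v = dep (s v) v"
  using assms(3)
proof (induction n rule: dec_induct)
  case (step k)
  have k: "k \<ge> 1" using step assms by simp
  obtain w where "s (Suc k) = Attach (s k) w" using path_step[OF assms(1) k] .
  moreover have "num_nodes (s k) = k" using path_trees[OF assms(1) k] by (simp add: trees_def)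
  ultimately show ?case using step by simp
qed simp

text \<open>The depth of a node never changes, so only the newest node needs control: from
  \<open>N\<close> on each node is low when inserted, and the finitely many earlier depths are
  overtaken by \<open>ch * ln n\<close>.\<close>

lemma path_ht:
  assumes s: "path s" and ev: "\<forall>\<^sub>F n in sequentially. real (dep (s n) n) \<le> ch * ln (real n)"
  shows "\<forall>\<^sub>F n in sequentially. ht (s n)"
proof -
  obtain N where N: "\<And>n. n \<ge> N \<Longrightarrow> real (dep (s n) n) \<le> ch * ln (real n)"
    using ev by (auto simp: eventually_sequentially)
  define D where "D = (\<Sum>k<N. real (dep (s k) k))"
  have "filterlim (\<lambda>n. ch * ln (real n)) at_top sequentially"
    using ch_pos by real_asymp
  then have "\<forall>\<^sub>F n in sequentially. D \<le> ch * ln (real n)"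
    by (simp add: filterlim_at_top)
  with eventually_ge_at_top[of 1] show ?thesis
  proof eventually_elim
    case (elim n)
    have nn: "num_nodes (s n) = n" using path_trees[OF s elim(1)] by (simp add: trees_def)
    show ?case unfolding ht_def
    proof
      fix v assume "v \<in> nodes (s n)"
      then have v: "1 \<le> v" "v \<le> n" by (auto simp: nodes_def nn)
      have "real (dep (s v) v) \<le> ch * ln (real n)"
      proof (cases "v < N")
        case True
        then have "real (dep (s v) v) \<le> D" unfolding D_def by (intro member_le_sum) auto
        then show ?thesis using elim by simp
      next
        case False
        then have "real (dep (s v) v) \<le> ch * ln (real v)" using N by simp
        also have "\<dots> \<le> ch * ln (real n)" using v ch_pos by simp
        finally show ?thesis .
      qed
      then show "real (dep (s n) v) \<le> ch * ln (real (num_nodes (s n)))"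
        using path_dep[OF s v] by (simp add: nn)
    qed
  qed
qed

lemma mu_bounds:
  assumes "reach t" "ht t"
  shows "0 \<le> mu t" "mu t \<le> ch * ln (real (num_nodes t))"
proof -
  have "avg t (\<lambda>_. 0) \<le> mu t" unfolding mu_def using assms by (intro avg_mono) auto
  then show "0 \<le> mu t" by (simp add: avg_const[OF assms(1)])
  have "mu t \<le> avg t (\<lambda>_. ch * ln (real (num_nodes t)))"
    unfolding mu_def using assms by (intro avg_mono) (auto simp: ht_def)
  then show "mu t \<le> ch * ln (real (num_nodes t))" by (simp add: avg_const[OF assms(1)])
qed

lemma dev_bound:
  assumes "reach t" "ht t" "v \<in> nodes t"
  shows "\<bar>real (dep t v) - mu t\<bar> \<le> ch * ln (real (num_nodes t))"
  using mu_bounds[OF assms(1,2)] assms(2,3) unfolding ht_def by (auto simp: abs_le_iff)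

lemma vv_bound:
  assumes "reach t" "ht t"
  shows "vv t \<le> (ch * ln (real (num_nodes t)))\<^sup>2"
proof -
  have "avg t (\<lambda>v. (real (dep t v) - mu t)\<^sup>2) \<le> avg t (\<lambda>_. (ch * ln (real (num_nodes t)))\<^sup>2)"
  proof (rule avg_mono[OF assms(1)])
    fix v assume "v \<in> nodes t"
    then show "(real (dep t v) - mu t)\<^sup>2 \<le> (ch * ln (real (num_nodes t)))\<^sup>2"
      using dev_bound[OF assms] by (intro power2_le_iff_abs_le[THEN iffD2]) (auto simp: ch_pos less_imp_le)
  qed
  then show ?thesis by (simp add: avg_const[OF assms(1)] avg_dev2[OF assms(1)])
qed

text \<open>Bound for the square of \<open>yv\<close> on trees of logarithmic height, of order
  \<open>ln n ^ 4 / n ^ 2\<close>.\<close>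

definition bv :: "nat \<Rightarrow> real" where
  "bv n = ((2 * (ch * ln (real n))\<^sup>2 + 2 * lam * (ch * ln (real n))) / real n)\<^sup>2"

lemma summable_bv: "summable bv"
by (rule summable_bigo_powr) (unfold bv_def, use ch_pos lam_pos in real_asymp)

lemma yv_bound:
  assumes "reach t" "ht t" "v \<in> nodes t"
  shows "(yv t v)\<^sup>2 \<le> bv (num_nodes t)"
proof -
  let ?n = "num_nodes t"
  let ?c = "ch * ln (real ?n)" and ?d = "real (dep t v) - mu t"
  have r: "0 \<le> rho ?n" "rho ?n \<le> 1 / real ?n" "0 \<le> 1 - rho ?n" "1 - rho ?n \<le> 1"
    using rho_pos[of ?n] rho_le[of ?n] rho_le1[of ?n] by auto
  have d: "\<bar>?d\<bar> \<le> ?c" by (rule dev_bound[OF assms])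
  have c0: "0 \<le> ?c" using d by linarith
  have d2: "?d\<^sup>2 \<le> ?c\<^sup>2" using d c0 by (intro power2_le_iff_abs_le[THEN iffD2])
  have "\<bar>?d\<^sup>2 + 2 * lam * ?d - vv t\<bar> \<le> ?d\<^sup>2 + \<bar>2 * lam * ?d\<bar> + \<bar>vv t\<bar>"
    using abs_triangle_ineq4[of "?d\<^sup>2 + 2 * lam * ?d" "vv t"] abs_triangle_ineq[of "?d\<^sup>2" "2 * lam * ?d"] by simp
  also have "\<dots> \<le> ?c\<^sup>2 + 2 * lam * ?c + ?c\<^sup>2"
    using d2 d vv_nonneg[OF assms(1)] vv_bound[OF assms(1,2)] lam_pos
    by (intro add_mono) (auto simp: abs_mult)
  finally have A: "\<bar>?d\<^sup>2 + 2 * lam * ?d - vv t\<bar> \<le> 2 * ?c\<^sup>2 + 2 * lam * ?c" by simp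
  have "rho ?n * (1 - rho ?n) \<le> 1 / real ?n * 1" using r by (intro mult_mono) auto
  then have "\<bar>yv t v\<bar> \<le> 1 / real ?n * (2 * ?c\<^sup>2 + 2 * lam * ?c)"
    unfolding yv_def abs_mult using A r by (intro mult_mono) (auto simp: abs_mult[symmetric])
  then have "(yv t v)\<^sup>2 \<le> (1 / real ?n * (2 * ?c\<^sup>2 + 2 * lam * ?c))\<^sup>2"
    using c0 lam_pos by (intro power2_le_iff_abs_le[THEN iffD2]) auto
  then show ?thesis by (simp add: bv_def)
qed

text \<open>Centred increments are orthogonal to the past: the cross term vanishes, so the mean
  square grows by at most \<open>b\<close>, and not at all while the gate is closed.\<close>

lemma avg_tsum_square:
  assumes t: "reach t" and y: "avg t (y t) = 0"
    and b: "\<And>v. v \<in> nodes t \<Longrightarrow> G t \<Longrightarrow> (y t v)\<^sup>2 \<le> b" "0 \<le> b"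
  shows "avg t (\<lambda>v. (tsum n G y (Attach t v))\<^sup>2) \<le> (tsum n G y t)\<^sup>2 + b"
proof (cases "n \<le> num_nodes t \<and> G t")
  case True
  let ?Y = "tsum n G y t"
  have "avg t (\<lambda>v. (tsum n G y (Attach t v))\<^sup>2) = avg t (\<lambda>v. ?Y\<^sup>2 + (2 * ?Y) * y t v + (y t v)\<^sup>2)"
    using True by (intro avg_cong) (simp add: power2_eq_square algebra_simps)
  also have "\<dots> = ?Y\<^sup>2 + avg t (\<lambda>v. (y t v)\<^sup>2)"
    by (simp only: avg_add avg_cmult avg_const[OF t]) (simp add: y)
  also have "avg t (\<lambda>v. (y t v)\<^sup>2) \<le> avg t (\<lambda>_. b)" using True b t by (intro avg_mono) auto
  finally show ?thesis by (simp add: avg_const[OF t])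
next
  case False
  then have "tsum n G y (Attach t v) = tsum n G y t" for v by auto
  then show ?thesis using b by (simp add: avg_const[OF t] del: tsum.simps)
qed

text \<open>Summing the recursion of \<open>vv_Attach\<close> leaves a bounded martingale part, a
  convergent error sum and \<open>lam\<close> times the sum of \<open>rho\<close>, which is
  asymptotic to the logarithm.\<close>

lemma path_vv:
  assumes s: "path s" and N: "N \<ge> 1" and h: "\<And>n. n \<ge> N \<Longrightarrow> ht (s n)"
    and x: "\<And>n. n \<ge> N \<Longrightarrow> (tsum N ht yv (s n))\<^sup>2 \<le> x"
  shows "(\<lambda>n. vv (s n) / ln (real n)) \<longlonglongrightarrow> lam"
proof -
  have nn: "num_nodes (s n) = n" "reach (s n)" if "n \<ge> N" for n
    using path_trees[OF s, of n] N that by (auto simp: trees_def)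
  define e where "e k = (rho k)\<^sup>2 * (lam\<^sup>2 + vv (s k))" for k
  have id: "vv (s n) = vv (s N) + tsum N ht yv (s n) + lam * (\<Sum>k=N..<n. rho k) - (\<Sum>k=N..<n. e k)"
    if "n \<ge> N" for n
    using that
  proof (induction n rule: dec_induct)
    case base
    then show ?case using nn[of N] by (simp add: tsum_le)
  next
    case (step n)
    have n1: "n \<ge> 1" using step N by simp
    obtain v where v: "v \<in> nodes (s n)" "s (Suc n) = Attach (s n) v" using path_step[OF s n1] .
    have "vv (s (Suc n)) = vv (s n) + yv (s n) v + (rho n * lam - (rho n)\<^sup>2 * lam\<^sup>2) - (rho n)\<^sup>2 * vv (s n)"
      using vv_Attach[OF reach_proper v(1)] nn[of n] step v(2) by simp
    moreover have "tsum N ht yv (s (Suc n)) = tsum N ht yv (s n) + yv (s n) v"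
      using v nn[of n] h[of n] step by simp
    moreover have "e n = (rho n)\<^sup>2 * lam\<^sup>2 + (rho n)\<^sup>2 * vv (s n)" by (simp add: e_def algebra_simps)
    moreover have "(\<Sum>k=N..<Suc n. e k) = (\<Sum>k=N..<n. e k) + e n"
      "lam * (\<Sum>k=N..<Suc n. rho k) = lam * (\<Sum>k=N..<n. rho k) + rho n * lam"
      using step by (simp_all add: algebra_simps)
    ultimately show ?case using step.IH by linarith
  qed
  define w where "w k = 1 / (real k)\<^sup>2 * (lam\<^sup>2 + (ch * ln (real k))\<^sup>2)" for k
  have w: "summable w"
  by (rule summable_bigo_powr) (unfold w_def, use ch_pos lam_pos in real_asymp)
  have w0: "0 \<le> w k" for k by (simp add: w_def)
  have ew: "0 \<le> e k" "e k \<le> w k" if "k \<ge> N" for k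
  proof -
    have v0: "0 \<le> vv (s k)" "vv (s k) \<le> (ch * ln (real k))\<^sup>2"
      using vv_nonneg[of "s k"] vv_bound[of "s k"] nn[of k] h[of k] that by auto
    show "0 \<le> e k" using v0 by (simp add: e_def)
    have "(rho k)\<^sup>2 \<le> (1 / real k)\<^sup>2" using rho_pos[of k] rho_le[of k] that N by (intro power_mono) auto
    then show "e k \<le> w k" unfolding e_def w_def using v0
      by (intro mult_mono add_mono) (auto simp: power_divide)
  qed
  define K where "K = vv (s N) + sqrt x + suminf w"
  have bnd: "\<bar>vv (s n) - lam * (\<Sum>k=N..<n. rho k)\<bar> \<le> K" if n: "n \<ge> N" for n
  proof -
    have "(\<Sum>k=N..<n. e k) \<le> (\<Sum>k=N..<n. w k)" using ew by (intro sum_mono) auto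
    also have "\<dots> \<le> suminf w" using w w0 by (intro sum_le_suminf) auto
    finally have 1: "(\<Sum>k=N..<n. e k) \<le> suminf w" .
    have 2: "0 \<le> (\<Sum>k=N..<n. e k)" using ew by (intro sum_nonneg) auto
    have 3: "\<bar>tsum N ht yv (s n)\<bar> \<le> sqrt x" using x[OF n] real_le_rsqrt by (metis power2_abs)
    have 4: "0 \<le> vv (s N)" using vv_nonneg nn by auto
    show ?thesis using id[OF n] 1 2 3 4 unfolding K_def by linarith
  qed
  have "(\<lambda>n. (vv (s n) - lam * (\<Sum>k=N..<n. rho k)) / ln (real n)) \<longlonglongrightarrow> 0"
  proof (rule tendsto_0_le)
    show "(\<lambda>n. K / ln (real n)) \<longlonglongrightarrow> 0" by real_asymp
    show "\<forall>\<^sub>F n in sequentially. norm ((vv (s n) - lam * (\<Sum>k=N..<n. rho k)) / ln (real n)) \<le> norm (K / ln (real n)) * 1"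
      using eventually_ge_at_top[of N]
    proof eventually_elim
      case (elim n)
      then show ?case using bnd[OF elim] by (auto simp: abs_divide intro!: divide_right_mono)
    qed
  qed
  moreover have "(\<lambda>n. lam * ((\<Sum>k=N..<n. rho k) / ln (real n))) \<longlonglongrightarrow> lam * 1"
    by (intro tendsto_intros sum_rho_asymp N)
  ultimately have "(\<lambda>n. (vv (s n) - lam * (\<Sum>k=N..<n. rho k)) / ln (real n) + lam * ((\<Sum>k=N..<n. rho k) / ln (real n))) \<longlonglongrightarrow> 0 + lam * 1"
    by (rule tendsto_add)
  then show ?thesis by (simp add: diff_divide_distrib)
qed

end

context tree_run
begin

lemma expT_ephi: "n \<ge> 1 \<Longrightarrow> expT n ephi \<le> exp (ea * (1 + ln (real n)))"
proof -
  assume n: "n \<ge> 1"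
  have "expT n ephi \<le> exp (ea * (\<Sum>k=1..<n. rho k))"
    using n
  proof (induction n rule: nat_induct_at_least)
    case base
    have "ephi Root = 1" using avg_const[of Root "1::real"] by (simp add: ephi_def)
    then show ?case by (simp add: expT_1)
  next
    case (Suc n)
    have "expT (Suc n) ephi = expT n (\<lambda>t. (1 + rho n * ea) * ephi t)"
      unfolding expT_Suc[OF Suc.hyps]
      by (intro expT_cong Suc.hyps) (auto simp: trees_def avg_ephi)
    also have "\<dots> = (1 + rho n * ea) * expT n ephi" by (rule expT_cmult[OF Suc.hyps])
    also have "\<dots> \<le> (1 + rho n * ea) * exp (ea * (\<Sum>k=1..<n. rho k))"
      using Suc.IH rho_pos[of n] ea_pos by (intro mult_left_mono) auto
    also have "\<dots> \<le> exp (rho n * ea) * exp (ea * (\<Sum>k=1..<n. rho k))"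
      by (intro mult_right_mono exp_ge_add_one_self) simp
    also have "\<dots> = exp (ea * (\<Sum>k=1..<Suc n. rho k))"
      using Suc.hyps by (simp add: exp_add[symmetric] algebra_simps)
    finally show ?case .
  qed
  also have "\<dots> \<le> exp (ea * (1 + ln (real n)))" using sum_rho_upper[OF n] ea_pos by simp
  finally show ?thesis .
qed

text \<open>Exponential Markov inequality for the newest node. It lies one level below its
  attachment point, which accounts for a factor \<open>exp 1\<close>.\<close>

lemma prob_depth:
  assumes n: "n \<ge> 1"
  shows "prob {\<omega>\<in>space M. ch * ln (real (Suc n)) < real (dep (T (Suc n) \<omega>) (Suc n))} \<le> exp (1 + ea) * (1 / (real (Suc n))\<^sup>2)"
proof -
  let ?h = "ch * ln (real (Suc n))"
  have "prob {\<omega>\<in>space M. ?h < real (dep (T (Suc n) \<omega>) (Suc n))} = expT (Suc n) (\<lambda>t. if ?h < real (dep t (Suc n)) then 1 else 0)"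
    by (rule expT_indicator[symmetric]) simp
  also have "\<dots> \<le> expT (Suc n) (\<lambda>t. exp (- ?h) * exp (real (dep t (Suc n))))"
    by (intro expT_mono) (auto simp: exp_add[symmetric])
  also have "\<dots> = exp (- ?h) * expT (Suc n) (\<lambda>t. exp (real (dep t (Suc n))))"
    by (rule expT_cmult) simp
  also have "expT (Suc n) (\<lambda>t. exp (real (dep t (Suc n)))) = expT n (\<lambda>t. exp 1 * ephi t)"
    unfolding expT_Suc[OF n]
    by (intro expT_cong n) (auto simp: trees_def exp_add avg_cmult ephi_def)
  also have "\<dots> = exp 1 * expT n ephi" by (rule expT_cmult[OF n])
  also have "exp (- ?h) * (exp 1 * expT n ephi) \<le> exp (- ?h) * (exp 1 * exp (ea * (1 + ln (real (Suc n)))))"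
  proof -
    have "exp (ea * (1 + ln (real n))) \<le> exp (ea * (1 + ln (real (Suc n))))" using ea_pos n by simp
    then have "expT n ephi \<le> exp (ea * (1 + ln (real (Suc n))))" using expT_ephi[OF n] by linarith
    then show ?thesis by simp
  qed
  also have "\<dots> = exp (1 + ea) * exp (- (2 * ln (real (Suc n))))"
    by (simp add: exp_add[symmetric] ch_def algebra_simps)
  also have "exp (- (2 * ln (real (Suc n)))) = 1 / (real (Suc n))\<^sup>2"
    by (simp add: exp_minus exp_double field_simps del: of_nat_Suc)
  finally show ?thesis .
qed

lemma AE_ht: "AE \<omega> in M. \<forall>\<^sub>F n in sequentially. ht (T n \<omega>)"
proof -
  \<comment> \<open>\<open>prob_depth\<close> starts at size 2, hence the shifted index.\<close>
  let ?P = "\<lambda>n \<omega>. ch * ln (real (Suc (Suc n))) < real (dep (T (Suc (Suc n)) \<omega>) (Suc (Suc n)))"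
  have "AE \<omega> in M. \<forall>\<^sub>F n in sequentially. \<not> ?P n \<omega>"
  proof (rule borel_cantelli_AE)
    show "{\<omega>\<in>space M. ?P n \<omega>} \<in> events" for n by (rule T_event) simp
    have "summable (\<lambda>n. exp (1 + ea) * (1 / (real (n + 2))\<^sup>2))"
      by (intro summable_mult summable_ignore_initial_segment[where f="\<lambda>n. 1 / (real n)\<^sup>2"])
         (use inverse_power_summable[of 2] in \<open>simp add: inverse_eq_divide\<close>)
    then show "summable (\<lambda>n. prob {\<omega>\<in>space M. ?P n \<omega>})"
      by (rule summable_comparison_test[rotated])
         (use prob_depth[of "Suc _"] in \<open>auto intro!: exI[of _ 0]\<close>)
  qed
  with AE_path show ?thesis
  proof eventually_elim
    case (elim \<omega>)
    from elim(2) have "\<forall>\<^sub>F n in sequentially. real (dep (T (n + 2) \<omega>) (n + 2)) \<le> ch * ln (real (n + 2))"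
      by (auto simp: not_less)
    then have "\<forall>\<^sub>F n in sequentially. real (dep (T n \<omega>) n) \<le> ch * ln (real n)"
      by (subst (asm) eventually_sequentially_seg)
    then show ?case by (rule path_ht[OF elim(1)])
  qed
qed

text \<open>The square of the gated sum plus the remaining budget \<open>B\<close> is a nonnegative
  supermartingale, so Ville's inequality makes its supremum finite almost surely. The gate
  \<open>ht\<close> is what makes the budget deterministic.\<close>

lemma AE_tsum_bounded:
  assumes N: "N \<ge> 1"
  shows "AE \<omega> in M. \<exists>x. \<forall>n\<ge>N. (tsum N ht yv (T n \<omega>))\<^sup>2 \<le> x"
proof -
  define B where "B n = (\<Sum>i. bv (i + n))" for n
  have sb: "summable (\<lambda>i. bv (i + n))" for n using summable_bv by (rule summable_ignore_initial_segment)
  have bv0: "0 \<le> bv n" for n by (simp add: bv_def)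
  have B0: "0 \<le> B n" for n unfolding B_def using sb bv0 by (intro suminf_nonneg) auto
  have BS: "B n = bv n + B (Suc n)" for n
    using suminf_split_head[OF sb[of n]] by (simp add: B_def)
  define g where "g t = (tsum N ht yv t)\<^sup>2 + B (num_nodes t)" for t
  let ?A = "\<lambda>x. {\<omega>\<in>space M. \<exists>k\<ge>N. x \<le> g (T k \<omega>)}"
  have A: "prob (?A x) \<le> B N / x" if "x > 0" for x
  proof -
    have "prob (?A x) \<le> expT N g / x"
    proof (rule ville[OF N that])
      fix t assume t: "reach t" "N \<le> num_nodes t"
      show "0 \<le> g t" using B0 by (simp add: g_def)
      have "avg t (\<lambda>v. g (Attach t v)) = avg t (\<lambda>v. (tsum N ht yv (Attach t v))\<^sup>2) + B (Suc (num_nodes t))"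
        by (simp add: g_def avg_add avg_const[OF t(1)])
      also have "\<dots> \<le> ((tsum N ht yv t)\<^sup>2 + bv (num_nodes t)) + B (Suc (num_nodes t))"
        using yv_bound[OF t(1)] bv0 avg_yv[OF t(1)] by (intro add_right_mono avg_tsum_square t) auto
      finally show "avg t (\<lambda>v. g (Attach t v)) \<le> g t" using BS[of "num_nodes t"] by (simp add: g_def)
    qed
    also have "expT N g = expT N (\<lambda>_. B N)"
      using N by (intro expT_cong) (auto simp: g_def trees_def tsum_le)
    finally show ?thesis by (simp add: expT_const[OF N])
  qed
  have ev: "{\<omega>\<in>space M. \<exists>k\<ge>N. x \<le> g (T k \<omega>)} \<in> events" for x :: real
    by (rule T_event_ex[OF N])
  let ?Z = "{\<omega>\<in>space M. \<forall>j::nat. \<exists>k. N \<le> k \<and> real (Suc j) \<le> g (T k \<omega>)}"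
  have "prob ?Z \<le> B N / real (Suc j)" for j
  proof -
    have "prob ?Z \<le> prob {\<omega>\<in>space M. \<exists>k. N \<le> k \<and> real (Suc j) \<le> g (T k \<omega>)}"
    proof (rule finite_measure_mono)
      show "{\<omega>\<in>space M. \<exists>k. N \<le> k \<and> real (Suc j) \<le> g (T k \<omega>)} \<in> events"
        by (rule ev)
      show "?Z \<subseteq> {\<omega>\<in>space M. \<exists>k. N \<le> k \<and> real (Suc j) \<le> g (T k \<omega>)}"
        by (intro Collect_mono impI conjI; elim conjE; (assumption | drule spec[of _ j], assumption))
    qed
    then show ?thesis using A[of "real (Suc j)"] by simp
  qed
  moreover have "(\<lambda>j. B N / real (Suc j)) \<longlonglongrightarrow> 0" by real_asymp
  ultimately have "prob ?Z \<le> 0"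
    by (intro LIMSEQ_le_const[of _ 0]) auto
  then have "prob ?Z = 0" by (simp add: measure_le_0_iff)
  then have "AE \<omega> in M. \<not> (\<forall>j::nat. \<exists>k. N \<le> k \<and> real (Suc j) \<le> g (T k \<omega>))"
    by (subst (asm) prob_eq_0) (intro sets.sets_Collect_countable_All ev, simp)
  then show ?thesis
  proof eventually_elim
    case (elim \<omega>)
    then obtain j where j: "\<And>k. N \<le> k \<Longrightarrow> g (T k \<omega>) < real (Suc j)" by (meson not_le)
    show ?case
    proof (intro exI[of _ "real (Suc j)"] allI impI)
      fix n assume "N \<le> n"
      from j[OF this] show "(tsum N ht yv (T n \<omega>))\<^sup>2 \<le> real (Suc j)"
        using B0[of "num_nodes (T n \<omega>)"] unfolding g_def by linarith
    qed
  qed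
qed

lemma AE_vv: "AE \<omega> in M. (\<lambda>n. vv (T n \<omega>) / ln (real n)) \<longlonglongrightarrow> lam"
proof -
  \<comment> \<open>The size after which the height stays logarithmic is random, so boundedness is
    taken for all starting sizes at once.\<close>
  have "AE \<omega> in M. \<forall>N. N \<ge> 1 \<longrightarrow> (\<exists>x. \<forall>n\<ge>N. (tsum N ht yv (T n \<omega>))\<^sup>2 \<le> x)"
    unfolding AE_all_countable using AE_tsum_bounded by auto
  with AE_path AE_ht show ?thesis
  proof eventually_elim
    case (elim \<omega>)
    from elim(2) obtain N where N: "\<And>n. n \<ge> N \<Longrightarrow> ht (T n \<omega>)" by (auto simp: eventually_sequentially)
    then have N': "\<And>n. n \<ge> Suc N \<Longrightarrow> ht (T n \<omega>)" by simp
    obtain x where "\<And>n. n \<ge> Suc N \<Longrightarrow> (tsum (Suc N) ht yv (T n \<omega>))\<^sup>2 \<le> x" using elim(3)[rule_format, of "Suc N"] by auto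
    then show ?case by (intro path_vv[OF elim(1) _ N']) auto
  qed
qed

section \<open>Second moments\<close>

lemma expT_vv: "n \<ge> 1 \<Longrightarrow> expT n vv \<le> lam * (1 + ln (real n))"
proof -
  assume n: "n \<ge> 1"
  have "expT n vv \<le> lam * (\<Sum>k=1..<n. rho k)"
    using n
  proof (induction n rule: nat_induct_at_least)
    case base
    then show ?case by (simp add: expT_1)
  next
    case (Suc n)
    have "expT (Suc n) vv \<le> expT n (\<lambda>t. vv t + rho n * lam)"
      unfolding expT_Suc[OF Suc.hyps]
    proof (intro expT_mono Suc.hyps)
      fix t assume "t \<in> trees n"
      then have t: "reach t" "num_nodes t = n" by (auto simp: trees_def)
      have "avg t (\<lambda>v. vv (Attach t v)) = avg t (\<lambda>v. vv t + yv t v + (rho n * lam - (rho n)\<^sup>2 * lam\<^sup>2) - (rho n)\<^sup>2 * vv t)"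
        using vv_Attach[OF reach_proper[OF t(1)]] t by (intro avg_cong) auto
      also have "\<dots> = vv t + (rho n * lam - (rho n)\<^sup>2 * lam\<^sup>2) - (rho n)\<^sup>2 * vv t"
        by (simp only: avg_add avg_diff avg_const[OF t(1)] avg_yv[OF t(1)])
      also have "\<dots> \<le> vv t + rho n * lam"
      proof -
        have "0 \<le> (rho n)\<^sup>2 * lam\<^sup>2" "0 \<le> (rho n)\<^sup>2 * vv t" using vv_nonneg[OF t(1)] by simp_all
        then show ?thesis by linarith
      qed
      finally show "avg t (\<lambda>v. vv (Attach t v)) \<le> vv t + rho n * lam" .
    qed
    also have "\<dots> = expT n vv + rho n * lam" by (simp only: expT_add[OF Suc.hyps] expT_const[OF Suc.hyps])
    also have "\<dots> \<le> lam * (\<Sum>k=1..<Suc n. rho k)"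
      using Suc by (simp add: algebra_simps)
    finally show ?case .
  qed
  also have "\<dots> \<le> lam * (1 + ln (real n))" using sum_rho_upper[OF n] lam_pos by simp
  finally show ?thesis .
qed

text \<open>By orthogonality the second moment is the sum of \<open>rho\<close> squared times the
  mean of \<open>vv\<close>, which is dominated by a series of order
  \<open>ln k / k^2\<close>.\<close>

lemma expT_spl2: "\<exists>C. \<forall>n\<ge>1. expT n (\<lambda>t. (spl t)\<^sup>2) \<le> C"
proof -
  define w where "w k = 1 / (real k)\<^sup>2 * (lam * (1 + ln (real k)))" for k
  have w: "summable w"
  by (rule summable_bigo_powr) (unfold w_def, use lam_pos in real_asymp)
  have w0: "0 \<le> w k" for k
    using lam_pos by (cases "k = 0") (auto simp: w_def intro!: divide_nonneg_nonneg mult_nonneg_nonneg add_nonneg_nonneg)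
  have "expT n (\<lambda>t. (spl t)\<^sup>2) \<le> (\<Sum>k=1..<n. w k)" if "n \<ge> 1" for n
    using that
  proof (induction n rule: nat_induct_at_least)
    case base
    then show ?case by (simp add: expT_1)
  next
    case (Suc n)
    have "expT (Suc n) (\<lambda>t. (spl t)\<^sup>2) = expT n (\<lambda>t. (spl t)\<^sup>2 + (rho n)\<^sup>2 * vv t)"
      unfolding expT_Suc[OF Suc.hyps]
    proof (intro expT_cong Suc.hyps)
      fix t assume "t \<in> trees n"
      then have t: "reach t" "num_nodes t = n" by (auto simp: trees_def)
      have "avg t (\<lambda>v. (spl (Attach t v))\<^sup>2) = avg t (\<lambda>v. (spl t)\<^sup>2 + (2 * spl t) * yy t v + (yy t v)\<^sup>2)"
        by (intro avg_cong) (simp add: power2_eq_square algebra_simps)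
      also have "\<dots> = (spl t)\<^sup>2 + (rho n)\<^sup>2 * vv t"
        by (simp add: avg_add avg_cmult avg_const[OF t(1)] avg_yy[OF t(1)] avg_yy2[OF t(1)] t)
      finally show "avg t (\<lambda>v. (spl (Attach t v))\<^sup>2) = (spl t)\<^sup>2 + (rho n)\<^sup>2 * vv t" .
    qed
    also have "\<dots> = expT n (\<lambda>t. (spl t)\<^sup>2) + (rho n)\<^sup>2 * expT n vv"
      by (simp only: expT_add[OF Suc.hyps] expT_cmult[OF Suc.hyps])
    also have "\<dots> \<le> (\<Sum>k=1..<n. w k) + w n"
    proof (intro add_mono Suc.IH)
      have r: "(rho n)\<^sup>2 \<le> (1 / real n)\<^sup>2" using rho_pos[of n] rho_le[of n] Suc.hyps by (intro power_mono) auto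
      have "(rho n)\<^sup>2 * expT n vv \<le> (rho n)\<^sup>2 * (lam * (1 + ln (real n)))"
        using expT_vv[OF Suc.hyps] by (intro mult_left_mono) auto
      also have "\<dots> \<le> (1 / real n)\<^sup>2 * (lam * (1 + ln (real n)))"
        using r lam_pos Suc.hyps by (intro mult_right_mono) auto
      finally show "(rho n)\<^sup>2 * expT n vv \<le> w n" by (simp add: w_def power_divide)
    qed
    finally show ?case using Suc.hyps by simp
  qed
  moreover have "(\<Sum>k=1..<n. w k) \<le> suminf w" for n
    using w w0 by (intro sum_le_suminf) auto
  ultimately show ?thesis by (intro exI[of _ "suminf w"]) (meson order_trans)
qed

end

section \<open>Exponential martingales and the upper bound\<close>

text \<open>The cubic Taylor remainder has coefficient at most \<open>3 / 6\<close> because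
  \<open>exp 1 \<le> 3\<close>, and one factor of \<open>x\<close> is at most
  \<open>\<epsilon>\<close> in modulus.\<close>

lemma exp_quadratic_bounds:
  assumes "\<bar>x\<bar> \<le> \<epsilon>" "\<epsilon> \<le> (1::real)"
  shows "exp x \<le> 1 + x + x\<^sup>2 / 2 * (1 + \<epsilon>)" "1 + x + x\<^sup>2 / 2 * (1 - \<epsilon>) \<le> exp x"
proof -
  obtain t where t: "\<bar>t\<bar> \<le> \<bar>x\<bar>" "exp x = (\<Sum>m<3. x ^ m / fact m) + exp t / fact 3 * x ^ 3"
    using Maclaurin_exp_le[of x 3] by blast
  have "exp t \<le> exp 1" using t assms by simp
  also have "exp 1 \<le> (3::real)" by (rule exp_le)
  finally have "exp t / fact 3 \<le> 1 / 2" by (simp add: fact_numeral)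
  define R where "R = exp t / fact 3 * x ^ 3"
  from \<open>exp t / fact 3 \<le> 1 / 2\<close> have R: "\<bar>R\<bar> \<le> 1 / 2 * (x\<^sup>2 * \<epsilon>)"
    unfolding R_def abs_mult using assms
    by (intro mult_mono) (auto simp: power3_eq_cube power2_eq_square abs_mult intro!: mult_left_mono)
  moreover have "(\<Sum>m<3. x ^ m / fact m) = 1 + x + x\<^sup>2 / 2"
    by (simp add: numeral_3_eq_3 power2_eq_square)
  moreover have "x\<^sup>2 / 2 * (1 + \<epsilon>) = x\<^sup>2 / 2 + 1 / 2 * (x\<^sup>2 * \<epsilon>)" "x\<^sup>2 / 2 * (1 - \<epsilon>) = x\<^sup>2 / 2 - 1 / 2 * (x\<^sup>2 * \<epsilon>)"
    by (simp_all add: field_simps)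
  ultimately show "exp x \<le> 1 + x + x\<^sup>2 / 2 * (1 + \<epsilon>)" "1 + x + x\<^sup>2 / 2 * (1 - \<epsilon>) \<le> exp x"
    using t(2)[folded R_def] R by (simp_all only:)
qed

lemma exp_le_one_plus:
  assumes "0 \<le> z" "z \<le> \<epsilon>" "\<epsilon> \<le> (1::real)"
  shows "exp (z * (1 - \<epsilon>)) \<le> 1 + z"
proof -
  have "z * (1 - \<epsilon>) \<le> z - z\<^sup>2" using assms using mult_right_mono[of z \<epsilon> z] by (simp add: power2_eq_square algebra_simps)
  also have "\<dots> \<le> ln (1 + z)" using assms by (intro ln_one_plus_pos_lower_bound) auto
  finally have "exp (z * (1 - \<epsilon>)) \<le> exp (ln (1 + z))" by simp
  then show ?thesis using assms by simp
qed

text \<open>To first order the sum of \<open>ln k / k^2\<close> over \<open>k \<ge> n\<close>, in a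
  closed form whose differences telescope.\<close>

definition hh :: "nat \<Rightarrow> real" where "hh n = ln (real n) / real n"

lemma hh_decr: "\<forall>\<^sub>F n in sequentially. hh (Suc n) < hh n"
proof -
  have "\<forall>\<^sub>F n in sequentially. hh (Suc n) - hh n < 0"
    unfolding hh_def by real_asymp
  then show ?thesis by simp
qed

context tree_params
begin

text \<open>
  \<open>lam * hh n\<close> is the variance of \<open>S - S\<^sub>n\<close> to first order, with decrements \<open>vk\<close>, and \<open>phi\<close> is the
  normalisation of the law of the iterated logarithm. A good tree has logarithmic height and nearly
  the predicted conditional variance.
\<close>

definition vk :: "nat \<Rightarrow> real" where "vk k = lam * (hh k - hh (Suc k))"

definition good :: "real \<Rightarrow> rec_tree \<Rightarrow> bool" where
  "good \<epsilon> t \<longleftrightarrow> ht t \<and> (1 - \<epsilon>) * vk (num_nodes t) \<le> (rho (num_nodes t))\<^sup>2 * vv t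
     \<and> (rho (num_nodes t))\<^sup>2 * vv t \<le> (1 + \<epsilon>) * vk (num_nodes t)"

definition phi :: "nat \<Rightarrow> real" where "phi n = sqrt (2 * lam * hh n * ln (ln (real n)))"

text \<open>Past \<open>K0\<close> the variances \<open>vk\<close> are positive and their square
  roots obey the bound that \<open>yy_bound\<close> gives for increments. This lets a sign of size
  \<open>sqrt (vk k)\<close> stand in for an increment in the lower bound.\<close>

definition K0 :: nat where
  "K0 = (SOME K. K \<ge> 3 \<and> (\<forall>k\<ge>K. hh (Suc k) < hh k \<and> sqrt (vk k) \<le> ch * hh k))"

lemma K0: "K0 \<ge> 3" "k \<ge> K0 \<Longrightarrow> hh (Suc k) < hh k" "k \<ge> K0 \<Longrightarrow> sqrt (vk k) \<le> ch * hh k"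
proof -
  have 1: "\<forall>\<^sub>F k in sequentially. sqrt (vk k) \<le> ch * hh k"
    unfolding vk_def hh_def using ch_pos lam_pos by real_asymp
  have "\<exists>K. K \<ge> 3 \<and> (\<forall>k\<ge>K. hh (Suc k) < hh k \<and> sqrt (vk k) \<le> ch * hh k)"
  proof -
    have "\<forall>\<^sub>F k in sequentially. k \<ge> 3 \<and> hh (Suc k) < hh k \<and> sqrt (vk k) \<le> ch * hh k"
      using 1 hh_decr eventually_ge_at_top[of 3] by eventually_elim auto
    then obtain K where "\<And>k. k \<ge> K \<Longrightarrow> k \<ge> 3 \<and> hh (Suc k) < hh k \<and> sqrt (vk k) \<le> ch * hh k"
      by (auto simp: eventually_sequentially)
    then show ?thesis by (intro exI[of _ K]) auto
  qed
  from someI_ex[OF this, folded K0_def]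
  show "K0 \<ge> 3" "k \<ge> K0 \<Longrightarrow> hh (Suc k) < hh k" "k \<ge> K0 \<Longrightarrow> sqrt (vk k) \<le> ch * hh k" by auto
qed

lemma hh_antimono:
  assumes "K0 \<le> n" "n \<le> k"
  shows "hh k \<le> hh n"
  using assms(2)
proof (induction k rule: dec_induct)
  case (step k)
  then show ?case using K0(2)[of k] assms(1) by simp
qed simp

lemma hh_pos: "K0 \<le> n \<Longrightarrow> hh n > 0"
  using K0(1) by (simp add: hh_def)

lemma vk_pos: "K0 \<le> k \<Longrightarrow> vk k > 0"
  using K0(2)[of k] lam_pos by (simp add: vk_def)

lemma sum_vk: "n \<le> N \<Longrightarrow> (\<Sum>k=n..<N. vk k) = lam * (hh n - hh N)"
  by (induction N rule: dec_induct) (auto simp: vk_def algebra_simps)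

lemma phi_tendsto_0: "phi \<longlonglongrightarrow> 0"
  unfolding phi_def[abs_def] hh_def using lam_pos by real_asymp

lemma yy_bound:
  assumes "reach t" "good \<epsilon> t" "v \<in> nodes t"
  shows "\<bar>yy t v\<bar> \<le> ch * hh (num_nodes t)"
proof -
  let ?n = "num_nodes t"
  have d: "\<bar>real (dep t v) - mu t\<bar> \<le> ch * ln (real ?n)"
    using assms by (intro dev_bound) (auto simp: good_def)
  have "\<bar>yy t v\<bar> \<le> 1 / real ?n * (ch * ln (real ?n))"
    unfolding yy_def abs_mult using rho_pos[of ?n] rho_le[of ?n] by (intro mult_mono d) auto
  then show ?thesis by (simp add: hh_def)
qed

text \<open>The exponential is compared with its quadratic polynomial, whose average is known from
  the first two moments of \<open>yy\<close>. Each factor \<open>1 + \<epsilon>\<close> or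
  \<open>1 - \<epsilon>\<close> in the exponents pays for one approximation: Taylor, the variance
  allowed by \<open>good\<close>, and in the lower bound also \<open>1 + z\<close> against an
  exponential.\<close>

lemma avg_exp_bounds:
  assumes t: "reach t" "good \<epsilon> t" "num_nodes t \<ge> K0" and s: "\<bar>s\<bar> * (ch * hh (num_nodes t)) \<le> \<epsilon>" and e: "\<epsilon> \<le> 1"
  shows "avg t (\<lambda>v. exp (s * yy t v)) \<le> exp (s\<^sup>2 / 2 * (1 + \<epsilon>)\<^sup>2 * vk (num_nodes t))"
    and "exp (s\<^sup>2 / 2 * (1 - \<epsilon>) ^ 3 * vk (num_nodes t)) \<le> avg t (\<lambda>v. exp (s * yy t v))"
proof -
  let ?k = "num_nodes t"
  let ?w = "(rho ?k)\<^sup>2 * vv t"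
  have e0: "0 \<le> \<epsilon>" using s hh_pos[OF t(3)] ch_pos by (smt (verit) mult_nonneg_nonneg)
  have w: "(1 - \<epsilon>) * vk ?k \<le> ?w" "?w \<le> (1 + \<epsilon>) * vk ?k" using t(2) by (auto simp: good_def)
  have small: "\<bar>s * yy t v\<bar> \<le> \<epsilon>" if "v \<in> nodes t" for v
  proof -
    have "\<bar>s * yy t v\<bar> \<le> \<bar>s\<bar> * (ch * hh ?k)"
      unfolding abs_mult using yy_bound[OF t(1,2) that] by (intro mult_left_mono) auto
    then show ?thesis using s by linarith
  qed
  have av: "avg t (\<lambda>v. 1 + s * yy t v + (s * yy t v)\<^sup>2 / 2 * c) = 1 + s\<^sup>2 / 2 * ?w * c" for c
  proof -
    have "(\<lambda>v. 1 + s * yy t v + (s * yy t v)\<^sup>2 / 2 * c) = (\<lambda>v. 1 + s * yy t v + (s\<^sup>2 / 2 * c) * (yy t v)\<^sup>2)"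
      by (auto simp: power_mult_distrib)
    then have "avg t (\<lambda>v. 1 + s * yy t v + (s * yy t v)\<^sup>2 / 2 * c) = 1 + s * 0 + (s\<^sup>2 / 2 * c) * ?w"
      by (simp only: avg_add avg_cmult avg_const[OF t(1)] avg_yy[OF t(1)] avg_yy2[OF t(1)])
    then show ?thesis by simp
  qed
  have "avg t (\<lambda>v. exp (s * yy t v)) \<le> avg t (\<lambda>v. 1 + s * yy t v + (s * yy t v)\<^sup>2 / 2 * (1 + \<epsilon>))"
    using small e by (intro avg_mono t exp_quadratic_bounds) auto
  also have "\<dots> = 1 + s\<^sup>2 / 2 * ?w * (1 + \<epsilon>)" by (rule av)
  also have "\<dots> \<le> exp (s\<^sup>2 / 2 * ?w * (1 + \<epsilon>))" by (rule exp_ge_add_one_self)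
  also have "s\<^sup>2 / 2 * ?w * (1 + \<epsilon>) \<le> s\<^sup>2 / 2 * ((1 + \<epsilon>) * vk ?k) * (1 + \<epsilon>)"
    using w e0 by (intro mult_right_mono mult_left_mono) auto
  finally show "avg t (\<lambda>v. exp (s * yy t v)) \<le> exp (s\<^sup>2 / 2 * (1 + \<epsilon>)\<^sup>2 * vk ?k)"
    by (simp add: power2_eq_square mult_ac)
  \<comment> \<open>The scaled variance is an average of squares that are at most
    \<open>\<epsilon>\<close>, which makes \<open>z\<close> small enough for
    \<open>exp_le_one_plus\<close>.\<close>
  have "?w = avg t (\<lambda>v. (yy t v)\<^sup>2)" by (simp add: avg_yy2[OF t(1)])
  also have "s\<^sup>2 * \<dots> = avg t (\<lambda>v. (s * yy t v)\<^sup>2)" by (simp add: avg_cmult power_mult_distrib)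
  also have "\<dots> \<le> avg t (\<lambda>_. \<epsilon>)"
  proof (rule avg_mono[OF t(1)])
    fix v assume "v \<in> nodes t"
    then have "(s * yy t v)\<^sup>2 \<le> \<epsilon>\<^sup>2" using small e0 by (intro power2_le_iff_abs_le[THEN iffD2]) auto
    also have "\<epsilon>\<^sup>2 \<le> \<epsilon>" using e e0 by (simp add: power2_eq_square mult_left_le)
    finally show "(s * yy t v)\<^sup>2 \<le> \<epsilon>" .
  qed
  finally have sw: "s\<^sup>2 * ?w \<le> \<epsilon>" by (simp add: avg_const[OF t(1)])
  define z where "z = s\<^sup>2 / 2 * ?w * (1 - \<epsilon>)"
  have w0: "0 \<le> ?w" using vv_nonneg[OF t(1)] by simp
  have z0: "0 \<le> z" unfolding z_def using vv_nonneg[OF t(1)] e by (intro mult_nonneg_nonneg) auto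
  have "z \<le> s\<^sup>2 / 2 * ?w" unfolding z_def using w0 e0 by (intro mult_left_le) auto
  then have z: "z \<le> \<epsilon>" using sw e0 by simp
  have "s\<^sup>2 / 2 * (1 - \<epsilon>) ^ 3 * vk ?k = (s\<^sup>2 / 2 * ((1 - \<epsilon>) * vk ?k) * (1 - \<epsilon>)) * (1 - \<epsilon>)"
    by (simp add: power3_eq_cube mult_ac)
  also have "\<dots> \<le> z * (1 - \<epsilon>)"
    unfolding z_def using w e by (intro mult_right_mono mult_left_mono) auto
  finally have "exp (s\<^sup>2 / 2 * (1 - \<epsilon>) ^ 3 * vk ?k) \<le> exp (z * (1 - \<epsilon>))" by simp
  also have "\<dots> \<le> 1 + z" using z0 z e by (rule exp_le_one_plus)
  also have "\<dots> = avg t (\<lambda>v. 1 + s * yy t v + (s * yy t v)\<^sup>2 / 2 * (1 - \<epsilon>))" by (simp only: av z_def)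
  also have "\<dots> \<le> avg t (\<lambda>v. exp (s * yy t v))"
    using small e by (intro avg_mono t exp_quadratic_bounds) auto
  finally show "exp (s\<^sup>2 / 2 * (1 - \<epsilon>) ^ 3 * vk ?k) \<le> avg t (\<lambda>v. exp (s * yy t v))" .
qed

end

context tree_run
begin

text \<open>Both \<open>(rho n)\<^sup>2 * vv (T n \<omega>)\<close> and \<open>vk n\<close> are
  asymptotic to \<open>lam * ln n / n^2\<close>, the former by \<open>AE_vv\<close>, the latter by
  differencing \<open>ln n / n\<close>.\<close>

lemma AE_good:
  assumes "\<epsilon> > 0"
  shows "AE \<omega> in M. \<forall>\<^sub>F n in sequentially. good \<epsilon> (T n \<omega>)"
  using AE_path AE_ht AE_vv
proof eventually_elim
  case (elim \<omega>)
  have "(\<lambda>n. lam * ((rho n)\<^sup>2 * ln (real n) / vk n)) \<longlonglongrightarrow> 1"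
    unfolding rho_def vk_def hh_def using lam_pos by real_asymp
  then have "(\<lambda>n. vv (T n \<omega>) / ln (real n) * (1 / lam) * (lam * ((rho n)\<^sup>2 * ln (real n) / vk n))) \<longlonglongrightarrow> lam * (1 / lam) * 1"
    by (intro tendsto_intros elim)
  moreover have "\<forall>\<^sub>F n in sequentially. vv (T n \<omega>) / ln (real n) * (1 / lam) * (lam * ((rho n)\<^sup>2 * ln (real n) / vk n))
      = (rho n)\<^sup>2 * vv (T n \<omega>) / vk n"
    using eventually_gt_at_top[of 1]
  proof eventually_elim
    case (elim n)
    then have "ln (real n) > 0" by simp
    then show ?case using lam_pos by (simp add: field_simps)
  qed
  ultimately have "(\<lambda>n. (rho n)\<^sup>2 * vv (T n \<omega>) / vk n) \<longlonglongrightarrow> lam * (1 / lam) * 1"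
    by (rule Lim_transform_eventually)
  then have "(\<lambda>n. (rho n)\<^sup>2 * vv (T n \<omega>) / vk n) \<longlonglongrightarrow> 1"
    using lam_pos by simp
  then have "\<forall>\<^sub>F n in sequentially. dist ((rho n)\<^sup>2 * vv (T n \<omega>) / vk n) 1 < \<epsilon>"
    using assms by (rule tendstoD)
  with elim(2) eventually_ge_at_top[of K0] show ?case
  proof eventually_elim
    case (elim n)
    have v: "vk n > 0" by (rule vk_pos[OF elim(2)])
    have n: "num_nodes (T n \<omega>) = n" using path_trees[OF \<open>path (\<lambda>n. T n \<omega>)\<close>, of n] elim(2) K0(1) by (simp add: trees_def)
    have "(1 - \<epsilon>) < (rho n)\<^sup>2 * vv (T n \<omega>) / vk n" "(rho n)\<^sup>2 * vv (T n \<omega>) / vk n < 1 + \<epsilon>"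
      using elim(3) by (auto simp: dist_real_def abs_less_iff)
    then show ?case using v elim(1) unfolding good_def n by (simp add: field_simps)
  qed
qed

text \<open>Ville's inequality for the exponential supermartingale \<open>f\<close>, whose
  compensator uses the deterministic variances. At a bad tree the sum stands still while the
  subtracted variance grows, which is harmless for an upper bound. The sign \<open>g\<close> treats
  both directions at once.\<close>

lemma max_tail:
  assumes n: "n \<ge> K0" and e: "\<epsilon> \<le> 1" and s: "0 \<le> s" "s * (ch * hh n) \<le> \<epsilon>" and g: "\<bar>g\<bar> = (1::real)"
  shows "prob {\<omega>\<in>space M. \<exists>k\<ge>n. lam * (hh n - hh k) \<le> u \<and> x \<le> g * tsum n (good \<epsilon>) yy (T k \<omega>)}
    \<le> exp (s\<^sup>2 / 2 * (1 + \<epsilon>)\<^sup>2 * u - s * x)"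
proof -
  let ?Y = "tsum n (good \<epsilon>) yy"
  define c where "c = s\<^sup>2 / 2 * (1 + \<epsilon>)\<^sup>2"
  have c0: "0 \<le> c" by (simp add: c_def)
  define f where "f t = exp (s * (g * ?Y t) - c * (lam * (hh n - hh (num_nodes t))))" for t
  have n1: "n \<ge> 1" using n K0(1) by simp
  have fs: "avg t (\<lambda>v. f (Attach t v)) \<le> f t" if t: "reach t" "n \<le> num_nodes t" for t
  proof -
    let ?k = "num_nodes t"
    have k: "?k \<ge> K0" using t n by simp
    have sp: "f (Attach t v) = f t * (exp (s * g * (if good \<epsilon> t then yy t v else 0)) * exp (- (c * vk ?k)))" for v
      using t by (simp add: f_def exp_add[symmetric] vk_def algebra_simps)
    show ?thesis
    proof (cases "good \<epsilon> t")
      case True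
      have "s * (ch * hh ?k) \<le> s * (ch * hh n)"
        using hh_antimono[OF n t(2)] s ch_pos by (intro mult_left_mono) auto
      then have "\<bar>s * g\<bar> * (ch * hh ?k) \<le> \<epsilon>" using s g by (simp add: abs_mult)
      from avg_exp_bounds(1)[OF t(1) True k this e]
      have A: "avg t (\<lambda>v. exp (s * g * yy t v)) \<le> exp (c * vk ?k)"
        using g by (simp add: c_def power_mult_distrib power2_eq_1_iff abs_if split: if_splits)
      have "avg t (\<lambda>v. f (Attach t v)) = f t * (avg t (\<lambda>v. exp (s * g * yy t v)) * exp (- (c * vk ?k)))"
        unfolding sp by (simp add: True avg_cmult avg_cmult_right)
      also have "\<dots> \<le> f t * (exp (c * vk ?k) * exp (- (c * vk ?k)))"
        using A by (intro mult_left_mono mult_right_mono) (auto simp: f_def)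
      finally show ?thesis by (simp add: exp_minus)
    next
      case False
      have "0 \<le> c * vk ?k" using vk_pos[OF k] c0 by simp
      then have "f t * exp (- (c * vk ?k)) \<le> f t * 1" by (intro mult_left_mono) (auto simp: f_def)
      then show ?thesis unfolding sp using False by (simp add: avg_const[OF t(1)])
    qed
  qed
  have "prob {\<omega>\<in>space M. \<exists>k\<ge>n. lam * (hh n - hh k) \<le> u \<and> x \<le> g * ?Y (T k \<omega>)} \<le>
     prob {\<omega>\<in>space M. \<exists>k\<ge>n. exp (s * x - c * u) \<le> f (T k \<omega>)}"
  proof (rule finite_measure_mono_AE)
    show "AE \<omega> in M. \<omega> \<in> {\<omega>\<in>space M. \<exists>k\<ge>n. lam * (hh n - hh k) \<le> u \<and> x \<le> g * ?Y (T k \<omega>)} \<longrightarrow>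
        \<omega> \<in> {\<omega>\<in>space M. \<exists>k\<ge>n. exp (s * x - c * u) \<le> f (T k \<omega>)}"
      using AE_path
    proof eventually_elim
      case (elim \<omega>)
      have "exp (s * x - c * u) \<le> f (T k \<omega>)" if k: "k \<ge> n" "lam * (hh n - hh k) \<le> u" "x \<le> g * ?Y (T k \<omega>)" for k
      proof -
        have "num_nodes (T k \<omega>) = k" using path_trees[OF elim, of k] k n1 by (simp add: trees_def)
        moreover have "c * (lam * (hh n - hh k)) \<le> c * u" using k c0 by (intro mult_left_mono) auto
        moreover have "s * x \<le> s * (g * ?Y (T k \<omega>))" using k s by (intro mult_left_mono) auto
        ultimately show ?thesis by (simp add: f_def)
      qed
      then show ?case by auto
    qed
    show "{\<omega>\<in>space M. \<exists>k\<ge>n. exp (s * x - c * u) \<le> f (T k \<omega>)} \<in> events"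
      by (rule T_event_ex[OF n1])
  qed
  also have "\<dots> \<le> expT n f / exp (s * x - c * u)"
    by (rule ville[OF n1 _ _ fs]) (auto simp: f_def)
  also have "expT n f = expT n (\<lambda>_. 1)"
    by (intro expT_cong n1) (auto simp: f_def trees_def tsum_le)
  finally show ?thesis by (simp add: expT_const[OF n1] exp_minus[symmetric] inverse_eq_divide[symmetric] c_def)
qed

text \<open>\<open>\<kappa>\<close> is the fraction of the tail variance that may be consumed. The
  condition on \<open>y\<close>, \<open>\<kappa>\<close> and \<open>\<eta>\<close> makes the
  Gaussian exponent at least \<open>1 + \<eta>\<close> times the iterated logarithm, so the bound is
  summable along geometric sizes.\<close>

lemma max_tail_phi:
  assumes e: "0 < \<epsilon>" "\<epsilon> \<le> 1" and y: "0 < y" "0 < \<kappa>" "(1 + \<eta>) * (\<kappa> * (1 + \<epsilon>)\<^sup>2) \<le> y\<^sup>2" and g: "\<bar>g\<bar> = (1::real)"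
  shows "\<forall>\<^sub>F n in sequentially.
    prob {\<omega>\<in>space M. \<exists>k\<ge>n. lam * (hh n - hh k) \<le> \<kappa> * (lam * hh n) \<and> y * phi n \<le> g * tsum n (good \<epsilon>) yy (T k \<omega>)}
      \<le> ln (real n) powr - (1 + \<eta>)"
proof -
  let ?c = "y * ch / (\<kappa> * lam * (1 + \<epsilon>)\<^sup>2)"
  have "(\<lambda>n. ?c * phi n) \<longlonglongrightarrow> ?c * 0" by (intro tendsto_intros phi_tendsto_0)
  then have "\<forall>\<^sub>F n in sequentially. ?c * phi n < \<epsilon>" using e by (intro order_tendstoD) auto
  moreover have "\<forall>\<^sub>F n in sequentially. ln (ln (real n)) > 0" by real_asymp
  ultimately show ?thesis using eventually_ge_at_top[of K0]
  proof eventually_elim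
    case (elim n)
    let ?L = "ln (ln (real n))"
    have h: "hh n > 0" using hh_pos elim by simp
    have p2: "(phi n)\<^sup>2 = 2 * lam * hh n * ?L" and p0: "phi n \<ge> 0"
      using h elim lam_pos by (simp_all add: phi_def)
    define D where "D = \<kappa> * (lam * hh n) * (1 + \<epsilon>)\<^sup>2"
    have D: "D > 0" unfolding D_def using y lam_pos h e by (intro mult_pos_pos zero_less_power) auto
    \<comment> \<open>Minimiser of the exponent \<open>s\<^sup>2 / 2 * D - s * (y * phi n)\<close>.
      It is admissible for large \<open>n\<close> because \<open>s * hh n\<close> is a multiple of
      \<open>phi n\<close>.\<close>
    define s where "s = y * phi n / D"
    have s0: "0 \<le> s" using p0 y D by (simp add: s_def)
    have "s * (ch * hh n) = ?c * phi n" using h by (simp add: s_def D_def mult_ac)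
    then have s1: "s * (ch * hh n) \<le> \<epsilon>" using elim by simp
    have "prob {\<omega>\<in>space M. \<exists>k\<ge>n. lam * (hh n - hh k) \<le> \<kappa> * (lam * hh n) \<and> y * phi n \<le> g * tsum n (good \<epsilon>) yy (T k \<omega>)}
      \<le> exp (s\<^sup>2 / 2 * (1 + \<epsilon>)\<^sup>2 * (\<kappa> * (lam * hh n)) - s * (y * phi n))"
      using elim e by (intro max_tail s0 s1 g) auto
    also have "s\<^sup>2 / 2 * (1 + \<epsilon>)\<^sup>2 * (\<kappa> * (lam * hh n)) = s\<^sup>2 / 2 * D" by (simp add: D_def mult_ac)
    also have "s\<^sup>2 / 2 * D - s * (y * phi n) = - (y\<^sup>2 * (phi n)\<^sup>2 / (2 * D))"
      using D by (simp add: s_def power2_eq_square field_simps)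
    also have "y\<^sup>2 * (phi n)\<^sup>2 / (2 * D) = y\<^sup>2 / (\<kappa> * (1 + \<epsilon>)\<^sup>2) * ?L"
      unfolding p2 D_def using h lam_pos by simp
    also have "exp (- (y\<^sup>2 / (\<kappa> * (1 + \<epsilon>)\<^sup>2) * ?L)) \<le> exp (- ((1 + \<eta>) * ?L))"
    proof -
      have "1 + \<eta> \<le> y\<^sup>2 / (\<kappa> * (1 + \<epsilon>)\<^sup>2)"
        using y e by (subst pos_le_divide_eq) (auto intro!: mult_pos_pos)
      then have "(1 + \<eta>) * ?L \<le> y\<^sup>2 / (\<kappa> * (1 + \<epsilon>)\<^sup>2) * ?L" using elim by (intro mult_right_mono) auto
      then show ?thesis by simp
    qed
    also have "\<dots> = ln (real n) powr - (1 + \<eta>)"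
      using elim by (simp add: powr_def mult_ac) (auto simp: algebra_simps)
    finally show ?case .
  qed
qed

end

subsection \<open>Geometric blocks\<close>

definition geo :: "real \<Rightarrow> nat \<Rightarrow> nat" where "geo \<theta> j = nat \<lceil>\<theta> ^ j\<rceil>"

context
  fixes \<theta> :: real
  assumes \<theta>: "\<theta> > 1"
begin

lemma geo_bounds: "\<theta> ^ j \<le> real (geo \<theta> j)" "real (geo \<theta> j) < \<theta> ^ j + 1"
proof -
  have "0 \<le> \<theta> ^ j" using \<theta> by simp
  then have "0 \<le> \<lceil>\<theta> ^ j\<rceil>" by (simp add: zero_le_ceiling)
  then have "real (geo \<theta> j) = of_int \<lceil>\<theta> ^ j\<rceil>" by (simp add: geo_def)
  then show "\<theta> ^ j \<le> real (geo \<theta> j)" "real (geo \<theta> j) < \<theta> ^ j + 1"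
    using ceiling_correct[of "\<theta> ^ j"] by auto
qed

lemma geo_mono: "i \<le> j \<Longrightarrow> geo \<theta> i \<le> geo \<theta> j"
  unfolding geo_def using \<theta> by (intro nat_mono ceiling_mono power_increasing) auto

lemma filterlim_geo: "filterlim (geo \<theta>) at_top sequentially"
proof -
  have "filterlim (\<lambda>j. \<theta> ^ j) at_top sequentially" using \<theta> by real_asymp
  then have "filterlim (\<lambda>j. real (geo \<theta> j)) at_top sequentially"
    by (rule filterlim_at_top_mono) (simp add: geo_bounds)
  then show ?thesis by (rule filterlim_sequentially_iff_filterlim_real[THEN iffD2])
qed

text \<open>Rounding up costs at most one, which any ratio larger than \<open>\<theta>\<close>
  absorbs for large \<open>j\<close>.\<close>

lemma geo_ratio: "\<theta>' > \<theta> \<Longrightarrow> \<forall>\<^sub>F j in sequentially. real (geo \<theta> (Suc j)) \<le> \<theta>' * real (geo \<theta> j)"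
proof -
  assume "\<theta>' > \<theta>"
  have "filterlim (\<lambda>j. \<theta> ^ j) at_top sequentially" using \<theta> by real_asymp
  then have "\<forall>\<^sub>F j in sequentially. 1 / (\<theta>' - \<theta>) \<le> \<theta> ^ j" unfolding filterlim_at_top by blast
  then have "\<forall>\<^sub>F j in sequentially. \<theta> ^ Suc j + 1 \<le> \<theta>' * \<theta> ^ j"
    by eventually_elim (use \<open>\<theta>' > \<theta>\<close> in \<open>simp add: field_simps\<close>)
  then show ?thesis
  proof eventually_elim
    case (elim j)
    have "\<theta>' * \<theta> ^ j \<le> \<theta>' * real (geo \<theta> j)"
      using geo_bounds \<open>\<theta>' > \<theta>\<close> \<theta> by (intro mult_left_mono) auto
    then show ?case using elim geo_bounds(2)[of "Suc j"] by linarith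
  qed
qed

lemma geo_between:
  assumes "geo \<theta> J \<le> n"
  obtains j where "j \<ge> J" "geo \<theta> j \<le> n" "n < geo \<theta> (Suc j)"
proof -
  have "\<forall>\<^sub>F j in sequentially. Suc n \<le> geo \<theta> j" using filterlim_geo unfolding filterlim_at_top by blast
  then obtain k where k: "geo \<theta> k > n" by (auto simp: eventually_sequentially Suc_le_eq)
  define i where "i = (LEAST i. geo \<theta> i > n)"
  have i: "geo \<theta> i > n" unfolding i_def using k by (rule LeastI)
  have "i > J" using geo_mono[of i J] i assms by (cases "i \<le> J") auto
  then obtain j where j: "i = Suc j" "j \<ge> J" by (cases i) auto
  have "\<not> geo \<theta> j > n" using not_less_Least[of j "\<lambda>i. geo \<theta> i > n"] j(1) by (simp add: i_def)
  then show ?thesis using that[of j] i j by auto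
qed

text \<open>The logarithm of the size is at least \<open>j * ln \<theta>\<close>.\<close>

lemma summable_ln_geo:
  assumes "\<eta> > 0"
  shows "summable (\<lambda>j. ln (real (geo \<theta> j)) powr - (1 + \<eta>))"
proof (rule summable_comparison_test_ev)
  have l: "ln \<theta> > 0" using \<theta> by simp
  show "summable (\<lambda>j. ln \<theta> powr - (1 + \<eta>) * real j powr - (1 + \<eta>))"
    using assms by (intro summable_mult) (simp add: summable_real_powr_iff)
  show "\<forall>\<^sub>F j in sequentially. norm (ln (real (geo \<theta> j)) powr - (1 + \<eta>)) \<le> ln \<theta> powr - (1 + \<eta>) * real j powr - (1 + \<eta>)"
    using eventually_gt_at_top[of 0]
  proof eventually_elim
    case (elim j)
    have "real j * ln \<theta> = ln (\<theta> ^ j)" using \<theta> by (simp add: ln_realpow)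
    also have "\<dots> \<le> ln (real (geo \<theta> j))" 
    proof (subst ln_le_cancel_iff)
      show "0 < \<theta> ^ j" using \<theta> by simp
      then show "0 < real (geo \<theta> j)" using geo_bounds(1)[of j] by linarith
    qed (rule geo_bounds)
    finally have "ln (real (geo \<theta> j)) powr - (1 + \<eta>) \<le> (real j * ln \<theta>) powr - (1 + \<eta>)"
      using elim l assms by (intro powr_mono2') auto
    also have "\<dots> = ln \<theta> powr - (1 + \<eta>) * real j powr - (1 + \<eta>)"
      using l by (simp add: powr_mult mult_ac)
    finally show ?case by simp
  qed
qed

end

context tree_run
begin

text \<open>Borel-Cantelli along geometric sizes; eventually all trees are good, and then the gated
  sum from the block start is the true increment of \<open>spl\<close>.\<close>

lemma AE_tail_bound:
  assumes \<theta>: "\<theta> > 1" and e: "0 < \<epsilon>" "\<epsilon> \<le> 1" "0 < \<eta>"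
    and y: "0 < y" "0 < \<kappa>" "(1 + \<eta>) * (\<kappa> * (1 + \<epsilon>)\<^sup>2) \<le> y\<^sup>2" and g: "\<bar>g\<bar> = (1::real)"
  shows "AE \<omega> in M. \<forall>\<^sub>F j in sequentially. \<forall>k\<ge>geo \<theta> j. hh (geo \<theta> j) - hh k \<le> \<kappa> * hh (geo \<theta> j) \<longrightarrow>
     g * (spl (T k \<omega>) - spl (T (geo \<theta> j) \<omega>)) < y * phi (geo \<theta> j)"
proof -
  let ?n = "geo \<theta>"
  have geo1: "?n j \<ge> 1" for j
    using geo_bounds(1)[OF \<theta>, of j] one_le_power[of \<theta> j] \<theta> by linarith
  let ?P = "\<lambda>n \<omega>. \<exists>k\<ge>n. lam * (hh n - hh k) \<le> \<kappa> * (lam * hh n) \<and> y * phi n \<le> g * tsum n (good \<epsilon>) yy (T k \<omega>)"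
  have "AE \<omega> in M. \<forall>\<^sub>F j in sequentially. \<not> ?P (?n j) \<omega>"
  proof (rule borel_cantelli_AE)
    show "\<And>j. {\<omega>\<in>space M. ?P (?n j) \<omega>} \<in> events" by (rule T_event_ex[OF geo1])
    show "summable (\<lambda>j. prob {\<omega>\<in>space M. ?P (?n j) \<omega>})"
    proof (rule summable_comparison_test_ev)
      show "summable (\<lambda>j. ln (real (?n j)) powr - (1 + \<eta>))" by (rule summable_ln_geo[OF \<theta> e(3)])
      show "\<forall>\<^sub>F j in sequentially. norm (prob {\<omega>\<in>space M. ?P (?n j) \<omega>}) \<le> ln (real (?n j)) powr - (1 + \<eta>)"
        using eventually_compose_filterlim[OF max_tail_phi[OF e(1,2) y g] filterlim_geo[OF \<theta>]]
        by simp
    qed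
  qed
  with AE_path AE_good[OF e(1)] show ?thesis
  proof eventually_elim
    case (elim \<omega>)
    obtain N where N: "\<And>k. k \<ge> N \<Longrightarrow> good \<epsilon> (T k \<omega>)" using elim(2) by (auto simp: eventually_sequentially)
    have "\<forall>\<^sub>F j in sequentially. ?n j \<ge> N" using filterlim_geo[OF \<theta>] unfolding filterlim_at_top by blast
    with elim(3) show ?case
    proof eventually_elim
      case (elim j)
      show ?case
      proof (intro allI impI)
        fix k assume k: "?n j \<le> k" "hh (?n j) - hh k \<le> \<kappa> * hh (?n j)"
        have eq: "tsum (?n j) (good \<epsilon>) yy (T k \<omega>) = spl (T k \<omega>) - spl (T (?n j) \<omega>)"
          using path_tsum[OF \<open>path (\<lambda>n. T n \<omega>)\<close> geo1 k(1), of "good \<epsilon>" spl yy] N elim(2) by simp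
        have "lam * (hh (?n j) - hh k) \<le> \<kappa> * (lam * hh (?n j))"
          using mult_left_mono[OF k(2), of lam] lam_pos by (simp add: mult_ac)
        then have "\<not> y * phi (?n j) \<le> g * tsum (?n j) (good \<epsilon>) yy (T k \<omega>)"
          using elim(1) k(1) by blast
        then show "g * (spl (T k \<omega>) - spl (T (?n j) \<omega>)) < y * phi (?n j)" by (simp add: eq)
      qed
    qed
  qed
qed

text \<open>For \<open>n\<close> in a block starting at \<open>a\<close>, the increment after
  \<open>n\<close> is split at \<open>a\<close>. The tail bound with \<open>\<kappa> = 1\<close>
  controls the movement from \<open>a\<close> to any later time by
  \<open>(1 + \<eta>) * phi a\<close>; with a small \<open>\<kappa>\<close> it controls the movement
  from \<open>a\<close> to \<open>n\<close> by \<open>\<eta> * phi a\<close>.\<close>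

lemma AE_lil_upper:
  assumes "\<delta> > 0"
  shows "AE \<omega> in M. \<forall>\<^sub>F n in sequentially. \<forall>k\<ge>n. \<bar>spl (T k \<omega>) - spl (T n \<omega>)\<bar> \<le> (1 + \<delta>) * phi n"
proof -
  \<comment> \<open>Chosen for the final estimate
    \<open>(1 + 2 * \<eta>) * (1 + \<eta>) \<le> 1 + 5 * \<eta>\<close>.\<close>
  define \<eta> where "\<eta> = min 1 (\<delta> / 5)"
  have \<eta>: "0 < \<eta>" "\<eta> \<le> 1" "5 * \<eta> \<le> \<delta>" using assms by (auto simp: \<eta>_def)
  define \<epsilon> where "\<epsilon> = \<eta> / 3"
  have e: "0 < \<epsilon>" "\<epsilon> \<le> 1" using \<eta> by (auto simp: \<epsilon>_def)
  have "\<eta> * \<eta> \<le> \<eta> * 1" using \<eta> by (intro mult_left_mono) auto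
  then have e2: "(1 + \<epsilon>)\<^sup>2 \<le> 1 + \<eta>" using \<eta> by (simp add: \<epsilon>_def power2_eq_square field_simps)
  \<comment> \<open>Solves \<open>(1 + \<eta>)\<^sup>2 * \<kappa> = \<eta>\<^sup>2\<close>, so that
    a deviation of \<open>\<eta> * phi\<close> meets the condition of the tail bound.\<close>
  define \<kappa> where "\<kappa> = \<eta>\<^sup>2 / (1 + \<eta>)\<^sup>2"
  have \<kappa>: "0 < \<kappa>" "\<kappa> < 1"
    using \<eta> by (auto simp: \<kappa>_def power_strict_mono)
  have y1: "(1 + \<eta>) * (1 * (1 + \<epsilon>)\<^sup>2) \<le> (1 + \<eta>)\<^sup>2"
    using e2 \<eta> by (simp add: power2_eq_square[of "1 + \<eta>"] mult_left_mono)
  have y2: "(1 + \<eta>) * (\<kappa> * (1 + \<epsilon>)\<^sup>2) \<le> \<eta>\<^sup>2"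
  proof -
    have "(1 + \<eta>) * (\<kappa> * (1 + \<epsilon>)\<^sup>2) \<le> (1 + \<eta>) * (\<kappa> * (1 + \<eta>))"
      using e2 \<eta> \<kappa> by (intro mult_left_mono) auto
    also have "\<dots> = \<eta>\<^sup>2" using \<eta> by (simp add: \<kappa>_def power2_eq_square)
    finally show ?thesis .
  qed
  \<comment> \<open>The first bound keeps \<open>phi\<close> from dropping within a block by more
    than the factor \<open>1 + \<eta>\<close>; the second keeps the variance consumed inside a block
    below the fraction \<open>\<kappa>\<close>.\<close>
  define \<theta>' where "\<theta>' = min ((1 + \<eta>)\<^sup>2) (1 / (1 - \<kappa>))"
  have "\<theta>' > 1" unfolding \<theta>'_def using \<eta> \<kappa> by (auto simp: one_less_power)
  then obtain \<theta> where \<theta>: "1 < \<theta>" "\<theta> < \<theta>'" using dense by blast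
  let ?n = "geo \<theta>"
  have AE1: "AE \<omega> in M. \<forall>\<^sub>F j in sequentially. \<forall>k\<ge>?n j. hh (?n j) - hh k \<le> 1 * hh (?n j) \<longrightarrow>
     g * (spl (T k \<omega>) - spl (T (?n j) \<omega>)) < (1 + \<eta>) * phi (?n j)" if "\<bar>g\<bar> = 1" for g
    using \<eta> by (intro AE_tail_bound[OF \<theta>(1) e \<eta>(1) _ _ y1 that]) auto
  have AE2: "AE \<omega> in M. \<forall>\<^sub>F j in sequentially. \<forall>k\<ge>?n j. hh (?n j) - hh k \<le> \<kappa> * hh (?n j) \<longrightarrow>
     g * (spl (T k \<omega>) - spl (T (?n j) \<omega>)) < \<eta> * phi (?n j)" if "\<bar>g\<bar> = 1" for g
    using \<eta> \<kappa> by (intro AE_tail_bound[OF \<theta>(1) e \<eta>(1) _ _ y2 that]) auto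
  have r: "\<forall>\<^sub>F j in sequentially. real (?n (Suc j)) \<le> \<theta>' * real (?n j)" by (rule geo_ratio[OF \<theta>])
  have large: "\<forall>\<^sub>F j in sequentially. ?n j \<ge> max K0 16" using filterlim_geo[OF \<theta>(1)] unfolding filterlim_at_top by blast
  have g: "\<bar>1::real\<bar> = 1" "\<bar>-1::real\<bar> = 1" by simp_all
  from AE1[OF g(1)] AE1[OF g(2)] AE2[OF g(1)] AE2[OF g(2)] show ?thesis
  proof eventually_elim
    case (elim \<omega>)
    have "\<forall>\<^sub>F j in sequentially. \<forall>n. ?n j \<le> n \<and> n < ?n (Suc j) \<longrightarrow> (\<forall>k\<ge>n. \<bar>spl (T k \<omega>) - spl (T n \<omega>)\<bar> \<le> (1 + \<delta>) * phi n)"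
      using elim r large
    proof eventually_elim
      case (elim j)
      show ?case
      proof (intro allI impI, elim conjE)
        fix n k assume n: "?n j \<le> n" "n < ?n (Suc j)" and k: "n \<le> k"
        let ?a = "?n j"
        have a: "?a \<ge> K0" "?a \<ge> 16" using elim(6) by auto
        have hp: "hh k > 0" "hh n > 0" "hh ?a > 0" using a n k by (auto intro!: hh_pos)
        have rat: "real n \<le> \<theta>' * real ?a" using elim(5) n by linarith
        have lna: "ln (real ?a) > 0" "ln (real n) \<ge> ln (real ?a)" using a n by auto
        have b1: "\<bar>spl (T k \<omega>) - spl (T ?a \<omega>)\<bar> \<le> (1 + \<eta>) * phi ?a"
          using elim(1)[rule_format, of k] elim(2)[rule_format, of k] n k hp by (simp add: abs_le_iff)
        have "hh ?a - hh n \<le> \<kappa> * hh ?a"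
        proof -
          have "real n * (1 - \<kappa>) \<le> real ?a"
          proof -
            have "real n \<le> 1 / (1 - \<kappa>) * real ?a" 
              by (rule order_trans[OF rat]) (intro mult_right_mono, simp_all add: \<theta>'_def)
            then show ?thesis using \<kappa> by (simp add: field_simps)
          qed
          then have "(1 - \<kappa>) / real ?a \<le> 1 / real n" using a n by (simp add: field_simps)
          then have "(1 - \<kappa>) / real ?a * ln (real ?a) \<le> 1 / real n * ln (real n)"
            using lna \<kappa> by (intro mult_mono) auto
          moreover have "(1 - \<kappa>) / real ?a * ln (real ?a) = hh ?a - \<kappa> * hh ?a"
            by (simp add: hh_def left_diff_distrib diff_divide_distrib)
          ultimately show ?thesis by (simp add: hh_def)
        qed
        then have b2: "\<bar>spl (T n \<omega>) - spl (T ?a \<omega>)\<bar> \<le> \<eta> * phi ?a"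
          using elim(3)[rule_format, of n] elim(4)[rule_format, of n] n by (simp add: abs_le_iff)
        have pa: "phi ?a \<le> (1 + \<eta>) * phi n"
        proof -
          have l16: "ln (real ?a) \<ge> 1"
          proof -
            have "exp 1 \<le> real ?a" using exp_le a by linarith
            then show ?thesis using a by (subst ln_ge_iff) auto
          qed
          have ll: "0 \<le> ln (ln (real ?a))" "ln (ln (real ?a)) \<le> ln (ln (real n))" using l16 lna by auto
          have "hh ?a * ln (ln (real ?a)) \<le> ((1 + \<eta>)\<^sup>2 * hh n) * ln (ln (real n))"
          proof (intro mult_mono ll)
            have "real n \<le> (1 + \<eta>)\<^sup>2 * real ?a" 
              by (rule order_trans[OF rat]) (intro mult_right_mono, simp_all add: \<theta>'_def)
            then have "1 / real ?a \<le> (1 + \<eta>)\<^sup>2 / real n" using a n by (simp add: field_simps)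
            then have "1 / real ?a * ln (real ?a) \<le> (1 + \<eta>)\<^sup>2 / real n * ln (real n)"
              using lna by (intro mult_mono) auto
            then show "hh ?a \<le> (1 + \<eta>)\<^sup>2 * hh n" by (simp add: hh_def)
          qed (use hp in auto)
          then have "2 * lam * (hh ?a * ln (ln (real ?a))) \<le> 2 * lam * (((1 + \<eta>)\<^sup>2 * hh n) * ln (ln (real n)))"
            using lam_pos by (intro mult_left_mono) auto
          then have "phi ?a \<le> sqrt ((1 + \<eta>)\<^sup>2 * (2 * lam * hh n * ln (ln (real n))))"
            unfolding phi_def by (simp add: mult_ac)
          then show ?thesis using \<eta> by (simp add: real_sqrt_mult phi_def)
        qed
        have p0: "0 \<le> phi n" "0 \<le> phi ?a"
        proof -
          have "ln (real i) \<ge> 1" if "i \<ge> 16" for i :: nat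
          proof -
            have "exp 1 \<le> real i" using exp_le that by linarith
            then show ?thesis using that by (subst ln_ge_iff) auto
          qed
          then show "0 \<le> phi n" "0 \<le> phi ?a" unfolding phi_def using a n hp lam_pos by auto
        qed
        have "\<bar>spl (T k \<omega>) - spl (T n \<omega>)\<bar> \<le> (1 + 2 * \<eta>) * phi ?a" using b1 b2 by (simp add: algebra_simps abs_le_iff)
        also have "\<dots> \<le> (1 + 2 * \<eta>) * ((1 + \<eta>) * phi n)" using pa \<eta> by (intro mult_left_mono) auto
        also have "\<dots> = ((1 + 2 * \<eta>) * (1 + \<eta>)) * phi n" by simp
        also have "\<dots> \<le> (1 + \<delta>) * phi n"
        proof (intro mult_right_mono p0)
          have "\<eta> * \<eta> \<le> \<eta>" using \<eta> by (simp add: mult_left_le)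
          moreover have "(1 + 2 * \<eta>) * (1 + \<eta>) = 1 + 3 * \<eta> + 2 * (\<eta> * \<eta>)" by (simp add: algebra_simps)
          ultimately show "(1 + 2 * \<eta>) * (1 + \<eta>) \<le> 1 + \<delta>" using \<eta> by linarith
        qed
        finally show "\<bar>spl (T k \<omega>) - spl (T n \<omega>)\<bar> \<le> (1 + \<delta>) * phi n" .
      qed
    qed
    then obtain J where J: "\<And>j n k. j \<ge> J \<Longrightarrow> ?n j \<le> n \<Longrightarrow> n < ?n (Suc j) \<Longrightarrow> n \<le> k \<Longrightarrow> \<bar>spl (T k \<omega>) - spl (T n \<omega>)\<bar> \<le> (1 + \<delta>) * phi n"
      by (auto simp: eventually_sequentially)
    show ?case unfolding eventually_sequentially
    proof (intro exI[of _ "?n J"] allI impI)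
      fix n k assume n: "?n J \<le> n" "n \<le> k"
      obtain j where "j \<ge> J" "?n j \<le> n" "n < ?n (Suc j)" using geo_between[OF \<theta>(1) n(1)] .
      then show "\<bar>spl (T k \<omega>) - spl (T n \<omega>)\<bar> \<le> (1 + \<delta>) * phi n" using J n(2) by blast
    qed
  qed
qed

end

section \<open>The lower bound\<close>

context tree_params
begin

text \<open>
  One block of the martingale, started from the value \<open>b\<close>. Whenever the tree is not good, the
  increment is replaced by a symmetric sign of the prescribed variance and the tree is frozen;
  this makes the conditional variances nearly deterministic without changing good paths.
\<close>

primrec ker :: "real \<Rightarrow> (real \<Rightarrow> real) \<Rightarrow> nat \<Rightarrow> nat \<Rightarrow> rec_tree \<Rightarrow> real \<Rightarrow> real" where
  "ker \<epsilon> f 0 k t b = f b"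
| "ker \<epsilon> f (Suc r) k t b = (if reach t \<and> num_nodes t = k \<and> good \<epsilon> t
     then avg t (\<lambda>v. ker \<epsilon> f r (Suc k) (Attach t v) (b + yy t v))
     else (ker \<epsilon> f r (Suc k) t (b + sqrt (vk k)) + ker \<epsilon> f r (Suc k) t (b - sqrt (vk k))) / 2)"

lemma ker_mono: "(\<And>b. f b \<le> g b) \<Longrightarrow> ker \<epsilon> f r k t b \<le> ker \<epsilon> g r k t b"
proof (induction r arbitrary: k t b)
  case (Suc r)
  show ?case
  proof (cases "reach t \<and> num_nodes t = k \<and> good \<epsilon> t")
    case True
    then show ?thesis using Suc by (auto intro!: avg_mono)
  next
    case False
    have "ker \<epsilon> f r (Suc k) t b' \<le> ker \<epsilon> g r (Suc k) t b'" for b' using Suc by blast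
    from this[of "b + sqrt (vk k)"] this[of "b - sqrt (vk k)"] show ?thesis
      using False by (simp only: ker.simps if_False) (intro divide_right_mono add_mono, auto)
  qed
qed simp

lemma ker_const: "ker \<epsilon> (\<lambda>_. c) r k t b = c"
proof (induction r arbitrary: k t b)
  case (Suc r)
  then show ?case by (simp add: avg_const)
qed simp

lemma ker_diff: "ker \<epsilon> (\<lambda>b. f b - g b) r k t b = ker \<epsilon> f r k t b - ker \<epsilon> g r k t b"
proof (induction r arbitrary: k t b)
  case (Suc r)
  then show ?case by (simp add: avg_diff diff_divide_distrib add_divide_distrib)
qed simp

lemma ker_cmult: "ker \<epsilon> (\<lambda>b. c * f b) r k t b = c * ker \<epsilon> f r k t b"
proof (induction r arbitrary: k t b)
  case (Suc r)
  then show ?case by (simp add: avg_cmult field_simps)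
qed simp

text \<open>Both kinds of step have nearly the prescribed variance: good steps by
  \<open>avg_exp_bounds\<close>, signs because \<open>sqrt (vk k) \<le> ch * hh k\<close>. Hence the
  bounds are uniform in the starting tree, whether or not it fits the size \<open>k\<close>.\<close>

lemma ker_exp_bounds:
  assumes k: "k \<ge> K0" and s: "\<bar>s\<bar> * (ch * hh k) \<le> \<epsilon>" and e: "\<epsilon> \<le> 1"
  shows "ker \<epsilon> (\<lambda>b. exp (s * b)) r k t b \<le> exp (s * b + s\<^sup>2 / 2 * (1 + \<epsilon>)\<^sup>2 * (\<Sum>i=k..<k+r. vk i))
    \<and> exp (s * b + s\<^sup>2 / 2 * (1 - \<epsilon>) ^ 3 * (\<Sum>i=k..<k+r. vk i)) \<le> ker \<epsilon> (\<lambda>b. exp (s * b)) r k t b"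
  using k s
proof (induction r arbitrary: k t b)
  case (Suc r)
  let ?E = "\<lambda>b. exp (s * b)"
  define C D where "C = s\<^sup>2 / 2 * (1 + \<epsilon>)\<^sup>2" and "D = s\<^sup>2 / 2 * (1 - \<epsilon>) ^ 3"
  define W where "W = (\<Sum>i=Suc k..<Suc k+r. vk i)"
  have e0: "0 \<le> \<epsilon>" using Suc.prems hh_pos ch_pos by (smt (verit) mult_nonneg_nonneg)
  have split: "(\<Sum>i=k..<k+Suc r. vk i) = vk k + W"
    unfolding W_def by (simp add: sum.atLeast_Suc_lessThan)
  have vp: "vk k > 0" by (rule vk_pos[OF Suc.prems(1)])
  have "\<bar>s\<bar> * (ch * hh (Suc k)) \<le> \<bar>s\<bar> * (ch * hh k)"
    using hh_antimono[of k "Suc k"] Suc.prems ch_pos by (intro mult_left_mono) auto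
  then have s': "\<bar>s\<bar> * (ch * hh (Suc k)) \<le> \<epsilon>" using Suc.prems by linarith
  have IH: "ker \<epsilon> ?E r (Suc k) t' b' \<le> exp (C * W) * exp (s * b')"
    "exp (D * W) * exp (s * b') \<le> ker \<epsilon> ?E r (Suc k) t' b'" for t' b'
    using Suc.IH[OF _ s', of t' b'] Suc.prems by (simp_all add: C_def D_def W_def exp_add mult_ac)
  have "ker \<epsilon> ?E (Suc r) k t b \<le> exp (C * W) * (exp (s * b) * exp (C * vk k))
    \<and> exp (D * W) * (exp (s * b) * exp (D * vk k)) \<le> ker \<epsilon> ?E (Suc r) k t b"
  proof (cases "reach t \<and> num_nodes t = k \<and> good \<epsilon> t")
    case True
    then have t: "reach t" "num_nodes t = k" "good \<epsilon> t" by auto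
    note bb = avg_exp_bounds[OF t(1,3) _ _ e, of s, unfolded t(2), OF Suc.prems]
    have eq: "ker \<epsilon> ?E (Suc r) k t b = avg t (\<lambda>v. ker \<epsilon> ?E r (Suc k) (Attach t v) (b + yy t v))" using True by simp
    have a: "avg t (\<lambda>v. exp c * exp (s * (b + yy t v))) = exp c * (exp (s * b) * avg t (\<lambda>v. exp (s * yy t v)))" for c
      by (simp add: avg_cmult exp_add ring_distribs)
    have "ker \<epsilon> ?E (Suc r) k t b \<le> avg t (\<lambda>v. exp (C * W) * exp (s * (b + yy t v)))"
      unfolding eq by (intro avg_mono t IH)
    also have "\<dots> \<le> exp (C * W) * (exp (s * b) * exp (C * vk k))"
      unfolding a using bb(1) by (intro mult_left_mono) (auto simp: C_def)
    finally have 1: "ker \<epsilon> ?E (Suc r) k t b \<le> exp (C * W) * (exp (s * b) * exp (C * vk k))" .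
    have "exp (D * W) * (exp (s * b) * exp (D * vk k)) \<le> avg t (\<lambda>v. exp (D * W) * exp (s * (b + yy t v)))"
      unfolding a using bb(2) by (intro mult_left_mono) (auto simp: D_def)
    also have "\<dots> \<le> ker \<epsilon> ?E (Suc r) k t b"
      unfolding eq by (intro avg_mono t IH)
    finally show ?thesis using 1 by simp
  next
    case False
    let ?h = "sqrt (vk k)"
    have h2: "(s * ?h)\<^sup>2 = s\<^sup>2 * vk k" using vp by (simp add: power_mult_distrib)
    then have h2': "(- (s * ?h))\<^sup>2 = s\<^sup>2 * vk k" by simp
    have sm: "\<bar>s * ?h\<bar> \<le> \<epsilon>"
    proof -
      have "\<bar>s * ?h\<bar> \<le> \<bar>s\<bar> * (ch * hh k)"
        unfolding abs_mult using K0(3)[OF Suc.prems(1)] vp by (intro mult_left_mono) auto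
      then show ?thesis using Suc.prems by linarith
    qed
    then have sm': "\<bar>- (s * ?h)\<bar> \<le> \<epsilon>" by simp
    let ?c = "(exp (s * ?h) + exp (- (s * ?h))) / 2"
    have eq: "ker \<epsilon> ?E (Suc r) k t b = (ker \<epsilon> ?E r (Suc k) t (b + ?h) + ker \<epsilon> ?E r (Suc k) t (b - ?h)) / 2"
      using False by auto
    have a: "(exp c * exp (s * (b + ?h)) + exp c * exp (s * (b - ?h))) / 2 = exp c * (exp (s * b) * ?c)" for c
      by (simp add: exp_add[symmetric] exp_diff ring_distribs)
    \<comment> \<open>Averaging over the two signs cancels the linear term and leaves
      \<open>1 + z\<close>, up to a factor \<open>1 + \<epsilon>\<close> or
      \<open>1 - \<epsilon>\<close> on \<open>z\<close>.\<close>
    define z where "z = s\<^sup>2 * vk k / 2"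
    have avg_up: "a \<le> 1 + w + q \<Longrightarrow> b \<le> 1 + - w + q \<Longrightarrow> (a + b) / 2 \<le> 1 + q" for a b w q :: real
      by simp
    have avg_lo: "1 + w + q \<le> a \<Longrightarrow> 1 + - w + q \<le> b \<Longrightarrow> 1 + q \<le> (a + b) / 2" for a b w q :: real
      by simp
    have z0: "0 \<le> z" using vp by (simp add: z_def)
    have "(s * ?h)\<^sup>2 \<le> \<epsilon>\<^sup>2" using sm e0 by (intro power2_le_iff_abs_le[THEN iffD2]) auto
    then have "s\<^sup>2 * vk k \<le> \<epsilon>\<^sup>2" unfolding h2 .
    moreover have "\<epsilon>\<^sup>2 \<le> \<epsilon>" using e e0 mult_left_mono[of \<epsilon> 1 \<epsilon>] by (simp add: power2_eq_square)
    ultimately have "s\<^sup>2 * vk k \<le> \<epsilon>" by linarith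
    then have z1: "z * (1 - \<epsilon>) \<le> \<epsilon>" using z0 e0 mult_left_mono[of "1 - \<epsilon>" 1 z] by (simp add: z_def)
    have "?c \<le> 1 + z * (1 + \<epsilon>)"
      using avg_up[OF exp_quadratic_bounds(1)[OF sm e, unfolded h2] exp_quadratic_bounds(1)[OF sm' e, unfolded h2']] unfolding z_def .
    also have "\<dots> \<le> exp (z * (1 + \<epsilon>))" by (rule exp_ge_add_one_self)
    also have "\<dots> \<le> exp (C * vk k)"
    proof -
      have "z * (1 + \<epsilon>) \<le> z * (1 + \<epsilon>)\<^sup>2" using z0 e0 by (intro mult_left_mono) (auto simp: power2_eq_square algebra_simps)
      then show ?thesis by (simp add: z_def C_def mult_ac)
    qed
    finally have c1: "?c \<le> exp (C * vk k)" .
    have "exp (D * vk k) \<le> exp ((z * (1 - \<epsilon>)) * (1 - \<epsilon>))"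
    proof -
      have "(1 - \<epsilon>) ^ 3 \<le> (1 - \<epsilon>)\<^sup>2" using e e0 by (intro power_decreasing) auto
      then have "z * (1 - \<epsilon>) ^ 3 \<le> z * (1 - \<epsilon>)\<^sup>2" using z0 by (rule mult_left_mono)
      then show ?thesis by (simp add: z_def D_def power2_eq_square mult_ac)
    qed
    also have "\<dots> \<le> 1 + z * (1 - \<epsilon>)" using z0 z1 e by (intro exp_le_one_plus) auto
    also have "\<dots> \<le> ?c"
      using avg_lo[OF exp_quadratic_bounds(2)[OF sm e, unfolded h2] exp_quadratic_bounds(2)[OF sm' e, unfolded h2']] unfolding z_def .
    finally have c2: "exp (D * vk k) \<le> ?c" .
    have "ker \<epsilon> ?E (Suc r) k t b \<le> exp (C * W) * (exp (s * b) * ?c)"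
      unfolding eq a[symmetric] by (intro divide_right_mono add_mono IH) auto
    also have "\<dots> \<le> exp (C * W) * (exp (s * b) * exp (C * vk k))" using c1 by (intro mult_left_mono) auto
    finally have 1: "ker \<epsilon> ?E (Suc r) k t b \<le> exp (C * W) * (exp (s * b) * exp (C * vk k))" .
    have "exp (D * W) * (exp (s * b) * exp (D * vk k)) \<le> exp (D * W) * (exp (s * b) * ?c)"
      using c2 by (intro mult_left_mono) auto
    also have "\<dots> \<le> ker \<epsilon> ?E (Suc r) k t b"
      unfolding eq a[symmetric] by (intro divide_right_mono add_mono IH) auto
    finally show ?thesis using 1 by simp
  qed
  moreover have "exp (C * W) * (exp (s * b) * exp (C * vk k)) = exp (s * b + C * (vk k + W))"
    "exp (D * W) * (exp (s * b) * exp (D * vk k)) = exp (s * b + D * (vk k + W))"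
    by (simp_all add: exp_add[symmetric] algebra_simps)
  ultimately show ?case unfolding split C_def[symmetric] D_def[symmetric] by simp
qed simp

text \<open>Kolmogorov's lower exponential bound: the tilted mass concentrates near \<open>x\<close>.\<close>

lemma tilting_indicator:
  assumes s: "0 \<le> s" and h: "0 \<le> \<eta>" and x: "0 \<le> (x::real)"
  shows "exp (- (s * (1 + \<eta>) * x)) * exp (s * c)
     - exp (- (s * (1 + \<eta>) * x) - \<eta> * s * ((1 + \<eta>) * x)) * exp ((1 + \<eta>) * s * c)
     - exp (- (s * (1 + \<eta>) * x) + \<eta> * s * ((1 - \<eta>) * x)) * exp ((1 - \<eta>) * s * c)
    \<le> (if c > (1 - \<eta>) * x then 1 else 0)"
proof -
  let ?a = "exp (- (s * (1 + \<eta>) * x) + s * c)"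
  let ?p = "exp (- (s * (1 + \<eta>) * x) - \<eta> * s * ((1 + \<eta>) * x)) * exp ((1 + \<eta>) * s * c)"
  let ?m = "exp (- (s * (1 + \<eta>) * x) + \<eta> * s * ((1 - \<eta>) * x)) * exp ((1 - \<eta>) * s * c)"
  have p: "?p = ?a * exp (\<eta> * s * (c - (1 + \<eta>) * x))"
    by (simp add: exp_add[symmetric]) (simp add: algebra_simps)
  have m: "?m = ?a * exp (\<eta> * s * ((1 - \<eta>) * x - c))"
    by (simp add: exp_add[symmetric]) (simp add: algebra_simps)
  have pos: "0 \<le> ?p" "0 \<le> ?m" by simp_all
  have a: "exp (- (s * (1 + \<eta>) * x)) * exp (s * c) = ?a" by (rule mult_exp_exp)
  define u w z where "u = ?a" and "w = ?p" and "z = ?m"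
  note abb = u_def[symmetric] w_def[symmetric] z_def[symmetric]
  \<comment> \<open>Below the window around \<open>x\<close> the smaller tilt
    \<open>(1 - \<eta>) * s\<close> outweighs the main term, above it the larger tilt
    \<open>(1 + \<eta>) * s\<close> does, and inside it the main term is at most 1.\<close>
  consider "c \<le> (1 - \<eta>) * x" | "(1 - \<eta>) * x < c" "c \<le> (1 + \<eta>) * x" | "(1 - \<eta>) * x < c" "(1 + \<eta>) * x < c" by linarith
  then show ?thesis
  proof cases
    case 1
    then have "1 \<le> exp (\<eta> * s * ((1 - \<eta>) * x - c))" using s h by simp
    then have "?a * 1 \<le> ?m" unfolding m by (intro mult_left_mono) auto
    then show ?thesis using pos 1 unfolding a abb by simp
  next
    case 2
    have "s * c \<le> s * ((1 + \<eta>) * x)" using 2 s by (intro mult_left_mono) auto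
    then have "?a \<le> 1" by (simp add: mult_ac)
    then show ?thesis using pos 2 unfolding a abb by simp
  next
    case 3
    then have "1 \<le> exp (\<eta> * s * (c - (1 + \<eta>) * x))" using s h by simp
    then have "?a * 1 \<le> ?p" unfolding p by (intro mult_left_mono) auto
    then show ?thesis using pos 3 unfolding a abb by simp
  qed
qed

text \<open>The tilt \<open>x / v\<close> shifts the mean of the block to about \<open>x\<close>,
  and subtracting the two neighbouring tilts removes the mass outside a window around
  \<open>x\<close>. With \<open>A = x^2 / v\<close>, each neighbour is smaller than the main term by
  about \<open>exp (- \<eta>^2 * A / 2)\<close>. The bound
  \<open>\<epsilon> \<le> \<eta>^2 / 48\<close> keeps the errors below this gain, and
  \<open>9 \<le> A * \<eta>^2\<close> makes each neighbour at most a quarter of the main term, so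
  half of it remains.\<close>

lemma ker_lower_tail:
  assumes n: "n \<ge> K0" and r: "r > 0" and g: "\<bar>g\<bar> = (1::real)"
    and eta: "0 < \<eta>" "\<eta> \<le> 1/2" and e: "0 < \<epsilon>" "\<epsilon> \<le> \<eta>\<^sup>2 / 48"
    and v: "v = (\<Sum>i=n..<n+r. vk i)" and x: "0 < x"
    and s: "(1 + \<eta>) * (x / v) * (ch * hh n) \<le> \<epsilon>"
    and A: "9 \<le> x\<^sup>2 / v * \<eta>\<^sup>2"
  shows "1/2 * exp (- (x\<^sup>2 / v / 2 * (1 + 4 * \<eta>))) \<le> ker \<epsilon> (\<lambda>b. if g * b > (1 - \<eta>) * x then 1 else 0) r n t 0"
proof -
  have "0 < (\<Sum>i=n..<n+r. vk i)" using n r by (intro sum_pos) (auto intro!: vk_pos)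
  then have v0: "0 < v" by (simp add: v)
  define s where "s = x / v"
  define A where "A = x\<^sup>2 / v"
  have s0: "0 < s" using x v0 by (simp add: s_def)
  have sx: "s * x = A" "s\<^sup>2 * v = A" using v0 by (simp_all add: s_def A_def power2_eq_square)
  have A0: "0 < A" using x v0 by (simp add: A_def)
  have "\<eta>\<^sup>2 \<le> (1/2)\<^sup>2" using eta by (intro power_mono) auto
  then have eta2: "\<eta>\<^sup>2 \<le> 1/4" by (simp add: power2_eq_square)
  have e1: "\<epsilon> \<le> 1" using e eta2 by simp
  have gs: "\<bar>g * s * c\<bar> * (ch * hh n) \<le> \<epsilon>" if "0 \<le> c" "c \<le> 1 + \<eta>" for c
  proof -
    have "\<bar>g * s * c\<bar> = c * s" using g s0 that by (simp add: abs_mult)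
    also have "c * s * (ch * hh n) \<le> (1 + \<eta>) * s * (ch * hh n)"
      using that s0 hh_pos[OF n] ch_pos by (intro mult_right_mono) auto
    finally show ?thesis using assms(10) by (simp add: s_def)
  qed
  have kb: "ker \<epsilon> (\<lambda>b. exp (g * s * c * b)) r n t 0 \<le> exp (c\<^sup>2 * A / 2 * (1 + \<epsilon>)\<^sup>2)"
    "exp (c\<^sup>2 * A / 2 * (1 - \<epsilon>) ^ 3) \<le> ker \<epsilon> (\<lambda>b. exp (g * s * c * b)) r n t 0" if "0 \<le> c" "c \<le> 1 + \<eta>" for c
  proof -
    have g2: "g\<^sup>2 = 1" using g by (simp add: power2_eq_1_iff abs_if split: if_splits)
    have gw: "(g * s * c)\<^sup>2 / 2 * w * (\<Sum>i=n..<n+r. vk i) = c\<^sup>2 * A / 2 * w" for w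
      unfolding v[symmetric] sx(2)[symmetric] by (simp add: power_mult_distrib g2)
    show "ker \<epsilon> (\<lambda>b. exp (g * s * c * b)) r n t 0 \<le> exp (c\<^sup>2 * A / 2 * (1 + \<epsilon>)\<^sup>2)"
      "exp (c\<^sup>2 * A / 2 * (1 - \<epsilon>) ^ 3) \<le> ker \<epsilon> (\<lambda>b. exp (g * s * c * b)) r n t 0"
      using ker_exp_bounds[OF n gs[OF that] e1, of r t 0, unfolded gw] by simp_all
  qed
  let ?k = "\<lambda>f. ker \<epsilon> f r n t 0"
  define P where "P = A * (1 + \<eta>)"
  define f where "f b = exp (- P) * exp (g * s * 1 * b)
     - exp (- P - \<eta> * (A * (1 + \<eta>))) * exp (g * s * (1 + \<eta>) * b)
     - exp (- P + \<eta> * (A * (1 - \<eta>))) * exp (g * s * (1 - \<eta>) * b)" for b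
  have "f b \<le> (if g * b > (1 - \<eta>) * x then 1 else 0)" for b
  proof -
    have E: "s * (1 + \<eta>) * x = P" "\<eta> * s * ((1 + \<eta>) * x) = \<eta> * (A * (1 + \<eta>))" "\<eta> * s * ((1 - \<eta>) * x) = \<eta> * (A * (1 - \<eta>))"
      "s * (g * b) = g * s * 1 * b" "(1 + \<eta>) * s * (g * b) = g * s * (1 + \<eta>) * b" "(1 - \<eta>) * s * (g * b) = g * s * (1 - \<eta>) * b"
      unfolding P_def sx(1)[symmetric] by simp_all
    have "0 \<le> s" "0 \<le> \<eta>" "0 \<le> x" using s0 eta x by simp_all
    from tilting_indicator[OF this, of "g * b", unfolded E]
    show ?thesis unfolding f_def .
  qed
  then have c1: "?k f \<le> ?k (\<lambda>b. if g * b > (1 - \<eta>) * x then 1 else 0)" by (rule ker_mono)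
  have c2: "?k f = exp (- P) * ?k (\<lambda>b. exp (g * s * 1 * b))
     - exp (- P - \<eta> * (A * (1 + \<eta>))) * ?k (\<lambda>b. exp (g * s * (1 + \<eta>) * b))
     - exp (- P + \<eta> * (A * (1 - \<eta>))) * ?k (\<lambda>b. exp (g * s * (1 - \<eta>) * b))"
    unfolding f_def[abs_def] ker_diff ker_cmult ..
  have c3: "\<dots> \<ge> exp (- P) * exp (A / 2 * (1 - \<epsilon>) ^ 3)
     - exp (- P - \<eta> * (A * (1 + \<eta>))) * exp ((1 + \<eta>)\<^sup>2 * A / 2 * (1 + \<epsilon>)\<^sup>2)
     - exp (- P + \<eta> * (A * (1 - \<eta>))) * exp ((1 - \<eta>)\<^sup>2 * A / 2 * (1 + \<epsilon>)\<^sup>2)"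
    using kb(2)[of 1] kb(1)[of "1 + \<eta>"] kb(1)[of "1 - \<eta>"] eta
    by (intro diff_mono mult_left_mono) auto
  have c4: "exp (- P) * exp (A / 2 * (1 - \<epsilon>) ^ 3) \<ge> exp (- P + A * (1/2 - \<eta>\<^sup>2 / 32))"
  proof -
    have "1 - 3 * \<epsilon> \<le> (1 - \<epsilon>) ^ 3"
      using Bernoulli_inequality[of "- \<epsilon>" 3] e1 by simp
    then have "1/2 - \<eta>\<^sup>2 / 32 \<le> (1 - \<epsilon>) ^ 3 / 2" using e by simp
    then have "A * (1/2 - \<eta>\<^sup>2 / 32) \<le> A * ((1 - \<epsilon>) ^ 3 / 2)" using A0 by (intro mult_left_mono) auto
    then show ?thesis by (simp add: exp_add[symmetric])
  qed
  have e2: "(1 + \<epsilon>)\<^sup>2 \<le> 1 + \<eta>\<^sup>2 / 16"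
  proof -
    have "\<epsilon> * \<epsilon> \<le> \<epsilon> * 1" using e e1 by (intro mult_left_mono) auto
    moreover have "(1 + \<epsilon>)\<^sup>2 = 1 + 2 * \<epsilon> + \<epsilon> * \<epsilon>" by (simp add: power2_eq_square algebra_simps)
    ultimately show ?thesis using e by linarith
  qed
  \<comment> \<open>For the tilts \<open>w = 1 + \<eta>\<close> and \<open>w = 1 - \<eta>\<close>
    the prefactor and the moment bound combine to a completed square with deficit
    \<open>A * \<eta>\<^sup>2 / 2\<close>. The error from \<open>(1 + \<epsilon>)\<^sup>2\<close>
    uses up at most a quarter of it.\<close>
  have small: "exp (- P + u) * exp (w\<^sup>2 * A / 2 * (1 + \<epsilon>)\<^sup>2) \<le> exp (- P + A * (1/2 - 3/8 * \<eta>\<^sup>2))"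
    if u: "u + w\<^sup>2 * A / 2 = A * (1/2 - \<eta>\<^sup>2 / 2)" and w: "w\<^sup>2 \<le> 4" for u w
  proof -
    have "w\<^sup>2 * A / 2 * (1 + \<epsilon>)\<^sup>2 \<le> w\<^sup>2 * A / 2 * (1 + \<eta>\<^sup>2 / 16)"
      using e2 A0 by (intro mult_left_mono) auto
    also have "\<dots> = w\<^sup>2 * A / 2 + w\<^sup>2 * (A * \<eta>\<^sup>2 / 32)" by (simp add: field_simps)
    also have "\<dots> \<le> w\<^sup>2 * A / 2 + 4 * (A * \<eta>\<^sup>2 / 32)"
      using w A0 by (intro add_left_mono mult_right_mono) auto
    finally have "u + w\<^sup>2 * A / 2 * (1 + \<epsilon>)\<^sup>2 \<le> A * (1/2 - 3/8 * \<eta>\<^sup>2)" using u by (simp add: field_simps)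
    then show ?thesis by (simp add: exp_add[symmetric])
  qed
  have "(1 + \<eta>)\<^sup>2 \<le> 2\<^sup>2" by (rule power_mono) (use eta in auto)
  moreover have "(1 - \<eta>)\<^sup>2 \<le> 1\<^sup>2" by (rule power_mono) (use eta in auto)
  ultimately have w: "(1 + \<eta>)\<^sup>2 \<le> 4" "(1 - \<eta>)\<^sup>2 \<le> 4" by simp_all
  have p1: "exp (- P - \<eta> * (A * (1 + \<eta>))) * exp ((1 + \<eta>)\<^sup>2 * A / 2 * (1 + \<epsilon>)\<^sup>2) \<le> exp (- P + A * (1/2 - 3/8 * \<eta>\<^sup>2))"
    using small[of "- (\<eta> * (A * (1 + \<eta>)))" "1 + \<eta>"] w by (simp add: power2_eq_square field_simps)
  have p2: "exp (- P + \<eta> * (A * (1 - \<eta>))) * exp ((1 - \<eta>)\<^sup>2 * A / 2 * (1 + \<epsilon>)\<^sup>2) \<le> exp (- P + A * (1/2 - 3/8 * \<eta>\<^sup>2))"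
    using small[of "\<eta> * (A * (1 - \<eta>))" "1 - \<eta>"] w by (simp add: power2_eq_square field_simps)
  \<comment> \<open>The exponents differ by \<open>11/32 * A * \<eta>^2\<close>, which is at least
    3, and \<open>exp 3 \<ge> 1 + 3\<close>.\<close>
  have p3: "exp (- P + A * (1/2 - 3/8 * \<eta>\<^sup>2)) \<le> 1/4 * exp (- P + A * (1/2 - \<eta>\<^sup>2 / 32))"
  proof -
    have l4: "9 \<le> A * \<eta>\<^sup>2" using assms(11) by (simp add: A_def)
    have eq: "- P + A * (1/2 - 3/8 * \<eta>\<^sup>2) = (- P + A * (1/2 - \<eta>\<^sup>2 / 32)) + - (11/32 * (A * \<eta>\<^sup>2))" by (simp add: field_simps)
    have "exp (- (11/32 * (A * \<eta>\<^sup>2))) \<le> 1/4"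
    proof -
      have "4 \<le> 1 + 11/32 * (A * \<eta>\<^sup>2)" using l4 by simp
      also have "\<dots> \<le> exp (11/32 * (A * \<eta>\<^sup>2))" by (rule exp_ge_add_one_self)
      finally show ?thesis by (simp add: exp_minus field_simps)
    qed
    then have "exp (- P + A * (1/2 - \<eta>\<^sup>2 / 32)) * exp (- (11/32 * (A * \<eta>\<^sup>2))) \<le> exp (- P + A * (1/2 - \<eta>\<^sup>2 / 32)) * (1/4)"
      by (intro mult_left_mono) auto
    then show ?thesis unfolding eq exp_add[of _ "- (11/32 * (A * \<eta>\<^sup>2))"] by (simp only: mult.commute)
  qed
  have p4: "1/2 * exp (- (A / 2 * (1 + 4 * \<eta>))) \<le> 1/2 * exp (- P + A * (1/2 - \<eta>\<^sup>2 / 32))"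
  proof -
    have "\<eta>\<^sup>2 \<le> \<eta>" using eta by (simp add: power2_eq_square mult_left_le)
    then have "A * (\<eta>\<^sup>2 / 32) \<le> A * \<eta>" using A0 eta by (intro mult_left_mono) auto
    then show ?thesis by (simp add: P_def algebra_simps)
  qed
  show ?thesis unfolding A_def[symmetric]
    using c1 c2 c3 c4 p1 p2 p3 p4 by linarith
qed

lemma ker_nonneg: "(\<And>b. 0 \<le> f b) \<Longrightarrow> 0 \<le> ker \<epsilon> f r k t b"
  using ker_mono[of "\<lambda>_. 0" f \<epsilon> r k t b] by (simp add: ker_const)

text \<open>The blocks \<open>{B ^ j..B ^ Suc j}\<close> carry almost all of the tail variance at \<open>B ^ j\<close> when \<open>B\<close> is large.\<close>

lemma ker_block:
  fixes B :: nat
  assumes B: "B > 2" and g: "\<bar>g\<bar> = (1::real)" and eta: "0 < \<eta>" "\<eta> \<le> 1/2" and e: "0 < \<epsilon>" "\<epsilon> \<le> \<eta>\<^sup>2 / 48"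
  defines "\<tau> \<equiv> (1 - \<eta>) * sqrt ((1 - \<eta>) / (1 + 4 * \<eta>) * (1 - 2 / real B))"
  shows "\<forall>\<^sub>F j in sequentially. \<forall>t.
    ker \<epsilon> (\<lambda>b. if g * b \<le> \<tau> * phi (B ^ j) then 1 else 0) (B ^ Suc j - B ^ j) (B ^ j) t 0
      \<le> 1 - 1/2 * (real j * ln (real B)) powr - (1 - \<eta>)"
proof -
  have lB: "ln (real B) > 0" using B by simp
  have B1: "0 < 1 - 2 / real B" "real B > 0" using B by (simp_all add: field_simps)
  have pow: "filterlim (\<lambda>j. B ^ j) at_top sequentially"
  proof (rule filterlim_at_top_mono[OF filterlim_ident])
    show "\<forall>\<^sub>F j in sequentially. j \<le> B ^ j"
      using B by (intro always_eventually allI less_imp_le power_gt_expt) auto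
  qed
  \<comment> \<open>Makes the exponent of the lower tail equal to \<open>1 - \<eta>\<close> times
    the iterated logarithm: the block probabilities are then of order
    \<open>j powr - (1 - \<eta>)\<close>, which is not summable.\<close>
  define c where "c = (1 - \<eta>) / (1 + 4 * \<eta>)"
  have c: "0 < c" "c \<le> 1" "c * (1 + 4 * \<eta>) = 1 - \<eta>" using eta by (auto simp: c_def)
  let ?K = "(1 + \<eta>) * ch / (lam * (1 - 2 / real B))"
  have "(\<lambda>j. ?K * phi (B ^ j)) \<longlonglongrightarrow> ?K * 0"
    by (intro tendsto_intros filterlim_compose[OF phi_tendsto_0 pow])
  then have "\<forall>\<^sub>F j in sequentially. ?K * phi (B ^ j) < \<epsilon>" using e by (intro order_tendstoD) auto
  moreover have "\<forall>\<^sub>F j in sequentially. B ^ j \<ge> K0" using pow unfolding filterlim_at_top by blast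
  moreover have "\<forall>\<^sub>F j in sequentially. 9 \<le> 2 * c * ln (real j * ln (real B)) * \<eta>\<^sup>2"
    using c lB eta by real_asymp
  moreover have "\<forall>\<^sub>F j in sequentially. 0 < ln (real j * ln (real B))"
    using lB by real_asymp
  ultimately show ?thesis using eventually_gt_at_top[of 0]
  proof eventually_elim
    case (elim j)
    let ?n = "B ^ j" and ?r = "B ^ Suc j - B ^ j" and ?L = "ln (real j * ln (real B))"
    have r: "?r > 0" using B by simp
    have nr: "?n + ?r = B ^ Suc j" using B by simp
    have L: "ln (ln (real ?n)) = ?L" by (simp add: ln_realpow B1)
    have hp: "hh ?n > 0" by (rule hh_pos[OF elim(2)])
    define v where "v = (\<Sum>i=?n..<?n+?r. vk i)"
    have v: "v = lam * (hh ?n - hh (B ^ Suc j))" unfolding v_def nr using B by (subst sum_vk) auto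
    \<comment> \<open>From \<open>j + 1 \<le> 2 * j\<close>: at most the fraction
      \<open>2 / B\<close> of the tail variance lies beyond the block.\<close>
    have "hh (B ^ Suc j) \<le> 2 / real B * hh ?n"
    proof -
      have "hh (B ^ Suc j) = (real j + 1) * ln (real B) / (real B * real B ^ j)"
        by (simp add: hh_def ln_mult ln_realpow B1 algebra_simps)
      also have "\<dots> \<le> (2 * real j) * ln (real B) / (real B * real B ^ j)"
        using elim(5) lB by (intro divide_right_mono mult_right_mono) auto
      also have "\<dots> = 2 / real B * hh ?n" by (simp add: hh_def ln_realpow B1)
      finally show ?thesis .
    qed
    then have vl: "lam * ((1 - 2 / real B) * hh ?n) \<le> v"
      unfolding v using lam_pos by (intro mult_left_mono) (auto simp: algebra_simps)
    have "K0 \<le> B ^ Suc j" using elim(2) r by linarith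
    then have "0 \<le> hh (B ^ Suc j)" using hh_pos less_imp_le by blast
    then have vu: "v \<le> lam * hh ?n" unfolding v using lam_pos by simp
    have w0: "0 < lam * ((1 - 2 / real B) * hh ?n)" using lam_pos B1 hp by (intro mult_pos_pos)
    then have v0: "0 < v" using vl by linarith
    \<comment> \<open>Scaled by the block variance \<open>v\<close>, so that
      \<open>x\<^sup>2 / v\<close> is exact; the comparison with \<open>phi\<close> rests on the two
      bounds for \<open>v\<close>.\<close>
    define x where "x = sqrt (2 * v * ?L * c)"
    have x0: "0 < x" using v0 elim(4) c by (simp add: x_def)
    have x2: "x\<^sup>2 / v = 2 * c * ?L" using v0 elim(4) c by (simp add: x_def)
    have xphi: "x \<le> phi ?n"
    proof -
      have "2 * v * ?L * c \<le> 2 * (lam * hh ?n) * ?L * 1"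
        using vu v0 elim(4) c lam_pos hp by (intro mult_mono) auto
      then show ?thesis unfolding x_def phi_def L by (simp add: mult_ac)
    qed
    have s: "(1 + \<eta>) * (x / v) * (ch * hh ?n) \<le> \<epsilon>"
    proof -
      have "x / v \<le> phi ?n / (lam * ((1 - 2 / real B) * hh ?n))"
        using x0 xphi vl w0 by (intro frac_le) auto
      then have "(1 + \<eta>) * (x / v) * (ch * hh ?n) \<le> (1 + \<eta>) * (phi ?n / (lam * ((1 - 2 / real B) * hh ?n))) * (ch * hh ?n)"
        using eta ch_pos hp by (intro mult_right_mono mult_left_mono) auto
      also have "\<dots> = ?K * phi ?n" using hp by simp
      finally show ?thesis using elim(1) by simp
    qed
    show ?case
    proof
      fix t
      let ?k = "\<lambda>f. ker \<epsilon> f ?r ?n t 0"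
      have "1/2 * exp (- (x\<^sup>2 / v / 2 * (1 + 4 * \<eta>))) \<le> ?k (\<lambda>b. if g * b > (1 - \<eta>) * x then 1 else 0)"
        using elim(3) by (intro ker_lower_tail elim(2) r g eta e v_def x0 s) (simp add: x2)
      moreover have "x\<^sup>2 / v / 2 * (1 + 4 * \<eta>) = (1 - \<eta>) * ?L"
        unfolding x2 c(3)[symmetric] by simp
      moreover have "exp (- ((1 - \<eta>) * ?L)) = (real j * ln (real B)) powr - (1 - \<eta>)"
        using elim(5) lB by (simp add: powr_def algebra_simps)
      moreover have "?k (\<lambda>b. if g * b \<le> \<tau> * phi ?n then 1 else 0) \<le> ?k (\<lambda>b. 1 - (if g * b > (1 - \<eta>) * x then 1 else 0))"
      proof (rule ker_mono)
        have "\<tau> * phi ?n \<le> (1 - \<eta>) * x"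
        proof -
          have "(c * (1 - 2 / real B)) * (2 * lam * hh ?n * ?L) = 2 * (lam * ((1 - 2 / real B) * hh ?n)) * ?L * c" by simp
          also have "\<dots> \<le> 2 * v * ?L * c" using vl elim(4) c by (intro mult_right_mono mult_left_mono) auto
          finally have "sqrt ((c * (1 - 2 / real B)) * (2 * lam * hh ?n * ?L)) \<le> x" by (simp add: x_def)
          then have "sqrt (c * (1 - 2 / real B)) * phi ?n \<le> x" unfolding phi_def L by (simp add: real_sqrt_mult)
          then show ?thesis unfolding \<tau>_def c_def[symmetric] mult.assoc using eta by (intro mult_left_mono) auto
        qed
        then show "(if g * b \<le> \<tau> * phi ?n then 1 else 0) \<le> 1 - (if g * b > (1 - \<eta>) * x then 1 else 0 :: real)" for b
          by auto
      qed
      moreover have "?k (\<lambda>b. 1 - (if g * b > (1 - \<eta>) * x then 1 else 0)) = 1 - ?k (\<lambda>b. if g * b > (1 - \<eta>) * x then 1 else 0)"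
        by (simp only: ker_diff ker_const)
      ultimately show "?k (\<lambda>b. if g * b \<le> \<tau> * phi ?n then 1 else 0) \<le> 1 - 1/2 * (real j * ln (real B)) powr - (1 - \<eta>)"
        by simp
    qed
  qed
qed

end

section \<open>Combining the blocks\<close>

context tree_run
begin

text \<open>The bound on \<open>ker\<close> holds for every starting tree, so it bounds a
  conditional probability given the past and the blocks multiply without independence. Inside a
  block, \<open>U\<close> evaluates \<open>ker\<close> with the remaining steps at the current tree;
  at a good tree \<open>ker\<close> makes the true step, which gives the supermartingale
  inequality.\<close>

lemma prob_no_large_block:
  fixes B :: nat and y p :: "nat \<Rightarrow> real"
  assumes B: "B > 2" and J: "J \<ge> 1" "K \<ge> J"
    and p: "\<And>j t. j \<ge> J \<Longrightarrow> ker \<epsilon> (\<lambda>b. if g * b \<le> y j then 1 else 0) (B ^ Suc j - B ^ j) (B ^ j) t 0 \<le> 1 - p j"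
    and p1: "\<And>j. j \<ge> J \<Longrightarrow> p j \<le> 1"
  defines "cond \<equiv> \<lambda>t. \<forall>j\<ge>J. num_nodes t = B ^ Suc j \<longrightarrow> g * tsum (B ^ j) (good \<epsilon>) yy t \<le> y j"
  defines "Q \<equiv> \<lambda>t. cond t \<and> (B ^ J \<le> num_nodes t \<longrightarrow> good \<epsilon> t)"
  shows "expT (B ^ K) (\<lambda>t. if past Q t \<and> cond t then 1 else 0 :: real) \<le> (\<Prod>j=J..<K. 1 - p j)"
  using J(2)
proof (induction K rule: dec_induct)
  case base
  have B1: "B ^ J \<ge> 1" using B by simp
  have "expT (B ^ J) (\<lambda>t. if past Q t \<and> cond t then 1 else 0 :: real) \<le> expT (B ^ J) (\<lambda>_. 1)"
    by (intro expT_mono B1) auto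
  then show ?case by (simp only: expT_const[OF B1]) simp
next
  case (step K)
  let ?n = "B ^ K"
  define N where "N = B ^ Suc K"
  have n1: "?n \<ge> 1" "N \<ge> 1" using B by (simp_all add: N_def)
  have nN: "?n < N" using B by (simp add: N_def)
  have nJ: "B ^ J \<le> ?n" using B step by (intro power_increasing) auto
  let ?f = "\<lambda>b. if g * b \<le> y K then 1 else 0 :: real"
  let ?ind = "\<lambda>t. if past Q t \<and> cond t then 1 else 0 :: real"
  define U where "U t = (if past Q t \<and> cond t
      then ker \<epsilon> ?f (N - num_nodes t) (num_nodes t) t (tsum ?n (good \<epsilon>) yy t) else 0)" for t
  have kn: "0 \<le> ker \<epsilon> ?f r k t b" for r k t b by (rule ker_nonneg) auto
  have U0: "0 \<le> U t" for t using kn by (simp add: U_def)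
  have sup: "avg t (\<lambda>v. U (Attach t v)) \<le> U t" if t: "reach t" "?n \<le> num_nodes t" "num_nodes t < N" for t
  proof (cases "past Q t \<and> Q t")
    case False
    then have "U (Attach t v) = 0" for v by (auto simp: U_def)
    then show ?thesis using U0 by (simp add: avg_const[OF t(1)])
  next
    case True
    let ?k = "num_nodes t"
    have gd: "good \<epsilon> t" "cond t" using True t nJ by (auto simp: Q_def)
    have r: "N - ?k = Suc (N - Suc ?k)" using t by simp
    have "avg t (\<lambda>v. U (Attach t v)) \<le> avg t (\<lambda>v. ker \<epsilon> ?f (N - Suc ?k) (Suc ?k) (Attach t v) (tsum ?n (good \<epsilon>) yy t + yy t v))"
    proof (intro avg_mono t)
      fix v
      have "U (Attach t v) \<le> ker \<epsilon> ?f (N - num_nodes (Attach t v)) (num_nodes (Attach t v)) (Attach t v) (tsum ?n (good \<epsilon>) yy (Attach t v))"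
        unfolding U_def using kn by simp
      then show "U (Attach t v) \<le> ker \<epsilon> ?f (N - Suc ?k) (Suc ?k) (Attach t v) (tsum ?n (good \<epsilon>) yy t + yy t v)"
        using t gd by simp
    qed
    also have "\<dots> = U t" unfolding U_def r ker.simps using True gd t by simp
    finally show ?thesis .
  qed
  \<comment> \<open>At the end of the block no step of \<open>ker\<close> remains, and
    \<open>cond\<close> at size \<open>N\<close> bounds the block increment, so \<open>U\<close> is
    the indicator.\<close>
  have "expT N ?ind = expT N U"
  proof (intro expT_cong n1)
    fix t assume "t \<in> trees N"
    then have "num_nodes t = N" by (simp add: trees_def)
    moreover from this have "g * tsum ?n (good \<epsilon>) yy t \<le> y K" if "cond t"
      using that step unfolding cond_def N_def by blast
    ultimately show "?ind t = U t" by (simp add: U_def)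
  qed
  also have "\<dots> \<le> expT ?n U" using n1 nN sup by (intro expT_supermart) auto
  also have "\<dots> \<le> expT ?n (\<lambda>t. (1 - p K) * ?ind t)"
  proof (intro expT_mono n1)
    fix t assume "t \<in> trees ?n"
    then have "num_nodes t = ?n" by (simp add: trees_def)
    then show "U t \<le> (1 - p K) * ?ind t" using p[of K t] step by (simp add: U_def tsum_le N_def)
  qed
  also have "\<dots> = (1 - p K) * expT ?n ?ind" by (rule expT_cmult[OF n1(1)])
  also have "\<dots> \<le> (1 - p K) * (\<Prod>j=J..<K. 1 - p j)"
    using step p1 by (intro mult_left_mono) auto
  finally show ?case using step unfolding N_def by (simp only: prod.atLeastLessThan_Suc mult.commute)
qed

text \<open>The probability that all trees are good and all blocks small from \<open>J\<close> on is
  at most \<open>exp\<close> of minus each partial sum of \<open>p\<close>. As \<open>p\<close> has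
  exponent \<open>1 - \<eta> < 1\<close>, these sums diverge.\<close>

lemma AE_large_blocks:
  fixes B :: nat
  assumes B: "B > 2" and g: "\<bar>g\<bar> = (1::real)" and eta: "0 < \<eta>" "\<eta> \<le> 1/2"
  defines "\<tau> \<equiv> (1 - \<eta>) * sqrt ((1 - \<eta>) / (1 + 4 * \<eta>) * (1 - 2 / real B))"
  shows "AE \<omega> in M. \<exists>\<^sub>F j in sequentially. \<tau> * phi (B ^ j) < g * (spl (T (B ^ Suc j) \<omega>) - spl (T (B ^ j) \<omega>))"
proof -
  define \<epsilon> where "\<epsilon> = \<eta>\<^sup>2 / 48"
  have e: "0 < \<epsilon>" "\<epsilon> \<le> \<eta>\<^sup>2 / 48" using eta by (auto simp: \<epsilon>_def)
  define p where "p j = 1/2 * (real j * ln (real B)) powr - (1 - \<eta>)" for j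
  define y where "y j = \<tau> * phi (B ^ j)" for j
  have lB: "ln (real B) > 0" using B by simp
  have p0: "0 \<le> p j" for j by (simp add: p_def)
  have "\<forall>\<^sub>F j in sequentially. (\<forall>t. ker \<epsilon> (\<lambda>b. if g * b \<le> y j then 1 else 0) (B ^ Suc j - B ^ j) (B ^ j) t 0 \<le> 1 - p j)"
    unfolding y_def p_def \<tau>_def by (rule ker_block[OF B g eta e])
  moreover have "\<forall>\<^sub>F j in sequentially. p j \<le> 1"
    unfolding p_def using lB eta by real_asymp
  ultimately have "\<forall>\<^sub>F j in sequentially. (\<forall>t. ker \<epsilon> (\<lambda>b. if g * b \<le> y j then 1 else 0) (B ^ Suc j - B ^ j) (B ^ j) t 0 \<le> 1 - p j) \<and> p j \<le> 1"
    by (rule eventually_conj)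
  then obtain J0 where J0: "\<And>j t. j \<ge> J0 \<Longrightarrow> ker \<epsilon> (\<lambda>b. if g * b \<le> y j then 1 else 0) (B ^ Suc j - B ^ j) (B ^ j) t 0 \<le> 1 - p j"
      "\<And>j. j \<ge> J0 \<Longrightarrow> p j \<le> 1"
    unfolding eventually_sequentially by blast
  have nsum: "\<not> summable p"
  proof
    assume "summable p"
    then have "summable (\<lambda>j. p j * (2 * ln (real B) powr (1 - \<eta>)))" by (rule summable_mult2)
    moreover have "p j * (2 * ln (real B) powr (1 - \<eta>)) = real j powr - (1 - \<eta>)" for j
      using lB by (simp add: p_def powr_mult powr_minus field_simps del: minus_diff_eq)
    ultimately show False using eta by (simp add: summable_real_powr_iff)
  qed
  have AEJ: "AE \<omega> in M. \<not> ((\<forall>k\<ge>B ^ J. good \<epsilon> (T k \<omega>)) \<and> (\<forall>j\<ge>J. g * tsum (B ^ j) (good \<epsilon>) yy (T (B ^ Suc j) \<omega>) \<le> y j))"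
    if J: "J \<ge> max 1 J0" for J
  proof -
    let ?P = "\<lambda>\<omega>. (\<forall>k\<ge>B ^ J. good \<epsilon> (T k \<omega>)) \<and> (\<forall>j\<ge>J. g * tsum (B ^ j) (good \<epsilon>) yy (T (B ^ Suc j) \<omega>) \<le> y j)"
    have B1: "B ^ k \<ge> 1" for k using B by simp
    have e1: "{\<omega>\<in>space M. B ^ J \<le> k \<longrightarrow> good \<epsilon> (T k \<omega>)} \<in> events" for k
      using T_event[of k "good \<epsilon>"] B1[of J] by (cases "B ^ J \<le> k") auto
    have e2: "{\<omega>\<in>space M. J \<le> j \<longrightarrow> g * tsum (B ^ j) (good \<epsilon>) yy (T (B ^ Suc j) \<omega>) \<le> y j} \<in> events" for j
      using T_event[of "B ^ Suc j" "\<lambda>t. J \<le> j \<longrightarrow> g * tsum (B ^ j) (good \<epsilon>) yy t \<le> y j"] B1[of "Suc j"] by simp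
    have ev: "{\<omega>\<in>space M. ?P \<omega>} \<in> events"
      by (intro sets.sets_Collect_conj sets.sets_Collect_countable_All e1 e2)
    have bound: "prob {\<omega>\<in>space M. ?P \<omega>} \<le> exp (- (\<Sum>j=J..<K. p j))" if K: "K \<ge> J" for K
    proof -
      define cond where "cond = (\<lambda>t. \<forall>j\<ge>J. num_nodes t = B ^ Suc j \<longrightarrow> g * tsum (B ^ j) (good \<epsilon>) yy t \<le> y j)"
      define Q where "Q = (\<lambda>t. cond t \<and> (B ^ J \<le> num_nodes t \<longrightarrow> good \<epsilon> t))"
      have "prob {\<omega>\<in>space M. ?P \<omega>} \<le> prob {\<omega>\<in>space M. past Q (T (B ^ K) \<omega>) \<and> cond (T (B ^ K) \<omega>)}"
      proof (rule finite_measure_mono_AE)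
        show "AE \<omega> in M. \<omega> \<in> {\<omega>\<in>space M. ?P \<omega>} \<longrightarrow> \<omega> \<in> {\<omega>\<in>space M. past Q (T (B ^ K) \<omega>) \<and> cond (T (B ^ K) \<omega>)}"
          using AE_path
        proof eventually_elim
          case (elim \<omega>)
          have nn: "num_nodes (T k \<omega>) = k" if "k \<ge> 1" for k using path_trees[OF elim that] by (simp add: trees_def)
          have "cond (T k \<omega>)" "Q (T k \<omega>)" if "?P \<omega>" "k \<ge> 1" for k
            using that nn[OF that(2)] by (auto simp: cond_def Q_def)
          then show ?case using path_past[OF elim B1[of K], of Q] B1[of K] by auto
        qed
        show "{\<omega>\<in>space M. past Q (T (B ^ K) \<omega>) \<and> cond (T (B ^ K) \<omega>)} \<in> events"
          by (rule T_event[OF B1])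
      qed
      also have "\<dots> = expT (B ^ K) (\<lambda>t. if past Q t \<and> cond t then 1 else 0)"
        by (rule expT_indicator[OF B1, symmetric])
      also have "\<dots> \<le> (\<Prod>j=J..<K. 1 - p j)"
        unfolding Q_def cond_def using J by (intro prob_no_large_block B K J0) auto
      also have "\<dots> \<le> (\<Prod>j=J..<K. exp (- p j))"
      proof (intro prod_mono conjI)
        fix j assume "j \<in> {J..<K}"
        then show "0 \<le> 1 - p j" using J0(2)[of j] J by simp
        show "1 - p j \<le> exp (- p j)" using exp_ge_add_one_self[of "- p j"] by simp
      qed
      also have "\<dots> = exp (- (\<Sum>j=J..<K. p j))" by (simp add: exp_sum[symmetric] sum_negf)
      finally show ?thesis .
    qed
    have "prob {\<omega>\<in>space M. ?P \<omega>} = 0"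
    proof (rule ccontr)
      assume "prob {\<omega>\<in>space M. ?P \<omega>} \<noteq> 0"
      then have pos: "prob {\<omega>\<in>space M. ?P \<omega>} > 0" by (simp add: zero_less_measure_iff)
      have "(\<Sum>j<K. p (j + J)) \<le> - ln (prob {\<omega>\<in>space M. ?P \<omega>})" for K
      proof -
        have "(\<Sum>j<K. p (j + J)) = (\<Sum>j=J..<J + K. p j)"
          using sum.shift_bounds_nat_ivl[of p 0 J K] by (simp add: lessThan_atLeast0 add.commute)
        moreover have "ln (prob {\<omega>\<in>space M. ?P \<omega>}) \<le> - (\<Sum>j=J..<J + K. p j)"
        proof -
          have "ln (prob {\<omega>\<in>space M. ?P \<omega>}) \<le> ln (exp (- (\<Sum>j=J..<J + K. p j)))"
            using bound[OF le_add1] pos by (subst ln_le_cancel_iff) auto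
          then show ?thesis by simp
        qed
        ultimately show ?thesis by simp
      qed
      then have "summable (\<lambda>j. p (j + J))"
        using p0 by (intro summableI_nonneg_bounded)
      then show False using nsum by (simp add: summable_iff_shift)
    qed
    then show ?thesis unfolding prob_eq_0[OF ev] by (rule AE_mp) (rule AE_I2, simp only: mem_Collect_eq simp_thms)
  qed
  have "AE \<omega> in M. \<forall>J. J \<ge> max 1 J0 \<longrightarrow> \<not> ((\<forall>k\<ge>B ^ J. good \<epsilon> (T k \<omega>)) \<and> (\<forall>j\<ge>J. g * tsum (B ^ j) (good \<epsilon>) yy (T (B ^ Suc j) \<omega>) \<le> y j))"
    unfolding AE_all_countable using AEJ by auto
  with AE_path AE_good[OF e(1)] show ?thesis
  proof eventually_elim
    case (elim \<omega>)
    obtain N where N: "\<And>k. k \<ge> N \<Longrightarrow> good \<epsilon> (T k \<omega>)" using elim(2) by (auto simp: eventually_sequentially)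
    show ?case unfolding frequently_sequentially
    proof
      fix I
      \<comment> \<open>From size \<open>B ^ J\<close> on all trees are good, since
        \<open>N \<le> J < B ^ J\<close>.\<close>
      define J where "J = max I (max N (max 1 J0))"
      have BJ: "B ^ j \<ge> N" if "j \<ge> J" for j
      proof -
        have "N \<le> j" using that by (simp add: J_def)
        also have "j < B ^ j" using B by (intro power_gt_expt) auto
        finally show ?thesis by simp
      qed
      have "\<not> (\<forall>j\<ge>J. g * tsum (B ^ j) (good \<epsilon>) yy (T (B ^ Suc j) \<omega>) \<le> y j)"
      proof -
        have "J \<ge> max 1 J0" by (simp add: J_def le_max_iff_disj)
        moreover have "\<forall>k\<ge>B ^ J. good \<epsilon> (T k \<omega>)" using N BJ[of J] by auto
        ultimately show ?thesis using elim(3) by blast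
      qed
      then obtain j where j: "j \<ge> J" "y j < g * tsum (B ^ j) (good \<epsilon>) yy (T (B ^ Suc j) \<omega>)" by (auto simp: not_le)
      have "tsum (B ^ j) (good \<epsilon>) yy (T (B ^ Suc j) \<omega>) = spl (T (B ^ Suc j) \<omega>) - spl (T (B ^ j) \<omega>)"
      proof (rule path_tsum[OF elim(1)])
        show "good \<epsilon> (T k \<omega>)" if "B ^ j \<le> k" for k using N BJ[OF j(1)] that by simp
      qed (use B in auto)
      then show "\<exists>j\<ge>I. \<tau> * phi (B ^ j) < g * (spl (T (B ^ Suc j) \<omega>) - spl (T (B ^ j) \<omega>))"
        using j by (intro exI[of _ j]) (auto simp: y_def J_def)
    qed
  qed
qed

end

section \<open>The central limit theorem\<close>

lemma iexp_quadratic: "cmod (iexp x - (1 + \<i> * complex_of_real x - complex_of_real (x\<^sup>2 / 2))) \<le> \<bar>x\<bar> ^ 3 / 6"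
proof -
  have "(\<Sum>k\<le>2. (\<i> * complex_of_real x) ^ k / fact k) = 1 + \<i> * complex_of_real x - complex_of_real (x\<^sup>2 / 2)"
    by (simp add: numeral_2_eq_2 power2_eq_square field_simps)
  then show ?thesis using iexp_approx1[of x 2] by (simp add: fact_numeral numeral_3_eq_3)
qed

lemma exp_minus_linear: "0 \<le> z \<Longrightarrow> \<bar>exp (- z) - (1 - z)\<bar> \<le> (z\<^sup>2 :: real)"
proof (cases "z \<le> 1")
  case True
  assume "0 \<le> z"
  have "1 - z \<le> exp (- z)" using exp_ge_add_one_self[of "- z"] by simp
  moreover have "exp (- z) \<le> 1 + (- z) + (- z)\<^sup>2 / 2 * (1 + 1)"
    using True \<open>0 \<le> z\<close> by (intro exp_quadratic_bounds(1)) auto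
  ultimately show ?thesis by simp
next
  case False
  assume "0 \<le> z"
  have "1 - z \<le> exp (- z)" using exp_ge_add_one_self[of "- z"] by simp
  moreover have "exp (- z) \<le> 1" using \<open>0 \<le> z\<close> by simp
  moreover have "z \<le> z\<^sup>2" using False by (simp add: power2_eq_square)
  ultimately show ?thesis using \<open>0 \<le> z\<close> unfolding abs_le_iff by linarith
qed

context tree_params
begin

lemma avg_norm:
  fixes f :: "nat \<Rightarrow> complex"
  assumes "reach t" "\<And>v. v \<in> nodes t \<Longrightarrow> norm (f v) \<le> g v"
  shows "norm (avg t f) \<le> avg t g"
  unfolding avg_def using assms q_nonneg[OF assms(1)]
  by (intro sum_norm_le) (auto intro: mult_left_mono)

lemma avg_of_real: "avg t (\<lambda>v. complex_of_real (f v)) = complex_of_real (avg t f)"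
  by (simp add: avg_def scaleR_conv_of_real)

text \<open>Three errors relative to \<open>u\<^sup>2 * vk\<close>: the cubic Taylor term gives
  \<open>z\<close>, the variance allowed by \<open>good\<close> gives \<open>\<epsilon>\<close>, and
  replacing \<open>1 - u\<^sup>2 / 2 * vk\<close> by an exponential gives
  \<open>z\<^sup>2\<close>.\<close>

lemma avg_iexp:
  fixes u :: real
  assumes t: "reach t" "good \<epsilon> t" and n: "K0 \<le> n" "n \<le> num_nodes t" and e: "0 < \<epsilon>" "\<epsilon> \<le> 1"
  defines "z \<equiv> \<bar>u\<bar> * (ch * hh n)"
  shows "norm (avg t (\<lambda>v. iexp (u * yy t v)) - complex_of_real (exp (- (u\<^sup>2 / 2 * vk (num_nodes t)))))
    \<le> u\<^sup>2 * vk (num_nodes t) * (\<epsilon> + z + z\<^sup>2)"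
proof -
  let ?k = "num_nodes t"
  let ?w = "(rho ?k)\<^sup>2 * vv t"
  have k: "K0 \<le> ?k" using n by simp
  have v: "vk ?k > 0" by (rule vk_pos[OF k])
  have w: "(1 - \<epsilon>) * vk ?k \<le> ?w" "?w \<le> (1 + \<epsilon>) * vk ?k" using t(2) by (auto simp: good_def)
  have z0: "0 \<le> z" using hh_pos[OF n(1)] ch_pos by (simp add: z_def)
  have hk: "\<bar>u\<bar> * (ch * hh ?k) \<le> z" unfolding z_def using hh_antimono[OF n] ch_pos by (intro mult_left_mono) auto
  have av: "avg t (\<lambda>v. 1 + \<i> * complex_of_real (u * yy t v) - complex_of_real ((u * yy t v)\<^sup>2 / 2)) = complex_of_real (1 - u\<^sup>2 * ?w / 2)"
  proof -
    have "avg t (\<lambda>v. 1 + \<i> * complex_of_real (u * yy t v) - complex_of_real ((u * yy t v)\<^sup>2 / 2))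
      = 1 + \<i> * complex_of_real (avg t (\<lambda>v. u * yy t v)) - complex_of_real (avg t (\<lambda>v. (u\<^sup>2 / 2) * (yy t v)\<^sup>2))"
      by (simp only: avg_add avg_diff avg_const[OF t(1)] avg_cmult[of _ "\<i>"] avg_of_real) (simp add: power_mult_distrib)
    then show ?thesis by (simp only: avg_cmult avg_yy[OF t(1)] avg_yy2[OF t(1)]) simp
  qed
  have "norm (avg t (\<lambda>v. iexp (u * yy t v) - (1 + \<i> * complex_of_real (u * yy t v) - complex_of_real ((u * yy t v)\<^sup>2 / 2))))
     \<le> avg t (\<lambda>v. (z * u\<^sup>2 / 6) * (yy t v)\<^sup>2)"
  proof (rule avg_norm[OF t(1)])
    fix i assume i: "i \<in> nodes t"
    have "\<bar>u * yy t i\<bar> \<le> \<bar>u\<bar> * (ch * hh ?k)"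
      unfolding abs_mult using yy_bound[OF t i] by (intro mult_left_mono) auto
    then have "\<bar>u * yy t i\<bar> * (u * yy t i)\<^sup>2 \<le> z * (u * yy t i)\<^sup>2" using hk by (intro mult_right_mono) auto
    then have "\<bar>u * yy t i\<bar> ^ 3 / 6 \<le> (z * u\<^sup>2 / 6) * (yy t i)\<^sup>2"
      by (simp add: power3_eq_cube power2_eq_square mult_ac)
    then show "norm (iexp (u * yy t i) - (1 + \<i> * complex_of_real (u * yy t i) - complex_of_real ((u * yy t i)\<^sup>2 / 2))) \<le> (z * u\<^sup>2 / 6) * (yy t i)\<^sup>2"
      using iexp_quadratic[of "u * yy t i"] by linarith
  qed
  also have "\<dots> = z * u\<^sup>2 / 6 * ?w" by (simp only: avg_cmult avg_yy2[OF t(1)])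
  also have "\<dots> \<le> z * u\<^sup>2 / 6 * (2 * vk ?k)"
  proof (intro mult_left_mono)
    have "(1 + \<epsilon>) * vk ?k \<le> 2 * vk ?k" using e v by (intro mult_right_mono) auto
    then show "?w \<le> 2 * vk ?k" using w by linarith
  qed (use z0 in auto)
  finally have 1: "norm (avg t (\<lambda>v. iexp (u * yy t v)) - complex_of_real (1 - u\<^sup>2 * ?w / 2)) \<le> z * u\<^sup>2 / 6 * (2 * vk ?k)"
    by (simp only: avg_diff[of t "\<lambda>v. iexp (u * yy t v)"] av)
  have 2: "\<bar>(1 - u\<^sup>2 * ?w / 2) - (1 - u\<^sup>2 / 2 * vk ?k)\<bar> \<le> u\<^sup>2 / 2 * (\<epsilon> * vk ?k)"
  proof -
    have "\<bar>vk ?k - ?w\<bar> \<le> \<epsilon> * vk ?k" using w by (auto simp: abs_le_iff algebra_simps)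
    then have "u\<^sup>2 / 2 * \<bar>vk ?k - ?w\<bar> \<le> u\<^sup>2 / 2 * (\<epsilon> * vk ?k)" by (intro mult_left_mono) auto
    moreover have "(1 - u\<^sup>2 * ?w / 2) - (1 - u\<^sup>2 / 2 * vk ?k) = u\<^sup>2 / 2 * (vk ?k - ?w)" by (simp add: field_simps)
    ultimately show ?thesis by (simp only: abs_mult) simp
  qed
  have 3: "\<bar>exp (- (u\<^sup>2 / 2 * vk ?k)) - (1 - u\<^sup>2 / 2 * vk ?k)\<bar> \<le> u\<^sup>2 / 2 * vk ?k * z\<^sup>2"
  proof -
    have "sqrt (vk ?k) \<le> ch * hh ?k" by (rule K0(3)[OF k])
    then have "\<bar>u\<bar> * sqrt (vk ?k) \<le> z" using hk by (smt (verit) mult_left_mono abs_ge_zero)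
    then have "(\<bar>u\<bar> * sqrt (vk ?k))\<^sup>2 \<le> z\<^sup>2" using v by (intro power_mono) auto
    then have uz: "u\<^sup>2 * vk ?k \<le> z\<^sup>2" using v by (simp add: power_mult_distrib)
    have "\<bar>exp (- (u\<^sup>2 / 2 * vk ?k)) - (1 - u\<^sup>2 / 2 * vk ?k)\<bar> \<le> (u\<^sup>2 / 2 * vk ?k)\<^sup>2"
      using v by (intro exp_minus_linear) auto
    also have "\<dots> = u\<^sup>2 / 2 * vk ?k * (u\<^sup>2 * vk ?k / 2)" by (simp add: power2_eq_square)
    also have "\<dots> \<le> u\<^sup>2 / 2 * vk ?k * z\<^sup>2" 
    proof (intro mult_left_mono)
      have "0 \<le> u\<^sup>2 * vk ?k" using v by simp
      then show "u\<^sup>2 * vk ?k / 2 \<le> z\<^sup>2" using uz by linarith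
    qed (use v in auto)
    finally show ?thesis .
  qed
  let ?a = "avg t (\<lambda>v. iexp (u * yy t v))" and ?b = "1 - u\<^sup>2 * ?w / 2" and ?e = "exp (- (u\<^sup>2 / 2 * vk ?k))"
  have "norm (?a - complex_of_real ?e) \<le> norm (?a - complex_of_real ?b) + norm (complex_of_real ?b - complex_of_real ?e)"
    by (rule order_trans[OF eq_refl norm_triangle_ineq]) simp
  moreover have "norm (complex_of_real ?b - complex_of_real ?e) = \<bar>?b - ?e\<bar>"
    by (simp only: of_real_diff[symmetric] norm_of_real)
  moreover have "\<bar>?b - ?e\<bar> \<le> u\<^sup>2 / 2 * (\<epsilon> * vk ?k) + u\<^sup>2 / 2 * vk ?k * z\<^sup>2" using 2 3 unfolding abs_le_iff by linarith
  moreover have "z * u\<^sup>2 / 6 * (2 * vk ?k) + (u\<^sup>2 / 2 * (\<epsilon> * vk ?k) + u\<^sup>2 / 2 * vk ?k * z\<^sup>2)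
     = u\<^sup>2 * vk ?k * (\<epsilon> / 2 + z / 3 + z\<^sup>2 / 2)" by (simp add: field_simps)
  moreover have "u\<^sup>2 * vk ?k * (\<epsilon> / 2 + z / 3 + z\<^sup>2 / 2) \<le> u\<^sup>2 * vk ?k * (\<epsilon> + z + z\<^sup>2)"
    using v e z0 by (intro mult_left_mono add_mono) auto
  ultimately show ?thesis using 1 by linarith
qed

end

context tree_run
begin

text \<open>\<open>D j\<close> runs the trees up to size \<open>j\<close> and multiplies by the
  Gaussian factor of the remaining variance, interpolating between a constant at \<open>n\<close>
  and the characteristic function at \<open>N\<close>. Paths with a bad ancestor are discarded; the
  mass \<open>\<pi> j - \<pi> (Suc j)\<close> lost in one step telescopes to the probability of
  meeting a bad tree.\<close>

lemma charfun_bound: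
  fixes u :: real
  assumes n: "K0 \<le> n" "n \<le> N" and e: "0 < \<epsilon>" "\<epsilon> \<le> 1"
  defines "z \<equiv> \<bar>u\<bar> * (ch * hh n)"
  shows "norm ((\<integral>\<omega>. iexp (u * (spl (T N \<omega>) - spl (T n \<omega>))) \<partial>M) - complex_of_real (exp (- (u\<^sup>2 / 2 * (lam * (hh n - hh N))))))
    \<le> u\<^sup>2 * (lam * hh n) * (\<epsilon> + z + z\<^sup>2) + 2 * prob {\<omega>\<in>space M. \<exists>k\<ge>n. \<not> good \<epsilon> (T k \<omega>)}"
proof -
  define P where "P = past (\<lambda>t. n \<le> num_nodes t \<longrightarrow> good \<epsilon> t)"
  let ?Y = "tsum n (good \<epsilon>) yy"
  define E where "E j = exp (- (u\<^sup>2 / 2 * (lam * (hh j - hh N))))" for j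
  define F where "F j t = (if P t then iexp (u * ?Y t) * complex_of_real (E j) else 0)" for j t
  define D where "D j = expT j (F j)" for j
  define \<pi> where "\<pi> j = expT j (\<lambda>t. if P t then 1 else 0 :: real)" for j
  define b where "b j = u\<^sup>2 * vk j * (\<epsilon> + z + z\<^sup>2)" for j
  have n1: "n \<ge> 1" using n K0(1) by simp
  have N1: "N \<ge> 1" using n1 n by simp
  have z0: "0 \<le> z" using hh_pos[OF n(1)] ch_pos by (simp add: z_def)
  have b0: "0 \<le> b j" if "j \<ge> n" for j unfolding b_def using vk_pos[of j] n that e z0 by auto
  have step: "norm (D (Suc j) - D j) \<le> b j + (\<pi> j - \<pi> (Suc j))" if j: "n \<le> j" "j < N" for j
  proof -
    have j1: "j \<ge> 1" using j n1 by simp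
    have Ej: "0 \<le> E (Suc j)" "E (Suc j) \<le> 1" "E j \<le> 1" "0 \<le> E j"
    proof -
      have "hh N \<le> hh (Suc j)" "hh N \<le> hh j" using hh_antimono[of j N] hh_antimono[of "Suc j" N] n j by auto
      then show "0 \<le> E (Suc j)" "E (Suc j) \<le> 1" "E j \<le> 1" "0 \<le> E j" using lam_pos by (simp_all add: E_def)
    qed
    have EE: "E j = exp (- (u\<^sup>2 / 2 * vk j)) * E (Suc j)"
      by (simp add: E_def vk_def exp_add[symmetric] field_simps)
    have "D (Suc j) - D j = expT j (\<lambda>t. avg t (\<lambda>v. F (Suc j) (Attach t v)) - F j t)"
      unfolding D_def expT_Suc[OF j1] by (rule expT_diff[OF j1, symmetric])
    also have "norm \<dots> \<le> expT j (\<lambda>t. b j + ((if P t then 1 else 0) - avg t (\<lambda>v. if P (Attach t v) then 1 else 0)))"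
    proof (rule expT_norm[OF j1])
      fix t assume "t \<in> trees j"
      then have t: "reach t" "num_nodes t = j" by (auto simp: trees_def)
      show "norm (avg t (\<lambda>v. F (Suc j) (Attach t v)) - F j t) \<le> b j + ((if P t then 1 else 0) - avg t (\<lambda>v. if P (Attach t v) then 1 else 0))"
      proof (cases "P t \<and> good \<epsilon> t")
        case True
        have PA: "P (Attach t v)" for v using True by (simp add: P_def)
        have "avg t (\<lambda>v. F (Suc j) (Attach t v)) - F j t =
           avg t (\<lambda>v. (iexp (u * ?Y t) * complex_of_real (E (Suc j))) * iexp (u * yy t v)) - F j t"
          using True PA t j by (simp add: F_def exp_add ring_distribs mult_ac)
        also have "\<dots> = (iexp (u * ?Y t) * complex_of_real (E (Suc j))) *
           (avg t (\<lambda>v. iexp (u * yy t v)) - complex_of_real (exp (- (u\<^sup>2 / 2 * vk j))))"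
          using True by (simp only: avg_cmult F_def EE if_True) (simp add: algebra_simps)
        also have "norm \<dots> = E (Suc j) * norm (avg t (\<lambda>v. iexp (u * yy t v)) - complex_of_real (exp (- (u\<^sup>2 / 2 * vk j))))"
          using Ej by (simp add: norm_mult)
        also have "\<dots> \<le> 1 * b j"
          using avg_iexp[OF t(1) _ n(1) _ e, of u] True t j Ej by (intro mult_mono) (auto simp: b_def z_def)
        finally show ?thesis using True PA by (simp add: avg_const[OF t(1)])
      next
        \<comment> \<open>Either the tree is discarded already, or the next step discards it; then
          the loss of at most 1 is the drop of the indicator of \<open>P\<close>.\<close>
        case False
        then have PA: "\<not> P (Attach t v)" for v using t j by (auto simp: P_def)
        have "norm (F j t) \<le> (if P t then 1 else 0)" using Ej by (simp add: F_def norm_mult)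
        then show ?thesis using PA b0[OF j(1)] by (auto simp: avg_const[OF t(1)] F_def)
      qed
    qed
    also have "\<dots> = b j + (\<pi> j - \<pi> (Suc j))"
      unfolding \<pi>_def expT_Suc[OF j1] by (simp only: expT_add[OF j1] expT_diff[OF j1] expT_const[OF j1])
    finally show ?thesis .
  qed
  have "norm (D j - D n) \<le> (\<Sum>i=n..<j. b i) + (\<pi> n - \<pi> j)" if "n \<le> j" "j \<le> N" for j
    using that
  proof (induction j rule: dec_induct)
    case (step j)
    have "norm (D (Suc j) - D n) \<le> norm (D (Suc j) - D j) + norm (D j - D n)"
      by (rule order_trans[OF eq_refl norm_triangle_ineq]) simp
    then show ?case using step \<open>\<And>j. n \<le> j \<Longrightarrow> j < N \<Longrightarrow> norm (D (Suc j) - D j) \<le> b j + (\<pi> j - \<pi> (Suc j))\<close>[of j] by simp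
  qed simp
  from this[OF n(2) order_refl] have DN: "norm (D N - D n) \<le> (\<Sum>i=n..<N. b i) + (\<pi> n - \<pi> N)" .
  have P_small: "P t" if "num_nodes t \<le> n" for t
    unfolding P_def using that by (induction t) auto
  have Dn: "D n = complex_of_real (E n)"
  proof -
    have "D n = expT n (\<lambda>_. complex_of_real (E n))"
      unfolding D_def by (intro expT_cong n1) (auto simp: F_def trees_def P_small tsum_le)
    then show ?thesis by (simp add: expT_const[OF n1])
  qed
  have pn: "\<pi> n = 1"
  proof -
    have "\<pi> n = expT n (\<lambda>_. 1)" unfolding \<pi>_def by (intro expT_cong n1) (auto simp: trees_def P_small)
    then show ?thesis by (simp add: expT_const[OF n1])
  qed
  have pN: "1 - \<pi> N = prob {\<omega>\<in>space M. \<not> P (T N \<omega>)}"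
  proof -
    have "1 - \<pi> N = expT N (\<lambda>t. 1 - (if P t then 1 else 0 :: real))"
      unfolding \<pi>_def by (simp only: expT_diff[OF N1] expT_const[OF N1])
    also have "\<dots> = expT N (\<lambda>t. if \<not> P t then 1 else 0 :: real)" by (intro expT_cong N1) auto
    also have "\<dots> = prob {\<omega>\<in>space M. \<not> P (T N \<omega>)}" by (rule expT_indicator[OF N1])
    finally show ?thesis .
  qed
  have e1: "{\<omega>\<in>space M. \<exists>k\<ge>n. \<not> good \<epsilon> (T k \<omega>)} \<in> events"
    by (rule T_event_ex[OF n1])
  have PT: "AE \<omega> in M. P (T N \<omega>) \<longleftrightarrow> (\<forall>k\<in>{n..<N}. good \<epsilon> (T k \<omega>))"
    using AE_path
  proof eventually_elim
    case (elim \<omega>)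
    have nn: "num_nodes (T k \<omega>) = k" if "k \<ge> 1" for k using path_trees[OF elim that] by (simp add: trees_def)
    show ?case unfolding P_def path_past[OF elim N1] using nn n1 by fastforce
  qed
  have p\<delta>: "1 - \<pi> N \<le> prob {\<omega>\<in>space M. \<exists>k\<ge>n. \<not> good \<epsilon> (T k \<omega>)}"
    unfolding pN
  proof (rule finite_measure_mono_AE[OF _ e1])
    show "AE \<omega> in M. \<omega> \<in> {\<omega>\<in>space M. \<not> P (T N \<omega>)} \<longrightarrow> \<omega> \<in> {\<omega>\<in>space M. \<exists>k\<ge>n. \<not> good \<epsilon> (T k \<omega>)}"
      using PT by eventually_elim auto
  qed
  have meas: "(\<lambda>\<omega>. iexp (u * (spl (T N \<omega>) - spl (T n \<omega>)))) \<in> borel_measurable M"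
    using T_borel[OF N1, of spl] T_borel[OF n1, of spl] by measurable
  have int1: "integrable M (\<lambda>\<omega>. iexp (u * (spl (T N \<omega>) - spl (T n \<omega>))))"
    by (rule integrable_const_bound[of _ 1]) (use meas in auto)
  have int2: "integrable M (\<lambda>\<omega>. F N (T N \<omega>))" by (rule integrable_T[OF N1])
  have last: "norm ((\<integral>\<omega>. iexp (u * (spl (T N \<omega>) - spl (T n \<omega>))) \<partial>M) - D N) \<le> 1 - \<pi> N"
  proof -
    have "(\<integral>\<omega>. iexp (u * (spl (T N \<omega>) - spl (T n \<omega>))) \<partial>M) - D N = (\<integral>\<omega>. iexp (u * (spl (T N \<omega>) - spl (T n \<omega>))) - F N (T N \<omega>) \<partial>M)"
      unfolding D_def expT_def by (rule Bochner_Integration.integral_diff[OF int1 int2, symmetric])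
    also have "norm \<dots> \<le> (\<integral>\<omega>. norm (iexp (u * (spl (T N \<omega>) - spl (T n \<omega>))) - F N (T N \<omega>)) \<partial>M)"
      by (rule integral_norm_bound)
    also have "\<dots> \<le> (\<integral>\<omega>. indicator {\<omega>\<in>space M. \<not> P (T N \<omega>)} \<omega> \<partial>M)"
    proof (rule integral_mono_AE)
      show "integrable M (\<lambda>\<omega>. norm (iexp (u * (spl (T N \<omega>) - spl (T n \<omega>))) - F N (T N \<omega>)))"
        by (intro integrable_norm Bochner_Integration.integrable_diff int1 int2)
      show "integrable M (indicator {\<omega>\<in>space M. \<not> P (T N \<omega>)} :: 'a \<Rightarrow> real)"
        using T_event[OF N1, of "\<lambda>t. \<not> P t"] by (simp add: emeasure_eq_measure)
      show "AE \<omega> in M. norm (iexp (u * (spl (T N \<omega>) - spl (T n \<omega>))) - F N (T N \<omega>)) \<le> indicator {\<omega>\<in>space M. \<not> P (T N \<omega>)} \<omega>"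
        using AE_path PT AE_space
      proof eventually_elim
        case (elim \<omega>)
        show ?case
        proof (cases "P (T N \<omega>)")
          case True
          then have "?Y (T N \<omega>) = spl (T N \<omega>) - spl (T n \<omega>)"
            using elim by (intro path_tsum[OF elim(1) n1 n(2)]) auto
          then show ?thesis using True by (simp add: F_def E_def)
        next
          case False
          then have "F N (T N \<omega>) = 0" by (simp add: F_def)
          then show ?thesis using False elim(3) by (simp del: of_real_mult of_real_diff)
        qed
      qed
    qed
    also have "\<dots> = 1 - \<pi> N" unfolding pN using T_event[OF N1, of "\<lambda>t. \<not> P t"] by simp
    finally show ?thesis .
  qed
  have sb: "(\<Sum>i=n..<N. b i) \<le> u\<^sup>2 * (lam * hh n) * (\<epsilon> + z + z\<^sup>2)"
  proof -
    have "(\<Sum>i=n..<N. b i) = (u\<^sup>2 * (\<epsilon> + z + z\<^sup>2)) * (\<Sum>i=n..<N. vk i)"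
      unfolding sum_distrib_left by (intro sum.cong) (simp_all add: b_def mult_ac)
    also have "\<dots> = (u\<^sup>2 * (\<epsilon> + z + z\<^sup>2)) * (lam * (hh n - hh N))" by (simp only: sum_vk[OF n(2)])
    also have "\<dots> \<le> (u\<^sup>2 * (\<epsilon> + z + z\<^sup>2)) * (lam * hh n)"
      using hh_pos[of N] n lam_pos e z0 by (intro mult_left_mono) auto
    finally show ?thesis by (simp add: mult_ac)
  qed
  let ?I = "\<integral>\<omega>. iexp (u * (spl (T N \<omega>) - spl (T n \<omega>))) \<partial>M"
  have "norm (?I - complex_of_real (E n)) \<le> norm (?I - D N) + norm (D N - D n)"
    unfolding Dn by (rule order_trans[OF eq_refl norm_triangle_ineq]) simp
  then show ?thesis using last DN pn p\<delta> sb unfolding E_def by linarith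
qed

text \<open>The error bound is uniform in \<open>N\<close>, so \<open>N\<close> goes to infinity
  first and replaces \<open>spl (T N \<omega>)\<close> by the limit. Then
  \<open>(u n)\<^sup>2 * (lam * hh n)\<close> is \<open>\<theta>\<^sup>2\<close>, \<open>z\<close>
  tends to 0, and \<open>\<epsilon>\<close> is arbitrary.\<close>

lemma clt_char:
  assumes S [measurable]: "S \<in> borel_measurable M" and lim: "AE \<omega> in M. (\<lambda>n. spl (T n \<omega>)) \<longlonglongrightarrow> S \<omega>"
  shows "(\<lambda>n. \<integral>\<omega>. iexp (\<theta> * (1 / sqrt (lam * hh n) * (spl (T n \<omega>) - S \<omega>))) \<partial>M) \<longlonglongrightarrow> complex_of_real (exp (- (\<theta>\<^sup>2 / 2)))"
proof -
  \<comment> \<open>Negative because the statement has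
    \<open>spl (T n \<omega>) - S \<omega>\<close> while the increments run onwards from
    \<open>n\<close>.\<close>
  define u where "u n = - (\<theta> / sqrt (lam * hh n))" for n
  define z where "z n = \<bar>u n\<bar> * (ch * hh n)" for n
  let ?I = "\<lambda>n. \<integral>\<omega>. iexp (\<theta> * (1 / sqrt (lam * hh n) * (spl (T n \<omega>) - S \<omega>))) \<partial>M"
  let ?c = "complex_of_real (exp (- (\<theta>\<^sup>2 / 2)))"
  let ?\<delta> = "\<lambda>\<epsilon> n. prob {\<omega>\<in>space M. \<exists>k\<ge>n. \<not> good \<epsilon> (T k \<omega>)}"
  have bound: "norm (?I n - ?c) \<le> \<theta>\<^sup>2 * (\<epsilon> + z n + (z n)\<^sup>2) + 2 * ?\<delta> \<epsilon> n"
    if n: "n \<ge> K0" and e: "0 < \<epsilon>" "\<epsilon> \<le> 1" for n \<epsilon>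
  proof -
    have n1: "n \<ge> 1" using n K0(1) by simp
    have hp: "lam * hh n > 0" using hh_pos[OF n] lam_pos by simp
    have u2: "(u n)\<^sup>2 * (lam * hh n) = \<theta>\<^sup>2" using hp hh_pos[OF n] lam_pos by (simp add: u_def power_divide)
    have [measurable]: "(\<lambda>\<omega>. spl (T n \<omega>)) \<in> borel_measurable M" by (rule T_borel[OF n1])
    let ?J = "\<lambda>N. \<integral>\<omega>. iexp (u n * (spl (T (N + n) \<omega>) - spl (T n \<omega>))) \<partial>M"
    have "?J \<longlonglongrightarrow> (\<integral>\<omega>. iexp (u n * (S \<omega> - spl (T n \<omega>))) \<partial>M)"
    proof (rule integral_dominated_convergence[where w="\<lambda>_. 1"])
      show "AE \<omega> in M. (\<lambda>N. iexp (u n * (spl (T (N + n) \<omega>) - spl (T n \<omega>)))) \<longlonglongrightarrow> iexp (u n * (S \<omega> - spl (T n \<omega>)))"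
        using lim
      proof eventually_elim
        case (elim \<omega>)
        from LIMSEQ_ignore_initial_segment[OF this, of n] show ?case by (intro tendsto_intros)
      qed
      show "(\<lambda>\<omega>. iexp (u n * (spl (T (N + n) \<omega>) - spl (T n \<omega>)))) \<in> borel_measurable M" for N
      proof -
        have [measurable]: "(\<lambda>\<omega>. spl (T (N + n) \<omega>)) \<in> borel_measurable M" using n1 by (intro T_borel) simp
        show ?thesis by measurable
      qed
    qed auto
    also have "(\<integral>\<omega>. iexp (u n * (S \<omega> - spl (T n \<omega>))) \<partial>M) = ?I n"
    proof -
      have "u n * (S \<omega> - spl (T n \<omega>)) = \<theta> * (1 / sqrt (lam * hh n) * (spl (T n \<omega>) - S \<omega>))" for \<omega>
        by (simp add: u_def algebra_simps diff_divide_distrib)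
      then show ?thesis by (simp only:)
    qed
    finally have J: "?J \<longlonglongrightarrow> ?I n" .
    have "(\<lambda>N. hh (N + n)) \<longlonglongrightarrow> 0"
    proof -
      have "hh \<longlonglongrightarrow> 0" unfolding hh_def[abs_def] by real_asymp
      then show ?thesis by (rule LIMSEQ_ignore_initial_segment)
    qed
    then have "(\<lambda>N. complex_of_real (exp (- ((u n)\<^sup>2 / 2 * (lam * (hh n - hh (N + n)))))))
      \<longlonglongrightarrow> complex_of_real (exp (- ((u n)\<^sup>2 / 2 * (lam * (hh n - 0)))))"
      by (intro tendsto_intros)
    also have "(u n)\<^sup>2 / 2 * (lam * (hh n - 0)) = \<theta>\<^sup>2 / 2" using u2 by simp
    finally have "(\<lambda>N. norm (?J N - complex_of_real (exp (- ((u n)\<^sup>2 / 2 * (lam * (hh n - hh (N + n)))))))) \<longlonglongrightarrow> norm (?I n - ?c)"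
      by (rule tendsto_norm[OF tendsto_diff[OF J]])
    then show ?thesis
    proof (rule LIMSEQ_le_const2)
      have "norm (?J N - complex_of_real (exp (- ((u n)\<^sup>2 / 2 * (lam * (hh n - hh (N + n))))))) \<le> \<theta>\<^sup>2 * (\<epsilon> + z n + (z n)\<^sup>2) + 2 * ?\<delta> \<epsilon> n" for N
        using charfun_bound[OF n le_add2 e, of "u n" N] unfolding u2 z_def .
      then show "\<exists>N0. \<forall>N\<ge>N0. norm (?J N - complex_of_real (exp (- ((u n)\<^sup>2 / 2 * (lam * (hh n - hh (N + n))))))) \<le> \<theta>\<^sup>2 * (\<epsilon> + z n + (z n)\<^sup>2) + 2 * ?\<delta> \<epsilon> n"
        by blast
    qed
  qed
  have z0: "z \<longlonglongrightarrow> 0"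
  proof -
    have "(\<lambda>n. ch * hh n / sqrt (lam * hh n)) \<longlonglongrightarrow> 0"
      unfolding hh_def using lam_pos ch_pos by real_asymp
    from tendsto_mult_left[OF this, of "\<bar>\<theta>\<bar>"] have "(\<lambda>n. \<bar>\<theta>\<bar> * (ch * hh n / sqrt (lam * hh n))) \<longlonglongrightarrow> 0" by simp
    then show ?thesis
    proof (rule Lim_transform_eventually)
      show "\<forall>\<^sub>F n in sequentially. \<bar>\<theta>\<bar> * (ch * hh n / sqrt (lam * hh n)) = z n"
        using eventually_ge_at_top[of K0]
      proof eventually_elim
        case (elim n)
        have s0: "0 \<le> sqrt (lam * hh n)" using hh_pos[OF elim] lam_pos by simp
        show ?case unfolding z_def u_def abs_minus_cancel abs_divide abs_of_nonneg[OF s0] by simp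
      qed
    qed
  qed
  have d0: "?\<delta> \<epsilon> \<longlonglongrightarrow> 0" if e: "0 < \<epsilon>" for \<epsilon>
  proof -
    \<comment> \<open>Nothing is assumed of \<open>T 0\<close>, so the events start at size 1 to be
      measurable.\<close>
    let ?A = "\<lambda>n. {\<omega>\<in>space M. \<exists>k\<ge>n + 1. \<not> good \<epsilon> (T k \<omega>)}"
    have ev: "?A n \<in> events" for n by (rule T_event_ex) simp
    have "(\<lambda>n. prob (?A n)) \<longlonglongrightarrow> prob (\<Inter>n. ?A n)"
      
    proof (rule finite_Lim_measure_decseq)
      show "range ?A \<subseteq> events" using ev by auto
      have "?A n \<subseteq> ?A m" if "m \<le> n" for m n
      proof
        fix \<omega> assume "\<omega> \<in> ?A n"
        then obtain k where "\<omega> \<in> space M" "k \<ge> n + 1" "\<not> good \<epsilon> (T k \<omega>)" by blast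
        moreover from this have "k \<ge> m + 1" using that by simp
        ultimately show "\<omega> \<in> ?A m" by blast
      qed
      then show "decseq ?A" by (simp add: decseq_def)
    qed
    moreover have "prob (\<Inter>n. ?A n) = 0"
    proof -
      have "AE \<omega> in M. \<omega> \<notin> (\<Inter>n. ?A n)"
        using AE_good[OF e]
      proof eventually_elim
        case (elim \<omega>)
        then obtain N where "\<And>k. k \<ge> N \<Longrightarrow> good \<epsilon> (T k \<omega>)" by (auto simp: eventually_sequentially)
        then have "\<omega> \<notin> ?A N" by auto
        then show ?case by blast
      qed
      then show ?thesis using ev by (subst prob_eq_0) auto
    qed
    ultimately have "(\<lambda>n. ?\<delta> \<epsilon> (n + 1)) \<longlonglongrightarrow> 0" by simp
    then show ?thesis by (rule LIMSEQ_offset)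
  qed
  have "(\<lambda>n. norm (?I n - ?c)) \<longlonglongrightarrow> 0"
  proof (rule LIMSEQ_I, goal_cases)
    case (1 r)
    define K where "K = \<theta>\<^sup>2 + 1"
    have t1: "0 < K" and tK: "\<theta>\<^sup>2 \<le> K" by (simp_all add: K_def add_nonneg_pos)
    define \<epsilon> where "\<epsilon> = min 1 (r / (2 * K))"
    have e: "0 < \<epsilon>" "\<epsilon> \<le> 1" using 1 t1 by (auto simp: \<epsilon>_def)
    have "\<theta>\<^sup>2 * \<epsilon> \<le> K * (r / (2 * K))" using e t1 tK 1 by (intro mult_mono) (auto simp: \<epsilon>_def)
    also have "\<dots> = r / 2" using t1 by simp
    finally have te: "\<theta>\<^sup>2 * (\<epsilon> + 0 + 0\<^sup>2) + 2 * 0 < r" using 1 by simp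
    have "(\<lambda>n. \<theta>\<^sup>2 * (\<epsilon> + z n + (z n)\<^sup>2) + 2 * ?\<delta> \<epsilon> n) \<longlonglongrightarrow> \<theta>\<^sup>2 * (\<epsilon> + 0 + 0\<^sup>2) + 2 * 0"
      by (intro tendsto_intros z0 d0 e)
    then have "\<forall>\<^sub>F n in sequentially. \<theta>\<^sup>2 * (\<epsilon> + z n + (z n)\<^sup>2) + 2 * ?\<delta> \<epsilon> n < r"
      using te by (rule order_tendstoD)
    then have "\<forall>\<^sub>F n in sequentially. norm (norm (?I n - ?c) - 0) < r"
      using eventually_ge_at_top[of K0]
    proof eventually_elim
      case (elim n)
      then show ?case using bound[OF elim(2) e] by simp
    qed
    then show ?case by (simp add: eventually_sequentially)
  qed
  then show ?thesis by (simp add: tendsto_norm_zero_iff LIM_zero_iff)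
qed

lemma clt:
  assumes S [measurable]: "S \<in> borel_measurable M" and lim: "AE \<omega> in M. (\<lambda>n. spl (T n \<omega>)) \<longlonglongrightarrow> S \<omega>"
    and X [measurable]: "\<And>n. X n \<in> borel_measurable M"
    and XT: "\<And>n. n \<ge> K0 \<Longrightarrow> AE \<omega> in M. X n \<omega> = 1 / sqrt (lam * hh n) * (spl (T n \<omega>) - S \<omega>)"
  shows "weak_conv_m (\<lambda>n. distr M borel (X n)) std_normal_distribution"
proof (rule levy_continuity)
  show "real_distribution (distr M borel (X n))" for n by (rule real_distribution_distr) simp
  show "real_distribution std_normal_distribution" by (rule real_dist_normal_dist)
  fix \<theta>
  have "\<forall>\<^sub>F n in sequentially. (\<integral>\<omega>. iexp (\<theta> * (1 / sqrt (lam * hh n) * (spl (T n \<omega>) - S \<omega>))) \<partial>M) = char (distr M borel (X n)) \<theta>"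
    using eventually_ge_at_top[of K0]
  proof eventually_elim
    case (elim n)
    have n1: "n \<ge> 1" using elim K0(1) by simp
    have [measurable]: "(\<lambda>\<omega>. spl (T n \<omega>)) \<in> borel_measurable M" by (rule T_borel[OF n1])
    have "char (distr M borel (X n)) \<theta> = (\<integral>\<omega>. iexp (\<theta> * X n \<omega>) \<partial>M)"
      unfolding char_def by (subst integral_distr) auto
    also have "\<dots> = (\<integral>\<omega>. iexp (\<theta> * (1 / sqrt (lam * hh n) * (spl (T n \<omega>) - S \<omega>))) \<partial>M)"
    proof (rule integral_cong_AE)
      show "AE \<omega> in M. iexp (\<theta> * X n \<omega>) = iexp (\<theta> * (1 / sqrt (lam * hh n) * (spl (T n \<omega>) - S \<omega>)))"
        using XT[OF elim] by eventually_elim simp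
    qed measurable
    finally show ?case by simp
  qed
  then have "(\<lambda>n. char (distr M borel (X n)) \<theta>) \<longlonglongrightarrow> complex_of_real (exp (- (\<theta>\<^sup>2 / 2)))"
    by (rule Lim_transform_eventually[OF clt_char[OF S lim]])
  then show "(\<lambda>n. char (distr M borel (X n)) \<theta>) \<longlonglongrightarrow> char std_normal_distribution \<theta>"
    by (simp add: char_std_normal_distribution)
qed

end

section \<open>The martingale property and the limit laws\<close>

lemma limsup_eq_oneI:
  fixes x :: "nat \<Rightarrow> real"
  assumes up: "\<And>\<delta>. \<delta> > 0 \<Longrightarrow> \<forall>\<^sub>F n in sequentially. x n \<le> 1 + \<delta>"
    and lo: "\<And>\<delta>. \<delta> > 0 \<Longrightarrow> \<exists>\<^sub>F n in sequentially. 1 - \<delta> < x n"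
  shows "limsup (\<lambda>n. ereal (x n)) = 1"
proof (rule antisym)
  show "limsup (\<lambda>n. ereal (x n)) \<le> 1"
  proof (rule ereal_le_epsilon2)
    fix \<delta> :: real assume "0 < \<delta>"
    from up[OF this] have "\<forall>\<^sub>F n in sequentially. ereal (x n) \<le> 1 + ereal \<delta>"
      by eventually_elim (simp add: one_ereal_def)
    then show "limsup (\<lambda>n. ereal (x n)) \<le> 1 + ereal \<delta>" by (rule Limsup_bounded)
  qed
  show "1 \<le> limsup (\<lambda>n. ereal (x n))"
  proof (rule ccontr)
    assume "\<not> 1 \<le> limsup (\<lambda>n. ereal (x n))"
    then have "limsup (\<lambda>n. ereal (x n)) < ereal 1" by (simp add: one_ereal_def)
    then obtain r where r: "limsup (\<lambda>n. ereal (x n)) < ereal r" "ereal r < ereal 1"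
      using ereal_dense2 by blast
    have "\<forall>\<^sub>F n in sequentially. x n < r" using Limsup_lessD[OF r(1)] by simp
    moreover have "\<exists>\<^sub>F n in sequentially. r < x n" using lo[of "1 - r"] r by simp
    ultimately have "\<exists>\<^sub>F n in sequentially. r < x n \<and> x n < r"
      by (rule frequently_eventually_frequently[rotated])
    then show False by (auto dest: frequently_ex)
  qed
qed

context tree_params
begin

lemma phi_scale:
  assumes "n \<ge> 16"
  shows "sqrt ((\<beta> + real m) / (2 * real m)) * sqrt (real n / (ln (real n) * ln (ln (real n)))) = 1 / phi n" "phi n > 0"
proof -
  have m: "real m > 0" "\<beta> + real m > 0" using params bm_pos by auto
  have "exp 1 < real n" using exp_le assms by linarith
  then have "ln (exp 1) < ln (real n)" using assms by (subst ln_less_cancel_iff) auto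
  then have l: "ln (real n) > 1" by simp
  then have l2: "ln (ln (real n)) > 0" by simp
  have "(\<beta> + real m) / (2 * real m) * (real n / (ln (real n) * ln (ln (real n)))) = 1 / (2 * lam * hh n * ln (ln (real n)))"
    using m l l2 by (simp add: lam_def hh_def)
  then show "sqrt ((\<beta> + real m) / (2 * real m)) * sqrt (real n / (ln (real n) * ln (ln (real n)))) = 1 / phi n"
    unfolding real_sqrt_mult[symmetric] phi_def by (simp only: real_sqrt_divide real_sqrt_one)
  show "phi n > 0" unfolding phi_def hh_def using l l2 lam_pos assms by simp
qed

text \<open>The constant tends to 1 as \<open>\<eta>\<close> tends to 0 and \<open>B\<close> to
  infinity, here along one sequence. The term \<open>4 / sqrt (real B)\<close> is the cost of the
  tail after the block.\<close>

lemma lil_parameters: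
  assumes "\<delta> > 0"
  obtains \<eta> :: real and B :: nat where "0 < \<eta>" "\<eta> \<le> 1/2" "B > 2"
    "1 - \<delta> < (1 - \<eta>) * sqrt ((1 - \<eta>) / (1 + 4 * \<eta>) * (1 - 2 / real B)) - 4 / sqrt (real B)"
proof -
  let ?e = "\<lambda>i::nat. 1 / (real i + 2)"
  have "(\<lambda>i::nat. (1 - ?e i) * sqrt ((1 - ?e i) / (1 + 4 * ?e i) * (1 - 2 / (real i + 3))) - 4 / sqrt (real i + 3)) \<longlonglongrightarrow> 1"
    by real_asymp
  then have "\<forall>\<^sub>F i in sequentially. 1 - \<delta> < (1 - ?e i) * sqrt ((1 - ?e i) / (1 + 4 * ?e i) * (1 - 2 / (real i + 3))) - 4 / sqrt (real i + 3)"
    using assms by (intro order_tendstoD) auto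
  then obtain i :: nat where i: "1 - \<delta> < (1 - ?e i) * sqrt ((1 - ?e i) / (1 + 4 * ?e i) * (1 - 2 / (real i + 3))) - 4 / sqrt (real i + 3)"
    by (auto simp: eventually_sequentially)
  have e: "0 < ?e i" "?e i \<le> 1/2" by (simp_all add: field_simps)
  have r: "real i + 3 = real (i + 3)" by simp
  show ?thesis using that[OF e, of "i + 3"] i unfolding r by simp
qed

text \<open>Over a block the tail variance shrinks by about the factor \<open>B\<close>; the crude
  factor 4 under the root absorbs the growth of the logarithms.\<close>

lemma phi_block:
  assumes B: "B > (2::nat)"
  shows "\<forall>\<^sub>F j in sequentially. phi (B ^ Suc j) \<le> 2 / sqrt (real B) * phi (B ^ j)"
proof -
  have lB: "ln (real B) > 0" "real B > 0" using B by auto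
  have "\<forall>\<^sub>F j in sequentially. (real j + 1) * ln ((real j + 1) * ln (real B)) \<le> 4 * real j * ln (real j * ln (real B))"
    using lB by real_asymp
  then show ?thesis
  proof eventually_elim
    case (elim j)
    have l: "ln (real (B ^ j)) = real j * ln (real B)" "ln (real (B ^ Suc j)) = (real j + 1) * ln (real B)"
      by (simp_all add: ln_realpow ln_mult lB algebra_simps)
    have "2 * lam * hh (B ^ Suc j) * ln (ln (real (B ^ Suc j))) =
        2 * lam * ln (real B) / (real B * real (B ^ j)) * ((real j + 1) * ln ((real j + 1) * ln (real B)))"
      unfolding hh_def l by simp
    also have "\<dots> \<le> 2 * lam * ln (real B) / (real B * real (B ^ j)) * (4 * real j * ln (real j * ln (real B)))"
      using elim lB lam_pos by (intro mult_left_mono) auto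
    also have "\<dots> = 4 / real B * (2 * lam * hh (B ^ j) * ln (ln (real (B ^ j))))"
      unfolding hh_def l by simp
    finally have "phi (B ^ Suc j) \<le> sqrt (4 / real B * (2 * lam * hh (B ^ j) * ln (ln (real (B ^ j)))))"
      unfolding phi_def by (intro real_sqrt_le_mono)
    also have "\<dots> = 2 / sqrt (real B) * phi (B ^ j)"
      unfolding phi_def by (simp only: real_sqrt_mult real_sqrt_divide real_sqrt_four)
    finally show ?case .
  qed
qed

text \<open>The limit minus \<open>x (B ^ j)\<close> is the block increment plus the rest after the
  block. By the upper bound with factor 2 and \<open>phi_block\<close>, the rest is at most
  \<open>4 / sqrt (real B) * phi (B ^ j)\<close>.\<close>

lemma sequence_lil:
  fixes x :: "nat \<Rightarrow> real"
  assumes lim: "x \<longlonglongrightarrow> s" and up: "\<And>i::nat. \<forall>\<^sub>F n in sequentially. \<forall>k\<ge>n. \<bar>x k - x n\<bar> \<le> (1 + 1 / real (Suc i)) * phi n"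
    and lo: "\<And>\<delta>. \<delta> > 0 \<Longrightarrow> \<exists>B::nat. B > 2 \<and> (\<exists>\<tau>. 1 - \<delta> < \<tau> - 4 / sqrt (real B) \<and>
      (\<exists>\<^sub>F j in sequentially. \<tau> * phi (B ^ j) < g * (x (B ^ Suc j) - x (B ^ j))))"
    and g: "\<bar>g\<bar> = 1"
  shows "limsup (\<lambda>n. ereal (g * (1 / phi n * (s - x n)))) = 1"
proof -
  have upS: "\<forall>\<^sub>F n in sequentially. \<bar>s - x n\<bar> \<le> (1 + 1 / real (Suc i)) * phi n" for i
    using up[of i]
  proof eventually_elim
    case (elim n)
    have "(\<lambda>k. \<bar>x k - x n\<bar>) \<longlonglongrightarrow> \<bar>s - x n\<bar>" by (intro tendsto_intros lim)
    then show ?case by (rule LIMSEQ_le_const2) (use elim in auto)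
  qed
  have g_le: "g * r \<le> \<bar>r\<bar>" "- \<bar>r\<bar> \<le> g * r" for r :: real
    using g abs_mult[of g r] by (auto simp: abs_le_iff)
  show ?thesis
  proof (rule limsup_eq_oneI)
    fix \<delta> :: real assume d: "\<delta> > 0"
    then obtain i where i: "1 / real (Suc i) < \<delta>" using nat_approx_posE by blast
    show "\<forall>\<^sub>F n in sequentially. g * (1 / phi n * (s - x n)) \<le> 1 + \<delta>"
      using upS[of i] eventually_ge_at_top[of 16]
    proof eventually_elim
      case (elim n)
      have p: "phi n > 0" by (rule phi_scale(2)[OF elim(2)])
      have "g * (s - x n) \<le> (1 + \<delta>) * phi n"
      proof -
        have "(1 + 1 / real (Suc i)) * phi n \<le> (1 + \<delta>) * phi n" using i p by (intro mult_right_mono) auto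
        then show ?thesis using g_le(1)[of "s - x n"] elim(1) by linarith
      qed
      then show ?case using p by (simp add: field_simps)
    qed
    obtain B :: nat and \<tau> where B: "B > 2" and t: "1 - \<delta> < \<tau> - 4 / sqrt (real B)"
      and fr: "\<exists>\<^sub>F j in sequentially. \<tau> * phi (B ^ j) < g * (x (B ^ Suc j) - x (B ^ j))"
      using lo[OF d] by auto
    have pow: "j < B ^ j" for j using B by (intro power_gt_expt) auto
    have fl: "filterlim (\<lambda>j. B ^ Suc j) at_top sequentially"
    proof (rule filterlim_at_top_mono[OF filterlim_ident])
      show "\<forall>\<^sub>F j in sequentially. j \<le> B ^ Suc j"
        using less_trans[OF lessI pow[of "Suc _"]] by (intro always_eventually allI less_imp_le)
    qed
    have ev: "\<forall>\<^sub>F j in sequentially. \<bar>s - x (B ^ Suc j)\<bar> \<le> (1 + 1 / real (Suc 0)) * phi (B ^ Suc j)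
       \<and> phi (B ^ Suc j) \<le> 2 / sqrt (real B) * phi (B ^ j)"
      using eventually_compose_filterlim[OF upS[of 0] fl] phi_block[OF B] by (rule eventually_conj)
    have fr2: "\<exists>\<^sub>F j in sequentially. \<tau> * phi (B ^ j) < g * (x (B ^ Suc j) - x (B ^ j)) \<and>
       (\<bar>s - x (B ^ Suc j)\<bar> \<le> (1 + 1 / real (Suc 0)) * phi (B ^ Suc j)
       \<and> phi (B ^ Suc j) \<le> 2 / sqrt (real B) * phi (B ^ j))"
      by (rule frequently_eventually_frequently[OF fr ev])
    show "\<exists>\<^sub>F n in sequentially. 1 - \<delta> < g * (1 / phi n * (s - x n))"
      unfolding frequently_sequentially
    proof
      fix N :: nat
      obtain j where j: "j \<ge> max N 16" "\<tau> * phi (B ^ j) < g * (x (B ^ Suc j) - x (B ^ j))"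
        "\<bar>s - x (B ^ Suc j)\<bar> \<le> (1 + 1 / real (Suc 0)) * phi (B ^ Suc j)"
        "phi (B ^ Suc j) \<le> 2 / sqrt (real B) * phi (B ^ j)"
        using fr2 unfolding frequently_sequentially by blast
      let ?n = "B ^ j"
      have n: "?n \<ge> N" "?n \<ge> 16" using pow[of j] j(1) by auto
      have p: "phi ?n > 0" by (rule phi_scale(2)[OF n(2)])
      have "\<bar>s - x (B ^ Suc j)\<bar> \<le> 4 / sqrt (real B) * phi ?n" using j(3,4) by simp
      then have "- (4 / sqrt (real B) * phi ?n) \<le> g * (s - x (B ^ Suc j))"
        using g_le(2)[of "s - x (B ^ Suc j)"] by linarith
      then have "\<tau> * phi ?n - 4 / sqrt (real B) * phi ?n < g * (x (B ^ Suc j) - x ?n) + g * (s - x (B ^ Suc j))"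
        using j(2) by linarith
      also have "\<dots> = g * (s - x ?n)" by (simp add: algebra_simps)
      finally have "(\<tau> - 4 / sqrt (real B)) * phi ?n < g * (s - x ?n)" by (simp add: left_diff_distrib)
      moreover have "(1 - \<delta>) * phi ?n < (\<tau> - 4 / sqrt (real B)) * phi ?n"
        using t p by (intro mult_strict_right_mono)
      ultimately have "(1 - \<delta>) * phi ?n < g * (s - x ?n)" by linarith
      then have "1 - \<delta> < g * (1 / phi ?n * (s - x ?n))" using p by (simp add: field_simps)
      then show "\<exists>n\<ge>N. 1 - \<delta> < g * (1 / phi n * (s - x n))" using n by blast
    qed
  qed
qed

end

section \<open>The normalised path length as a martingale\<close>

context tree_run
begin

lemma expT_spl: "n \<ge> 1 \<Longrightarrow> expT n spl = 0"
proof (induction n rule: nat_induct_at_least)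
  case (Suc n)
  have "expT (Suc n) spl = expT n spl"
    unfolding expT_Suc[OF Suc.hyps]
    by (intro expT_cong Suc.hyps) (auto simp: trees_def avg_add avg_const avg_yy)
  then show ?case using Suc by simp
qed (simp add: expT_1)

text \<open>The path length is the normaliser times \<open>spl\<close> plus a constant depending on
  \<open>n\<close> only. The constant disappears on centring, since \<open>spl\<close> has mean
  0.\<close>

lemma normalized_eq_spl:
  assumes n: "n \<ge> 1" and t: "T n \<omega> \<in> trees n"
  shows "normalized_path_length M \<beta> m T n \<omega> = spl (T n \<omega>)"
proof -
  have c: "real n - cc > 0" using n cc_less1 by linarith
  have pl: "real (path_length t) = (real n - cc) * spl t + ((real n - cc) * det_mean n + cc * (real n - 1))" if "t \<in> trees n" for t
    using that path_length_mu[OF reach_proper, of t] mu_eq_spl[OF reach_proper, of t] by (simp add: trees_def algebra_simps)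
  have "(\<integral>\<omega>. real (path_length (T n \<omega>)) \<partial>M) = expT n (\<lambda>t. (real n - cc) * spl t + ((real n - cc) * det_mean n + cc * (real n - 1)))"
    using expT_cong[OF n pl] by (simp add: expT_def)
  also have "\<dots> = (real n - cc) * det_mean n + cc * (real n - 1)"
    by (simp only: expT_add[OF n] expT_cmult[OF n] expT_const[OF n] expT_spl[OF n])
  finally have "normalized_path_length M \<beta> m T n \<omega> = (real n - cc) * spl (T n \<omega>) / (real n - cc)"
    using n pl[OF t] by (simp add: normalized_path_length_def cc_def[symmetric])
  then show ?thesis using c by simp
qed

lemma AE_normalized: "AE \<omega> in M. \<forall>n\<ge>1. normalized_path_length M \<beta> m T n \<omega> = spl (T n \<omega>)"
  using AE_path
proof eventually_elim
  case (elim \<omega>)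
  then show ?case using normalized_eq_spl path_trees by blast
qed

text \<open>Adaptedness requires a function of \<open>T n\<close> everywhere, not only almost
  surely, as null sets need not belong to the filtration.\<close>

lemma normalized_fun: "n \<ge> 1 \<Longrightarrow> \<exists>h. normalized_path_length M \<beta> m T n = (\<lambda>\<omega>. h (T n \<omega>))"
  by (intro exI[of _ "\<lambda>t. (real (path_length t) - (\<integral>\<omega>'. real (path_length (T n \<omega>')) \<partial>M)) / (real n - \<beta> / (\<beta> + real m))"])
     (auto simp: normalized_path_length_def)

lemma normalized_0: "normalized_path_length M \<beta> m T 0 = (\<lambda>_. 0)"
  by (simp add: normalized_path_length_def[abs_def])

lemma normalized_integrable: "integrable M (normalized_path_length M \<beta> m T n)"
proof (cases "n = 0")
  case False
  then obtain h where "normalized_path_length M \<beta> m T n = (\<lambda>\<omega>. h (T n \<omega>))" using normalized_fun[of n] by auto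
  then show ?thesis using False by (simp add: integrable_T)
qed (simp add: normalized_0)

section \<open>The filtration and conditional expectations\<close>

abbreviation "\<F> \<equiv> tree_filtration M T"
abbreviation "gens n \<equiv> {T i -` A \<inter> space M | i A. 1 \<le> i \<and> i \<le> n}"

lemma space_F: "space (\<F> n) = space M"
  unfolding tree_filtration_def by (rule space_measure_of) auto

lemma sets_F: "sets (\<F> n) = sigma_sets (space M) (gens n)"
  unfolding tree_filtration_def by (rule sets_measure_of) auto

lemma F_events: "sets (\<F> n) \<subseteq> events"
  unfolding sets_F
proof (rule sets.sigma_sets_subset, clarify)
  fix i :: nat and A assume "1 \<le> i"
  then show "T i -` A \<inter> space M \<in> events" using measurable_sets[OF random_tree, of i A] by simp
qed

lemma F_mono: "i \<le> j \<Longrightarrow> sets (\<F> i) \<subseteq> sets (\<F> j)"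
  unfolding sets_F by (intro sigma_sets_mono') fastforce

lemma T_measurable_F: "n \<ge> 1 \<Longrightarrow> T n \<in> measurable (\<F> n) (count_space UNIV)"
proof (rule measurableI)
  fix A :: "rec_tree set" assume "n \<ge> 1"
  then have "T n -` A \<inter> space M \<in> gens n" by blast
  then show "T n -` A \<inter> space (\<F> n) \<in> sets (\<F> n)" unfolding space_F sets_F by (rule sigma_sets.Basic)
qed simp

text \<open>Almost surely the last tree of a history determines the whole history.\<close>

lemma F_set_last_tree:
  assumes "A \<in> sets (\<F> n)" "n \<ge> 1"
  shows "\<exists>B. AE \<omega> in M. \<omega> \<in> A \<longleftrightarrow> T n \<omega> \<in> B"
  using assms(1) unfolding sets_F
proof (induction rule: sigma_sets.induct)
  case (Basic a)
  then obtain i C where a: "a = T i -` C \<inter> space M" "1 \<le> i" "i \<le> n" by auto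
  have "AE \<omega> in M. \<omega> \<in> a \<longleftrightarrow> T n \<omega> \<in> {t. anc t i \<in> C}"
    using AE_path AE_space
  proof eventually_elim
    case (elim \<omega>)
    from path_anc[OF elim(1) a(2,3)] show ?case using elim(2) by (simp add: a(1))
  qed
  then show ?case by blast
next
  case Empty
  show ?case by (rule exI[of _ "{}"]) simp
next
  case (Compl a)
  then obtain B where "AE \<omega> in M. \<omega> \<in> a \<longleftrightarrow> T n \<omega> \<in> B" by auto
  with AE_space have "AE \<omega> in M. \<omega> \<in> space M - a \<longleftrightarrow> T n \<omega> \<in> - B" by eventually_elim auto
  then show ?case by blast
next
  case (Union a)
  then have "\<forall>k. \<exists>B. AE \<omega> in M. \<omega> \<in> a k \<longleftrightarrow> T n \<omega> \<in> B" by blast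
  then obtain B where "\<And>k. AE \<omega> in M. \<omega> \<in> a k \<longleftrightarrow> T n \<omega> \<in> B k" by metis
  then have "AE \<omega> in M. \<forall>k. \<omega> \<in> a k \<longleftrightarrow> T n \<omega> \<in> B k" by (simp add: AE_all_countable)
  then have "AE \<omega> in M. \<omega> \<in> (\<Union>k. a k) \<longleftrightarrow> T n \<omega> \<in> (\<Union>k. B k)" by eventually_elim auto
  then show ?case by blast
qed

text \<open>Up to a null set the event is a condition on \<open>T i\<close>, hence on the stage
  \<open>anc t i\<close> of every later tree. Such a condition is unaffected by an attachment, and
  \<open>yy\<close> averages to 0.\<close>

lemma set_integral_normalized:
  assumes A: "A \<in> sets (\<F> i)" and i: "1 \<le> i" "i \<le> j"
  shows "(\<integral>\<omega>\<in>A. normalized_path_length M \<beta> m T j \<omega> \<partial>M) = (\<integral>\<omega>\<in>A. normalized_path_length M \<beta> m T i \<omega> \<partial>M)"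
proof -
  obtain B where B: "AE \<omega> in M. \<omega> \<in> A \<longleftrightarrow> T i \<omega> \<in> B" using F_set_last_tree[OF A i(1)] by auto
  have AM: "A \<in> events" using A F_events by blast
  define f where "f t = (if anc t i \<in> B then spl t else 0)" for t
  have eq: "(\<integral>\<omega>\<in>A. normalized_path_length M \<beta> m T k \<omega> \<partial>M) = expT k f" if k: "i \<le> k" for k
    unfolding set_lebesgue_integral_def expT_def
  proof (rule integral_cong_AE)
    have k1: "k \<ge> 1" using k i by simp
    show "(\<lambda>\<omega>. indicat_real A \<omega> *\<^sub>R normalized_path_length M \<beta> m T k \<omega>) \<in> borel_measurable M"
      using AM borel_measurable_integrable[OF normalized_integrable[of k]] by measurable
    show "(\<lambda>\<omega>. f (T k \<omega>)) \<in> borel_measurable M" by (rule T_borel[OF k1])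
    show "AE \<omega> in M. indicat_real A \<omega> *\<^sub>R normalized_path_length M \<beta> m T k \<omega> = f (T k \<omega>)"
      using AE_path AE_normalized B
    proof eventually_elim
      case (elim \<omega>)
      from path_anc[OF elim(1) i(1) k] have "anc (T k \<omega>) i = T i \<omega>" by simp
      then show ?case using elim(2,3) k1 by (simp add: f_def indicator_def)
    qed
  qed
  have "expT j f = expT i f"
    using i(2)
  proof (induction j rule: dec_induct)
    case (step k)
    have k1: "k \<ge> 1" using step i by simp
    have "expT (Suc k) f = expT k f"
      unfolding expT_Suc[OF k1]
    proof (intro expT_cong k1)
      fix t assume "t \<in> trees k"
      then have t: "reach t" "num_nodes t = k" by (auto simp: trees_def)
      show "avg t (\<lambda>v. f (Attach t v)) = f t"
        using t step by (simp add: f_def avg_add avg_const[OF t(1)] avg_yy[OF t(1)])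
    qed
    then show ?case using step by simp
  qed simp
  then show ?thesis using eq i by simp
qed

lemma martingale_normalized: "martingale M \<F> (normalized_path_length M \<beta> m T)"
proof -
  let ?S = "normalized_path_length M \<beta> m T"
  have sub: "subalgebra M (\<F> n)" for n using F_events space_F by (simp add: subalgebra_def)
  have meas: "?S n \<in> borel_measurable (\<F> n)" for n
  proof (cases "n = 0")
    case False
    then obtain h where h: "?S n = (\<lambda>\<omega>. h (T n \<omega>))" using normalized_fun[of n] by auto
    show ?thesis unfolding h by (rule measurable_compose[OF T_measurable_F]) (use False in auto)
  qed (simp add: normalized_0)
  have "AE \<omega> in M. real_cond_exp M (\<F> i) (?S j) \<omega> = ?S i \<omega>" if ij: "i \<le> j" for i j
  proof -
    interpret F: finite_measure_subalgebra M "\<F> i" by unfold_locales (rule sub)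
    show ?thesis
    proof (rule F.real_cond_exp_charact)
      fix A assume A: "A \<in> sets (\<F> i)"
      show "(\<integral>\<omega>\<in>A. ?S j \<omega> \<partial>M) = (\<integral>\<omega>\<in>A. ?S i \<omega> \<partial>M)"
      proof (cases "i = 0")
        case False
        then show ?thesis using set_integral_normalized[OF A _ ij] by simp
      next
        \<comment> \<open>At index 0 the process is 0 by definition and no tree is available. The
          event also belongs to index 1, where the process vanishes almost surely because the tree
          is the root.\<close>
        case True
        show ?thesis
        proof (cases "j = 0")
          case False
          have A1: "A \<in> sets (\<F> 1)" using A F_mono[of i 1] True by auto
          then have AM: "A \<in> events" using F_events by blast
          have "(\<integral>\<omega>\<in>A. ?S j \<omega> \<partial>M) = (\<integral>\<omega>\<in>A. ?S 1 \<omega> \<partial>M)"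
            using False by (intro set_integral_normalized A1) auto
          also have "\<dots> = (\<integral>\<omega>\<in>A. 0 \<partial>M)"
            unfolding set_lebesgue_integral_def
          proof (rule integral_cong_AE)
            show "AE \<omega> in M. indicat_real A \<omega> *\<^sub>R ?S 1 \<omega> = indicat_real A \<omega> *\<^sub>R 0"
              using AE_normalized initial by eventually_elim simp
            show "(\<lambda>\<omega>. indicat_real A \<omega> *\<^sub>R ?S 1 \<omega>) \<in> borel_measurable M"
              using AM borel_measurable_integrable[OF normalized_integrable[of 1]] by measurable
          qed simp
          finally show ?thesis using True by (simp add: normalized_0)
        qed (use True in simp)
      qed
    qed (use normalized_integrable meas in auto)
  qed
  moreover have "filtration (space M) \<F>"
    by unfold_locales (auto simp: space_F F_mono)
  ultimately show ?thesis unfolding martingale_def using sub meas normalized_integrable by auto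
qed

lemma Lp_bounded_normalized: "Lp_bounded M 2 (normalized_path_length M \<beta> m T)"
proof -
  let ?S = "normalized_path_length M \<beta> m T"
  obtain C where C: "\<And>n. n \<ge> 1 \<Longrightarrow> expT n (\<lambda>t. (spl t)\<^sup>2) \<le> C" using expT_spl2 by auto
  have "(\<integral>\<^sup>+\<omega>. ennreal (\<bar>?S n \<omega>\<bar> powr 2) \<partial>M) \<le> ennreal C" for n
  proof (cases "n = 0")
    case False
    then have n: "n \<ge> 1" by simp
    have "(\<integral>\<^sup>+\<omega>. ennreal (\<bar>?S n \<omega>\<bar> powr 2) \<partial>M) = (\<integral>\<^sup>+\<omega>. ennreal ((spl (T n \<omega>))\<^sup>2) \<partial>M)"
      by (rule nn_integral_cong_AE) (use AE_normalized in eventually_elim, use n in simp)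
    also have "\<dots> = ennreal (expT n (\<lambda>t. (spl t)\<^sup>2))"
      unfolding expT_def by (rule nn_integral_eq_integral) (use integrable_T[OF n, of "\<lambda>t. (spl t)\<^sup>2"] in auto)
    also have "\<dots> \<le> ennreal C" using C[OF n] by (rule ennreal_leI)
    finally show ?thesis .
  qed (simp add: normalized_0)
  then have "(SUP n. \<integral>\<^sup>+\<omega>. ennreal (\<bar>?S n \<omega>\<bar> powr 2) \<partial>M) \<le> ennreal C" by (intro SUP_least)
  also have "\<dots> < \<infinity>" by simp
  finally show ?thesis by (simp add: Lp_bounded_def)
qed

text \<open>The upper half of the iterated logarithm law already makes almost every path Cauchy, as
  its bound tends to 0. The shifted index avoids \<open>T 0\<close>, which may fail to be
  measurable.\<close>

lemma AE_convergent_spl: "AE \<omega> in M. convergent (\<lambda>n. spl (T (Suc n) \<omega>))"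
  using AE_lil_upper[of 1, simplified]
proof eventually_elim
  case (elim \<omega>)
  have "Cauchy (\<lambda>n. spl (T n \<omega>))"
  proof (rule metric_CauchyI)
    fix e :: real assume "0 < e"
    have "(\<lambda>n. 2 * phi n) \<longlonglongrightarrow> 2 * 0" by (intro tendsto_intros phi_tendsto_0)
    then have "\<forall>\<^sub>F n in sequentially. 2 * phi n < e / 2" by (rule order_tendstoD(2)) (use \<open>0 < e\<close> in simp)
    with elim have "\<forall>\<^sub>F n in sequentially. \<forall>k\<ge>n. \<bar>spl (T k \<omega>) - spl (T n \<omega>)\<bar> < e / 2"
      by eventually_elim force
    then obtain N where N: "\<And>k. k \<ge> N \<Longrightarrow> \<bar>spl (T k \<omega>) - spl (T N \<omega>)\<bar> < e / 2"
      by (auto simp: eventually_sequentially)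
    show "\<exists>N. \<forall>i\<ge>N. \<forall>j\<ge>N. dist (spl (T i \<omega>)) (spl (T j \<omega>)) < e"
    proof (intro exI[of _ N] allI impI)
      fix i j assume "N \<le> i" "N \<le> j"
      from N[OF this(1)] N[OF this(2)] show "dist (spl (T i \<omega>)) (spl (T j \<omega>)) < e"
        unfolding dist_real_def abs_less_iff by linarith
    qed
  qed
  then have "convergent (\<lambda>n. spl (T n \<omega>))" by (simp add: Cauchy_convergent_iff)
  then obtain l where "(\<lambda>n. spl (T n \<omega>)) \<longlonglongrightarrow> l" by (auto simp: convergent_def)
  from LIMSEQ_Suc[OF this] show ?case by (auto simp: convergent_def)
qed

text \<open>\<open>sequence_lil\<close> asks for every \<open>\<delta> > 0\<close>. Fixing one
  choice of parameters for each \<open>1 / (i + 1)\<close> beforehand leaves countably many null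
  sets.\<close>

lemma AE_lil:
  assumes lim: "AE \<omega> in M. (\<lambda>n. spl (T n \<omega>)) \<longlonglongrightarrow> S \<omega>" and g: "\<bar>g\<bar> = (1::real)"
  shows "AE \<omega> in M. limsup (\<lambda>n. ereal (g * (1 / phi n * (S \<omega> - spl (T n \<omega>))))) = 1"
proof -
  have up: "AE \<omega> in M. \<forall>i. \<forall>\<^sub>F n in sequentially. \<forall>k\<ge>n. \<bar>spl (T k \<omega>) - spl (T n \<omega>)\<bar> \<le> (1 + 1 / real (Suc i)) * phi n"
    unfolding AE_all_countable by (intro allI AE_lil_upper) simp
  define good_par where "good_par i p \<longleftrightarrow> 0 < fst p \<and> fst p \<le> 1/2 \<and> snd p > 2 \<and>
    1 - 1 / real (Suc i) < (1 - fst p) * sqrt ((1 - fst p) / (1 + 4 * fst p) * (1 - 2 / real (snd p))) - 4 / sqrt (real (snd p))"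
    for i and p :: "real \<times> nat"
  have "\<exists>p. good_par i p" for i
    using lil_parameters[of "1 / real (Suc i)"] unfolding good_par_def by (metis fst_conv snd_conv zero_less_divide_1_iff of_nat_0_less_iff zero_less_Suc)
  then obtain p where p: "\<And>i. good_par i (p i)" by metis
  let ?\<tau> = "\<lambda>i. (1 - fst (p i)) * sqrt ((1 - fst (p i)) / (1 + 4 * fst (p i)) * (1 - 2 / real (snd (p i))))"
  have "AE \<omega> in M. \<forall>i. \<exists>\<^sub>F j in sequentially. ?\<tau> i * phi (snd (p i) ^ j) < g * (spl (T (snd (p i) ^ Suc j) \<omega>) - spl (T (snd (p i) ^ j) \<omega>))"
    unfolding AE_all_countable using p[unfolded good_par_def] g by (intro allI AE_large_blocks) auto
  with up lim show ?thesis
  proof eventually_elim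
    case (elim \<omega>)
    show ?case
    proof (rule sequence_lil[OF elim(2) _ _ g])
      show "\<forall>\<^sub>F n in sequentially. \<forall>k\<ge>n. \<bar>spl (T k \<omega>) - spl (T n \<omega>)\<bar> \<le> (1 + 1 / real (Suc i)) * phi n" for i
        using elim(1) by blast
      fix \<delta> :: real assume "\<delta> > 0"
      then obtain i where "1 / real (Suc i) < \<delta>" using nat_approx_posE by blast
      then show "\<exists>B::nat. B > 2 \<and> (\<exists>\<tau>. 1 - \<delta> < \<tau> - 4 / sqrt (real B) \<and>
        (\<exists>\<^sub>F j in sequentially. \<tau> * phi (B ^ j) < g * (spl (T (B ^ Suc j) \<omega>) - spl (T (B ^ j) \<omega>))))"
        using p[of i, unfolded good_par_def] elim(3) by (intro exI[of _ "snd (p i)"] conjI exI[of _ "?\<tau> i"]) auto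
    qed
  qed
qed

end

theorem theorem1:
  fixes M :: "'a measure" and \<beta> :: real and m :: nat
    and T :: "nat \<Rightarrow> 'a \<Rightarrow> rec_tree" and S :: "nat \<Rightarrow> 'a \<Rightarrow> real"
  assumes params: "(0 \<le> \<beta> \<and> m = 1) \<or> (\<beta> = -1 \<and> m > 1)"
    and trees: "random_tree_sequence M \<beta> m T"
    and S_def: "S = normalized_path_length M \<beta> m T"
  shows "martingale M (tree_filtration M T) S \<and> Lp_bounded M 2 S \<and>
    (\<exists>S_lim \<in> borel_measurable M.
      (AE \<omega> in M. (\<lambda>n. S n \<omega>) \<longlonglongrightarrow> S_lim \<omega>) \<and>
      weak_conv_m
        (\<lambda>n. distr M borel (\<lambda>\<omega>. sqrt ((\<beta> + real m) / real m) * sqrt (real n / ln (real n)) *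
           (S n \<omega> - S_lim \<omega>)))
        std_normal_distribution \<and>
      (AE \<omega> in M. limsup (\<lambda>n. ereal (sqrt ((\<beta> + real m) / (2 * real m)) *
           sqrt (real n / (ln (real n) * ln (ln (real n)))) * (S n \<omega> - S_lim \<omega>))) = 1) \<and>
      (AE \<omega> in M. liminf (\<lambda>n. ereal (sqrt ((\<beta> + real m) / (2 * real m)) *
           sqrt (real n / (ln (real n) * ln (ln (real n)))) * (S n \<omega> - S_lim \<omega>))) = -1))"
proof -
  interpret random_tree_sequence M \<beta> m T by (rule trees)
  interpret tree_run M \<beta> m T by unfold_locales (rule params)
  define L where "L \<omega> = lim (\<lambda>n. spl (T (Suc n) \<omega>))" for \<omega>
  have L [measurable]: "L \<in> borel_measurable M"
    unfolding L_def[abs_def] by (intro borel_measurable_lim_metric T_borel) simp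
  have lim: "AE \<omega> in M. (\<lambda>n. spl (T n \<omega>)) \<longlonglongrightarrow> L \<omega>"
    using AE_convergent_spl
  proof eventually_elim
    case (elim \<omega>)
    then have "(\<lambda>n. spl (T (Suc n) \<omega>)) \<longlonglongrightarrow> L \<omega>" unfolding L_def by (simp add: convergent_LIMSEQ_iff)
    then show ?case by (rule LIMSEQ_imp_Suc)
  qed
  have SN: "AE \<omega> in M. \<forall>n\<ge>1. S n \<omega> = spl (T n \<omega>)" unfolding S_def by (rule AE_normalized)
  have S_meas [measurable]: "S n \<in> borel_measurable M" for n
    unfolding S_def using normalized_integrable by (rule borel_measurable_integrable)
  let ?X = "\<lambda>n \<omega>. sqrt ((\<beta> + real m) / (2 * real m)) * sqrt (real n / (ln (real n) * ln (ln (real n)))) * (S n \<omega> - L \<omega>)"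
  show ?thesis
  proof (intro conjI bexI[of _ L] L)
    show "martingale M (tree_filtration M T) S" "Lp_bounded M 2 S"
      unfolding S_def by (rule martingale_normalized Lp_bounded_normalized)+
    show "AE \<omega> in M. (\<lambda>n. S n \<omega>) \<longlonglongrightarrow> L \<omega>"
      using lim SN
    proof eventually_elim
      case (elim \<omega>)
      have "\<forall>\<^sub>F n in sequentially. spl (T n \<omega>) = S n \<omega>"
        using eventually_ge_at_top[of 1] by eventually_elim (use elim(2) in simp)
      then show ?case by (rule Lim_transform_eventually[OF elim(1)])
    qed
    show "weak_conv_m (\<lambda>n. distr M borel (\<lambda>\<omega>. sqrt ((\<beta> + real m) / real m) * sqrt (real n / ln (real n)) * (S n \<omega> - L \<omega>))) std_normal_distribution"
    proof (rule clt[OF L lim])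
      fix n assume n: "n \<ge> K0"
      have "real n > 0" "ln (real n) > 0" "real m > 0" "\<beta> + real m > 0" using n K0(1) params bm_pos by auto
      then have "(\<beta> + real m) / real m * (real n / ln (real n)) = 1 / (lam * hh n)"
        by (simp add: lam_def hh_def)
      then have eq: "sqrt ((\<beta> + real m) / real m) * sqrt (real n / ln (real n)) = 1 / sqrt (lam * hh n)"
        unfolding real_sqrt_mult[symmetric] by (simp only: real_sqrt_divide real_sqrt_one)
      show "AE \<omega> in M. sqrt ((\<beta> + real m) / real m) * sqrt (real n / ln (real n)) * (S n \<omega> - L \<omega>) = 1 / sqrt (lam * hh n) * (spl (T n \<omega>) - L \<omega>)"
        using SN
      proof eventually_elim
        case (elim \<omega>)
        have "S n \<omega> = spl (T n \<omega>)" using elim n K0(1) by simp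
        then show ?case by (simp only: eq)
      qed
    qed measurable
    \<comment> \<open>\<open>AE_lil\<close> treats the limit minus the process. The reversed sign
      means that \<open>g = -1\<close> gives the limsup and \<open>g = 1\<close> the liminf.\<close>
    have minus: "\<bar>- 1 :: real\<bar> = 1" by simp
    have ev: "\<forall>\<^sub>F n in sequentially. ?X n \<omega>
        = - (1 / phi n * (L \<omega> - spl (T n \<omega>)))" if "\<forall>n\<ge>1. S n \<omega> = spl (T n \<omega>)" for \<omega>
      using eventually_ge_at_top[of 16]
    proof eventually_elim
      case (elim n)
      have "S n \<omega> = spl (T n \<omega>)" using that elim by simp
      then show ?case unfolding phi_scale(1)[OF elim] by (simp add: algebra_simps)
    qed
    show "AE \<omega> in M. limsup (\<lambda>n. ereal (?X n \<omega>)) = 1"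
      using AE_lil[OF lim minus] SN
    proof eventually_elim
      case (elim \<omega>)
      have "limsup (\<lambda>n. ereal (?X n \<omega>)) = limsup (\<lambda>n. ereal (-1 * (1 / phi n * (L \<omega> - spl (T n \<omega>)))))"
        by (rule Limsup_eq) (use ev[OF elim(2)] in \<open>eventually_elim, simp only: mult_minus1\<close>)
      then show ?case unfolding elim(1) .
    qed
    show "AE \<omega> in M. liminf (\<lambda>n. ereal (?X n \<omega>)) = -1"
      using AE_lil[OF lim, of 1, simplified] SN
    proof eventually_elim
      case (elim \<omega>)
      have "liminf (\<lambda>n. ereal (?X n \<omega>)) = liminf (\<lambda>n. - ereal (1 / phi n * (L \<omega> - spl (T n \<omega>))))"
        by (rule Liminf_eq) (use ev[OF elim(2)] in eventually_elim, simp)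
      also have "\<dots> = - 1" unfolding ereal_Liminf_uminus using elim(1) by simp
      finally show ?case .
    qed
  qed
qed

end
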